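(* Let $p\neq 2$ be a prime, let $k$ be a field of characteristic $p$, let $P_1,P_2$ be finite $p$-groups, and write $P:=P_1\times P_2$. Then $\operatorname{HH}^1(kP)$ is solvable as a Lie algebra if and only if both $\operatorname{HH}^1(kP_1)$ and $\operatorname{HH}^1(kP_2)$ are solvable as Lie algebras.
   Context: For a $k$-algebra $A$, $\operatorname{HH}^1(A)=\operatorname{Der}(A)/\operatorname{InnDer}(A)$, where $\operatorname{Der}(A)$ is the Lie algebra of $k$-linear derivations $A\to A$ with the commutator bracket and $\operatorname{InnDer}(A)$ is the ideal of derivations $a\mapsto xa-ax$ with $x\in A$; this quotient is a Lie algebra. *)

theory Defs
  imports "HOL-Computational_Algebra.Primes" "HOL-Algebra.Module" "HOL-Algebra.QuotRing"
begin

text \<open>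
  Associative \<open>K\<close>-algebras and Lie algebras over \<open>K\<close> are both represented by the record
  type \<^type>\<open>module\<close>, whose scalars come from the ring \<open>K\<close>. In a Lie algebra the field
  \<^const>\<open>mult\<close> is the Lie bracket and the field \<^const>\<open>one\<close> carries no meaning.
\<close>

definition ring_characteristic :: "('k, 'm) ring_scheme \<Rightarrow> nat" where
  "ring_characteristic R =
     (if \<exists>n::nat. 0 < n \<and> [n] \<cdot>\<^bsub>R\<^esub> \<one>\<^bsub>R\<^esub> = \<zero>\<^bsub>R\<^esub>
      then LEAST n::nat. 0 < n \<and> [n] \<cdot>\<^bsub>R\<^esub> \<one>\<^bsub>R\<^esub> = \<zero>\<^bsub>R\<^esub> else 0)"

definition finite_p_group :: "nat \<Rightarrow> ('g, 'n) monoid_scheme \<Rightarrow> bool" where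
  "finite_p_group p G \<longleftrightarrow> group G \<and> finite (carrier G) \<and> (\<exists>n::nat. order G = p ^ n)"


section \<open>Group algebras\<close>

text \<open>
  An element \<open>\<Sum>g. u g \<cdot> g\<close> of the group algebra is the function \<open>u\<close>; it is \<open>undefined\<close>
  outside the carrier of the group. The product is the convolution
  \<open>(u v) g = (\<Sum>x. u x \<cdot> v (x\<^sup>-\<^sup>1 g))\<close>, where \<open>x\<close> need only range over the finite support
  of \<open>u\<close>.
\<close>
definition group_algebra ::
  "('k, 'm) ring_scheme \<Rightarrow> ('g, 'n) monoid_scheme \<Rightarrow> ('k, 'g \<Rightarrow> 'k) module" where
  "group_algebra K G =
    \<lparr>carrier = {u \<in> carrier G \<rightarrow>\<^sub>E carrier K. finite {g \<in> carrier G. u g \<noteq> \<zero>\<^bsub>K\<^esub>}},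
     mult = (\<lambda>u v. \<lambda>g\<in>carrier G.
       \<Oplus>\<^bsub>K\<^esub>x\<in>{x \<in> carrier G. u x \<noteq> \<zero>\<^bsub>K\<^esub>}. u x \<otimes>\<^bsub>K\<^esub> v (inv\<^bsub>G\<^esub> x \<otimes>\<^bsub>G\<^esub> g)),
     one = (\<lambda>g\<in>carrier G. if g = \<one>\<^bsub>G\<^esub> then \<one>\<^bsub>K\<^esub> else \<zero>\<^bsub>K\<^esub>),
     zero = (\<lambda>g\<in>carrier G. \<zero>\<^bsub>K\<^esub>),
     add = (\<lambda>u v. \<lambda>g\<in>carrier G. u g \<oplus>\<^bsub>K\<^esub> v g),
     smult = (\<lambda>c u. \<lambda>g\<in>carrier G. c \<otimes>\<^bsub>K\<^esub> u g)\<rparr>"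


section \<open>Lie algebras\<close>

definition module_span :: "('k, 'm) ring_scheme \<Rightarrow> ('k, 'a, 'n) module_scheme \<Rightarrow> 'a set \<Rightarrow> 'a set"
  where "module_span K M S = \<Inter>{H. submodule H K M \<and> S \<subseteq> H}"

definition lie_derived :: "('k, 'm) ring_scheme \<Rightarrow> ('k, 'a, 'n) module_scheme \<Rightarrow> 'a set \<Rightarrow> 'a set"
  where "lie_derived K L H = module_span K L {x \<otimes>\<^bsub>L\<^esub> y | x y. x \<in> H \<and> y \<in> H}"

definition lie_solvable :: "('k, 'm) ring_scheme \<Rightarrow> ('k, 'a, 'n) module_scheme \<Rightarrow> bool" where
  "lie_solvable K L \<longleftrightarrow> (\<exists>n::nat. (lie_derived K L ^^ n) (carrier L) = {\<zero>\<^bsub>L\<^esub>})"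

text \<open>
  The quotient by a Lie ideal \<open>I\<close>, on the cosets \<open>I +> x\<close>. As for \<^const>\<open>FactRing\<close>, the
  operations are given by unions over all representatives, so that
  \<open>c \<odot> (I +> x) = I +> (c \<odot> x)\<close> and \<open>(I +> x) \<otimes> (I +> y) = I +> (x \<otimes> y)\<close>.
\<close>
definition lie_quotient :: "('k, 'a, 'n) module_scheme \<Rightarrow> 'a set \<Rightarrow> ('k, 'a set) module" where
  "lie_quotient L I =
    \<lparr>carrier = a_rcosets\<^bsub>L\<^esub> I,
     mult = rcoset_mult L I,
     one = undefined,
     zero = I,
     add = set_add L,
     smult = (\<lambda>c X. \<Union>x\<in>X. I +>\<^bsub>L\<^esub> (c \<odot>\<^bsub>L\<^esub> x))\<rparr>"


section \<open>Derivations and first Hochschild cohomology\<close>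

text \<open>
  Maps \<open>A \<rightarrow> A\<close> are taken to be \<open>undefined\<close> outside the carrier, so that two derivations are
  equal if and only if they agree on the carrier.
\<close>
definition derivations ::
  "('k, 'm) ring_scheme \<Rightarrow> ('k, 'a, 'n) module_scheme \<Rightarrow> ('a \<Rightarrow> 'a) set" where
  "derivations K A =
    {d \<in> carrier A \<rightarrow>\<^sub>E carrier A.
      (\<forall>x\<in>carrier A. \<forall>y\<in>carrier A. d (x \<oplus>\<^bsub>A\<^esub> y) = d x \<oplus>\<^bsub>A\<^esub> d y) \<and>
      (\<forall>c\<in>carrier K. \<forall>x\<in>carrier A. d (c \<odot>\<^bsub>A\<^esub> x) = c \<odot>\<^bsub>A\<^esub> d x) \<and>
      (\<forall>x\<in>carrier A. \<forall>y\<in>carrier A. d (x \<otimes>\<^bsub>A\<^esub> y) = (d x \<otimes>\<^bsub>A\<^esub> y) \<oplus>\<^bsub>A\<^esub> (x \<otimes>\<^bsub>A\<^esub> d y))}"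

definition Der ::
  "('k, 'm) ring_scheme \<Rightarrow> ('k, 'a, 'n) module_scheme \<Rightarrow> ('k, 'a \<Rightarrow> 'a) module" where
  "Der K A =
    \<lparr>carrier = derivations K A,
     mult = (\<lambda>d e. \<lambda>x\<in>carrier A. d (e x) \<ominus>\<^bsub>A\<^esub> e (d x)),
     one = undefined,
     zero = (\<lambda>x\<in>carrier A. \<zero>\<^bsub>A\<^esub>),
     add = (\<lambda>d e. \<lambda>x\<in>carrier A. d x \<oplus>\<^bsub>A\<^esub> e x),
     smult = (\<lambda>c d. \<lambda>x\<in>carrier A. c \<odot>\<^bsub>A\<^esub> d x)\<rparr>"

definition InnDer :: "('k, 'a, 'n) module_scheme \<Rightarrow> ('a \<Rightarrow> 'a) set" where
  "InnDer A = {\<lambda>a\<in>carrier A. (x \<otimes>\<^bsub>A\<^esub> a) \<ominus>\<^bsub>A\<^esub> (a \<otimes>\<^bsub>A\<^esub> x) | x. x \<in> carrier A}"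

definition HH1 ::
  "('k, 'm) ring_scheme \<Rightarrow> ('k, 'a, 'n) module_scheme \<Rightarrow> ('k, ('a \<Rightarrow> 'a) set) module" where
  "HH1 K A = lie_quotient (Der K A) (InnDer A)"

end

theory Submission
  imports "HOL-Algebra.Multiplicative_Group" "HOL-Algebra.Group_Action" Defs
begin

text \<open>
  Write \<open>A = kP1\<close>, \<open>B = kP2\<close> and \<open>C = k(P1 \<times> P2) = A \<otimes> B\<close>, let \<open>Z\<close> denote centres, and let
  \<open>\<epsilon>\<close> be the augmentation, which sends every group element to \<open>1\<close>.

  The derivations of \<open>C\<close> are known modulo inner ones: they are sums of \<open>Z(C)\<close>-multiples of the
  derivations \<open>d \<otimes> 1\<close> and \<open>1 \<otimes> e\<close> that come from the two factors (lemma
  \<open>derivation_decomposition\<close>). This is the Kuenneth formula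
  \<open>HH1(A \<otimes> B) = HH1(A) \<otimes> Z(B) \<oplus> Z(A) \<otimes> HH1(B)\<close>, in the form that the argument needs.
  For group algebras it can be made explicit: a derivation of \<open>C\<close> has one component for each element
  of the other factor, components at conjugate elements differ by an inner derivation, and therefore
  class sums suffice as coefficients. As \<open>d \<mapsto> d \<otimes> 1\<close> is an injective Lie homomorphism
  \<open>HH1(A) \<rightarrow> HH1(C)\<close>, solvability of \<open>HH1(C)\<close> passes to both factors (lemma \<open>solvable_factor\<close>).

  For the converse the point is that, for odd \<open>p\<close>, solvability of \<open>HH1(A)\<close> forces
  \<open>\<epsilon> (d z) = 0\<close> for each derivation \<open>d\<close> and each central \<open>z\<close> (lemma \<open>aug_derivation_central\<close>).
  The augmentation ideal of a \<open>p\<close>-group in characteristic \<open>p\<close> is nilpotent (lemma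
  \<open>augmentation_ideal_nilpotent\<close>), so if \<open>\<epsilon> (d z) \<noteq> 0\<close> then the central element \<open>d z\<close> is
  invertible, and \<open>e = (d z)\<^sup>-\<^sup>1 d\<close> satisfies \<open>e z = 1\<close>. Then
  \<open>[e, z e] = e\<close>, \<open>[e, z\<^sup>2 e] = 2 z e\<close> and \<open>[z e, z\<^sup>2 e] = z\<^sup>2 e\<close>; since \<open>2\<close> is invertible,
  these three derivations span a perfect Lie algebra, which survives in every term of the derived
  series. But \<open>e\<close> is not inner, because inner derivations kill \<open>z\<close>. This is the only use of
  \<open>p \<noteq> 2\<close>. For \<open>p = 2\<close> and the group of order two, \<open>HH1\<close> is solvable although \<open>\<partial>/\<partial>z\<close>
  is a derivation of \<open>k[z]/(z\<^sup>2)\<close>.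

  Now let \<open>HH1(A)\<close> and \<open>HH1(B)\<close> be solvable, and let \<open>M\<close> consist of the \<open>z\<close> in \<open>Z(C)\<close> with
  \<open>\<epsilon> z = 0\<close>. By the previous paragraph and the decomposition, each derivation of \<open>C\<close> maps \<open>Z(C)\<close>
  into \<open>M\<close>. From \<open>[z d, w e] = z (d w) e - w (e z) d + z w [d, e]\<close> one sees that the spaces
  \<open>M\<^sup>a Der(C)\<close> satisfy \<open>[M\<^sup>a Der(C), M\<^sup>b Der(C)] \<subseteq> M\<^sup>a\<^sup>+\<^sup>b Der(C)\<close>, and
  \<open>M\<^sup>n = 0\<close> for large \<open>n\<close>; so \<open>M Der(C)\<close> is nilpotent modulo inner derivations. Modulo
  \<open>M Der(C)\<close> and inner derivations, all central coefficients become scalars, so what remains is an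
  image of \<open>HH1(A) \<oplus> HH1(B)\<close>, which is solvable (lemma \<open>solvable_product\<close>).
\<close>

section \<open>Solvability of a quotient by descending chains\<close>

text \<open>
  Solvability is expressed by chains of subspaces in which each bracket of elements of one term lies
  in the next one. Unlike derived series, such chains can be pulled back, pushed forward and
  concatenated. Chains are reflexive transitive closures of a single step, so that the index of a
  term never has to be mentioned.
\<close>
definition lie_step :: "('k, 'm) ring_scheme \<Rightarrow> ('k, 'a, 'n) module_scheme \<Rightarrow> 'a set \<Rightarrow> 'a set \<Rightarrow> bool"
  where "lie_step K L X Y \<longleftrightarrow>
    submodule X K L \<and> submodule Y K L \<and> (\<forall>x\<in>X. \<forall>y\<in>X. x \<otimes>\<^bsub>L\<^esub> y \<in> Y)"

text \<open>
  This expresses solvability of the quotient by \<open>I\<close> inside \<open>L\<close> itself, see \<open>lie_solvable_quotient_iff\<close>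
  below.
\<close>
definition solvable_modulo :: "('k, 'm) ring_scheme \<Rightarrow> ('k, 'a, 'n) module_scheme \<Rightarrow> 'a set \<Rightarrow> bool"
  where "solvable_modulo K L I \<longleftrightarrow> (\<exists>Y. (lie_step K L)\<^sup>*\<^sup>* (carrier L) Y \<and> Y \<subseteq> I)"

context module
begin

lemma submodule_add: "\<lbrakk>submodule H R M; x \<in> H; y \<in> H\<rbrakk> \<Longrightarrow> x \<oplus>\<^bsub>M\<^esub> y \<in> H"
  and submodule_zero: "submodule H R M \<Longrightarrow> \<zero>\<^bsub>M\<^esub> \<in> H"
  and submodule_neg: "\<lbrakk>submodule H R M; x \<in> H\<rbrakk> \<Longrightarrow> \<ominus>\<^bsub>M\<^esub> x \<in> H"
  and submodule_smult: "\<lbrakk>submodule H R M; c \<in> carrier R; x \<in> H\<rbrakk> \<Longrightarrow> c \<odot>\<^bsub>M\<^esub> x \<in> H"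
  and submodule_subset: "submodule H R M \<Longrightarrow> H \<subseteq> carrier M"
  using submoduleE[of H] subgroup.one_closed[of H "add_monoid M"] submodule.axioms(1)[of H R M]
  by auto

lemma submoduleI':
  assumes "H \<subseteq> carrier M" "\<zero>\<^bsub>M\<^esub> \<in> H" "\<And>x y. \<lbrakk>x \<in> H; y \<in> H\<rbrakk> \<Longrightarrow> x \<oplus>\<^bsub>M\<^esub> y \<in> H"
    "\<And>c x. \<lbrakk>c \<in> carrier R; x \<in> H\<rbrakk> \<Longrightarrow> c \<odot>\<^bsub>M\<^esub> x \<in> H"
  shows "submodule H R M"
proof (rule submoduleI)
  fix a assume "a \<in> H"
  moreover from this have "\<ominus>\<^bsub>M\<^esub> a = (\<ominus>\<^bsub>R\<^esub> \<one>\<^bsub>R\<^esub>) \<odot>\<^bsub>M\<^esub> a"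
    using assms(1) by (auto simp: smult_l_minus)
  ultimately show "\<ominus>\<^bsub>M\<^esub> a \<in> H" using assms(4) by simp
qed (use assms in auto)

lemma module_span_submodule:
  assumes "S \<subseteq> carrier M"
  shows "submodule (module_span R M S) R M"
proof (rule submoduleI')
  show "module_span R M S \<subseteq> carrier M"
    using assms carrier_is_submodule unfolding module_span_def by auto
qed (auto simp: module_span_def submodule_add submodule_zero submodule_smult)

lemma module_span_base: "x \<in> S \<Longrightarrow> x \<in> module_span R M S"
  unfolding module_span_def by auto

lemma module_span_absorb:
  "\<lbrakk>submodule H R M; S \<subseteq> H\<rbrakk> \<Longrightarrow> module_span R M (S \<union> H) = H"
  unfolding module_span_def by auto

lemma module_span_superset: "S \<subseteq> module_span R M S"
  unfolding module_span_def by auto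

lemma module_span_least: "\<lbrakk>submodule H R M; S \<subseteq> H\<rbrakk> \<Longrightarrow> module_span R M S \<subseteq> H"
  unfolding module_span_def by auto

end

text \<open>
  The structure on which chains are considered: a module with a bilinear skew bracket.
\<close>
locale bracket_module = module K L for L (structure) and K (structure) +
  assumes bracket_closed [simp, intro]: "\<lbrakk>x \<in> carrier L; y \<in> carrier L\<rbrakk> \<Longrightarrow> x \<otimes> y \<in> carrier L"
    and bracket_add_left: "\<lbrakk>x \<in> carrier L; y \<in> carrier L; z \<in> carrier L\<rbrakk> \<Longrightarrow>
      (x \<oplus> y) \<otimes> z = x \<otimes> z \<oplus> y \<otimes> z"
    and bracket_smult_left: "\<lbrakk>c \<in> carrier K; x \<in> carrier L; y \<in> carrier L\<rbrakk> \<Longrightarrow>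
      (c \<odot> x) \<otimes> y = c \<odot> (x \<otimes> y)"
    and bracket_skew: "\<lbrakk>x \<in> carrier L; y \<in> carrier L\<rbrakk> \<Longrightarrow> x \<otimes> y = \<ominus> (y \<otimes> x)"
begin

lemma bracket_add_right:
  assumes "x \<in> carrier L" "y \<in> carrier L" "z \<in> carrier L"
  shows "x \<otimes> (y \<oplus> z) = x \<otimes> y \<oplus> x \<otimes> z"
proof -
  have "x \<otimes> (y \<oplus> z) = \<ominus> (y \<otimes> x \<oplus> z \<otimes> x)"
    using assms bracket_skew[of x "y \<oplus> z"] bracket_add_left[of y z x] by simp
  also have "\<dots> = \<ominus> (y \<otimes> x) \<oplus> \<ominus> (z \<otimes> x)"
    using assms by (simp add: M.minus_add)
  finally show ?thesis using assms bracket_skew[of x y] bracket_skew[of x z] by simp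
qed

lemma bracket_smult_right:
  assumes "c \<in> carrier K" "x \<in> carrier L" "y \<in> carrier L"
  shows "x \<otimes> (c \<odot> y) = c \<odot> (x \<otimes> y)"
  using assms bracket_skew[of x "c \<odot> y"] bracket_smult_left[of c y x] bracket_skew[of x y]
  by (simp add: smult_r_minus)

text \<open>
  A bilinear map is controlled on spans by its values on generators; this is applied once in each
  argument.
\<close>
lemma module_span_bracket:
  assumes S: "S \<subseteq> carrier L" and T: "T \<subseteq> carrier L" and W: "submodule W K L"
    and gen: "\<And>x y. \<lbrakk>x \<in> S; y \<in> T\<rbrakk> \<Longrightarrow> x \<otimes> y \<in> W"
    and x: "x \<in> module_span K L S" and y: "y \<in> module_span K L T"
  shows "x \<otimes> y \<in> W"
proof -
  note W' = submodule_add[OF W] submodule_zero[OF W] submodule_neg[OF W] submodule_smult[OF W]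
  have null: "\<zero> \<otimes> y = \<zero>" "y \<otimes> \<zero> = \<zero>" if "y \<in> carrier L" for y
    using that bracket_smult_left[of "\<zero>\<^bsub>K\<^esub>" \<zero> y] bracket_smult_right[of "\<zero>\<^bsub>K\<^esub>" y \<zero>] by auto
  have 1: "x \<otimes> y \<in> W" if x: "x \<in> S" and y: "y \<in> module_span K L T" for x y
  proof -
    have xc: "x \<in> carrier L" using x S by auto
    have "submodule {y \<in> carrier L. x \<otimes> y \<in> W} K L"
      by (rule submoduleI')
        (auto simp: bracket_add_right bracket_smult_right W' null xc)
    from module_span_least[OF this, of T] show ?thesis using gen x y T by auto
  qed
  have yc: "y \<in> carrier L" using y module_span_submodule[OF T] submodule_subset by blast
  have "submodule {x \<in> carrier L. x \<otimes> y \<in> W} K L"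
    by (rule submoduleI')
      (auto simp: bracket_add_left bracket_smult_left W' null yc)
  from module_span_least[OF this, of S] show ?thesis using 1 x y S by auto
qed

end

locale bracket_ideal = bracket_module L K for L (structure) and K (structure) +
  fixes I
  assumes ideal_submodule: "submodule I K L"
    and ideal_bracket: "\<lbrakk>x \<in> carrier L; y \<in> I\<rbrakk> \<Longrightarrow> x \<otimes> y \<in> I"
begin

abbreviation Q where "Q \<equiv> lie_quotient L I"

abbreviation proj where "proj x \<equiv> I +> x"

sublocale cosets: abelian_subgroup I L
  using ideal_submodule submodule.axioms(1) M.abelian_group_axioms
  by (intro abelian_subgroupI3 additive_subgroup.intro) auto

lemma ideal_bracket_left: "\<lbrakk>x \<in> I; y \<in> carrier L\<rbrakk> \<Longrightarrow> x \<otimes> y \<in> I"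
  using bracket_skew[of x y] ideal_bracket[of y x] submodule_neg[OF ideal_submodule]
    submodule_subset[OF ideal_submodule] by auto


lemma proj_eqI: "\<lbrakk>x \<in> carrier L; i \<in> I\<rbrakk> \<Longrightarrow> proj (i \<oplus> x) = proj x"
  by (rule cosets.a_repr_independence'[symmetric]) (auto simp: a_r_coset_def')

lemma proj_memD: "\<lbrakk>x \<in> carrier L; y \<in> proj x\<rbrakk> \<Longrightarrow> \<exists>i\<in>I. y = i \<oplus> x"
  by (auto simp: a_r_coset_def')

lemma proj_eq_ideal_iff: "x \<in> carrier L \<Longrightarrow> proj x = I \<longleftrightarrow> x \<in> I"
  using cosets.a_rcos_self cosets.a_rcos_const by blast

lemma ideal_carrier: "x \<in> I \<Longrightarrow> x \<in> carrier L"
  using submodule_subset[OF ideal_submodule] by auto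

lemma Q_carrier: "carrier Q = proj ` carrier L"
  by (auto simp: lie_quotient_def A_RCOSETS_def RCOSETS_def a_r_coset_def)

lemma Q_zero: "\<zero>\<^bsub>Q\<^esub> = I"
  by (simp add: lie_quotient_def)

lemma Q_zero_proj: "\<zero>\<^bsub>Q\<^esub> = proj \<zero>"
  by (simp add: Q_zero cosets.a_rcos_const)

lemma Q_add: "\<lbrakk>x \<in> carrier L; y \<in> carrier L\<rbrakk> \<Longrightarrow> proj x \<oplus>\<^bsub>Q\<^esub> proj y = proj (x \<oplus> y)"
  by (simp add: lie_quotient_def cosets.a_rcos_sum)

lemma Q_smult:
  assumes c: "c \<in> carrier K" and x: "x \<in> carrier L"
  shows "c \<odot>\<^bsub>Q\<^esub> proj x = proj (c \<odot> x)"
proof -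
  have eq: "proj (c \<odot> y) = proj (c \<odot> x)" if y: "y \<in> proj x" for y
  proof -
    obtain i where i: "i \<in> I" "y = i \<oplus> x" using proj_memD[OF x y] by blast
    then have "c \<odot> y = c \<odot> i \<oplus> c \<odot> x" using c x ideal_carrier by (simp add: smult_r_distr)
    then show ?thesis
      using proj_eqI[of "c \<odot> x" "c \<odot> i"] submodule_smult[OF ideal_submodule c i(1)] c x by simp
  qed
  have "c \<odot>\<^bsub>Q\<^esub> proj x = (\<Union>y\<in>proj x. proj (c \<odot> y))" by (simp add: lie_quotient_def)
  also have "\<dots> = proj (c \<odot> x)" using eq cosets.a_rcos_self[OF x] by blast
  finally show ?thesis .
qed

lemma Q_mult:
  assumes x: "x \<in> carrier L" and y: "y \<in> carrier L"
  shows "proj x \<otimes>\<^bsub>Q\<^esub> proj y = proj (x \<otimes> y)"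
proof -
  have "proj (x' \<otimes> y') = proj (x \<otimes> y)" if x': "x' \<in> proj x" and y': "y' \<in> proj y" for x' y'
  proof -
    obtain i j where ij: "i \<in> I" "x' = i \<oplus> x" "j \<in> I" "y' = j \<oplus> y"
      using proj_memD[OF x x'] proj_memD[OF y y'] by auto
    then have "x' \<otimes> y' = (i \<otimes> (j \<oplus> y) \<oplus> x \<otimes> j) \<oplus> x \<otimes> y"
      using x y ideal_carrier by (simp add: bracket_add_left bracket_add_right M.a_ac)
    moreover have "i \<otimes> (j \<oplus> y) \<oplus> x \<otimes> j \<in> I"
      using ij x y ideal_carrier ideal_bracket ideal_bracket_left
      by (simp add: submodule_add[OF ideal_submodule])
    ultimately show ?thesis using x y by (simp add: proj_eqI)
  qed
  then have "(\<Union>x'\<in>proj x. \<Union>y'\<in>proj y. proj (x' \<otimes> y')) = proj (x \<otimes> y)"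
    using cosets.a_rcos_self[OF x] cosets.a_rcos_self[OF y] by blast
  then show ?thesis by (simp add: lie_quotient_def rcoset_mult_def)
qed

sublocale quot: module K Q
proof (rule moduleI)
  show "abelian_group Q"
  proof (rule abelian_groupI)
    fix X assume "X \<in> carrier Q"
    then obtain x where x: "x \<in> carrier L" "X = proj x" by (auto simp: Q_carrier)
    then show "\<exists>Y\<in>carrier Q. Y \<oplus>\<^bsub>Q\<^esub> X = \<zero>\<^bsub>Q\<^esub>"
      by (intro bexI[of _ "proj (\<ominus> x)"]) (auto simp: Q_carrier Q_add Q_zero_proj M.l_neg)
  qed (auto simp: Q_carrier Q_add Q_zero_proj M.a_ac)
qed (auto simp: Q_carrier Q_add Q_smult smult_l_distr smult_r_distr smult_assoc1 R.cring_axioms)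

lemma proj_submodule:
  assumes X: "submodule X K L"
  shows "submodule (proj ` X) K Q"
proof (rule quot.submoduleI')
  show "\<zero>\<^bsub>Q\<^esub> \<in> proj ` X"
    using submodule_zero[OF X] by (simp add: Q_zero_proj)
qed (use submodule_subset[OF X] submodule_add[OF X] submodule_smult[OF X] in
    \<open>auto simp: Q_carrier Q_add Q_smult subset_iff\<close>)

lemma proj_vimage_submodule:
  assumes X: "submodule X K Q"
  shows "submodule {x \<in> carrier L. proj x \<in> X} K L"
proof (rule submoduleI')
  show "\<zero> \<in> {x \<in> carrier L. proj x \<in> X}"
    using quot.submodule_zero[OF X] by (simp add: Q_zero_proj)
qed (use quot.submodule_add[OF X] quot.submodule_smult[OF X] in
    \<open>auto simp: Q_add[symmetric] Q_smult[symmetric]\<close>)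

lemma lie_derived_subset:
  assumes "H \<subseteq> carrier Q" 
  shows "lie_derived K Q H \<subseteq> carrier Q" "submodule (lie_derived K Q H) K Q"
proof -
  have "{x \<otimes>\<^bsub>Q\<^esub> y |x y. x \<in> H \<and> y \<in> H} \<subseteq> carrier Q"
  proof clarify
    fix x y assume "x \<in> H" "y \<in> H"
    then obtain x' y' where "x' \<in> carrier L" "y' \<in> carrier L" "x = proj x'" "y = proj y'"
      using assms unfolding Q_carrier by blast
    then show "x \<otimes>\<^bsub>Q\<^esub> y \<in> carrier Q" by (simp add: Q_mult) (simp add: Q_carrier)
  qed
  then show "submodule (lie_derived K Q H) K Q"
    unfolding lie_derived_def by (rule quot.module_span_submodule)
  then show "lie_derived K Q H \<subseteq> carrier Q" by (rule quot.submodule_subset)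
qed

lemma derived_series_submodule: "submodule ((lie_derived K Q ^^ n) (carrier Q)) K Q"
proof (induction n)
  case (Suc n)
  then show ?case using lie_derived_subset quot.submodule_subset by simp
qed (simp add: quot.carrier_is_submodule)

text \<open>
  In one direction the preimages of the derived series form a chain. In the other, by induction, the
  derived series stays below the images of the terms of a given chain.
\<close>
theorem lie_solvable_quotient_iff: "lie_solvable K Q \<longleftrightarrow> solvable_modulo K L I"
proof
  assume "lie_solvable K Q"
  then obtain n where n: "(lie_derived K Q ^^ n) (carrier Q) = {I}"
    by (auto simp: lie_solvable_def Q_zero)
  define T where "T i = {x \<in> carrier L. proj x \<in> (lie_derived K Q ^^ i) (carrier Q)}" for i
  have T: "submodule (T i) K L" for i
    unfolding T_def by (intro proj_vimage_submodule derived_series_submodule)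
  have "(lie_step K L)\<^sup>*\<^sup>* (carrier L) (T i)" for i
  proof (induction i)
    case 0
    have "T 0 = carrier L" by (auto simp: T_def Q_carrier)
    then show ?case by simp
  next
    case (Suc i)
    have "x \<otimes> y \<in> T (Suc i)" if "x \<in> T i" "y \<in> T i" for x y
    proof -
      have "proj x \<otimes>\<^bsub>Q\<^esub> proj y \<in> lie_derived K Q ((lie_derived K Q ^^ i) (carrier Q))"
        using that unfolding T_def lie_derived_def
        by (intro subsetD[OF quot.module_span_superset]) auto
      then show ?thesis using that by (auto simp: T_def Q_mult)
    qed
    then show ?case using Suc T by (auto simp: lie_step_def intro: rtranclp.rtrancl_into_rtrancl)
  qed
  moreover have "T n \<subseteq> I" using n by (auto simp: T_def proj_eq_ideal_iff)
  ultimately show "solvable_modulo K L I" unfolding solvable_modulo_def by blast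
next
  assume "solvable_modulo K L I"
  then obtain Y where Y: "(lie_step K L)\<^sup>*\<^sup>* (carrier L) Y" "Y \<subseteq> I"
    by (auto simp: solvable_modulo_def)
  have "\<exists>n. (lie_derived K Q ^^ n) (carrier Q) \<subseteq> proj ` Y"
    using Y(1)
  proof (induction rule: rtranclp_induct)
    case base
    show ?case by (rule exI[of _ 0]) (simp add: Q_carrier)
  next
    case (step X Z)
    then obtain n where n: "(lie_derived K Q ^^ n) (carrier Q) \<subseteq> proj ` X" by auto
    have X: "X \<subseteq> carrier L" and Z: "submodule Z K L" and XZ: "\<forall>x\<in>X. \<forall>y\<in>X. x \<otimes> y \<in> Z"
      using step(2) by (auto simp: lie_step_def submodule_subset)
    have "lie_derived K Q ((lie_derived K Q ^^ n) (carrier Q)) \<subseteq> proj ` Z"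
      unfolding lie_derived_def[of _ _ "_ (carrier Q)"]
    proof (rule quot.module_span_least[OF proj_submodule[OF Z]], clarify)
      fix x y assume "x \<in> (lie_derived K Q ^^ n) (carrier Q)" "y \<in> (lie_derived K Q ^^ n) (carrier Q)"
      then obtain x' y' where "x' \<in> X" "y' \<in> X" "x = proj x'" "y = proj y'" using n by blast
      then show "x \<otimes>\<^bsub>Q\<^esub> y \<in> proj ` Z" using X XZ by (auto simp: Q_mult subset_iff)
    qed
    then show ?case by (intro exI[of _ "Suc n"]) simp
  qed
  then obtain n where n: "(lie_derived K Q ^^ n) (carrier Q) \<subseteq> proj ` Y" by auto
  moreover have "proj ` Y \<subseteq> {I}" using Y(2) cosets.a_rcos_const by auto
  ultimately have "(lie_derived K Q ^^ n) (carrier Q) = {I}"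
    using quot.submodule_zero[OF derived_series_submodule[of n]] by (auto simp: Q_zero)
  then show "lie_solvable K Q" unfolding lie_solvable_def Q_zero by auto
qed

end

section \<open>The Lie algebra of derivations of an associative algebra\<close>

lemma (in ring) minus_add_add:
  "\<lbrakk>a \<in> carrier R; b \<in> carrier R; c \<in> carrier R; d \<in> carrier R\<rbrakk> \<Longrightarrow>
    a \<oplus> b \<ominus> (c \<oplus> d) = a \<ominus> c \<oplus> (b \<ominus> d)"
  by algebra

text \<open>
  The mixed terms in which each derivation hits one factor cancel. In this lemma and the next ones
  the values of the derivations are plain ring elements, so that the identity is one of
  noncommutative polynomials.
\<close>
lemma (in ring) commutator_leibniz:
  "\<lbrakk>x \<in> carrier R; y \<in> carrier R; dx \<in> carrier R; dy \<in> carrier R; ex \<in> carrier R; ey \<in> carrier R;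
    dex \<in> carrier R; dey \<in> carrier R; edx \<in> carrier R; edy \<in> carrier R\<rbrakk> \<Longrightarrow>
    (dex \<otimes> y \<oplus> ex \<otimes> dy) \<oplus> (dx \<otimes> ey \<oplus> x \<otimes> dey) \<ominus> ((edx \<otimes> y \<oplus> dx \<otimes> ey) \<oplus> (ex \<otimes> dy \<oplus> x \<otimes> edy))
    = (dex \<ominus> edx) \<otimes> y \<oplus> x \<otimes> (dey \<ominus> edy)"
  by algebra

lemma (in ring) bracket_inner_aux:
  "\<lbrakk>a \<in> carrier R; x \<in> carrier R; da \<in> carrier R; dx \<in> carrier R\<rbrakk> \<Longrightarrow>
    (dx \<otimes> a \<oplus> x \<otimes> da) \<ominus> (da \<otimes> x \<oplus> a \<otimes> dx) \<ominus> (x \<otimes> da \<ominus> da \<otimes> x) = dx \<otimes> a \<ominus> a \<otimes> dx"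
  by algebra

lemma (in ring) inner_leibniz:
  "\<lbrakk>a \<in> carrier R; x \<in> carrier R; y \<in> carrier R\<rbrakk> \<Longrightarrow>
    a \<otimes> (x \<otimes> y) \<ominus> (x \<otimes> y) \<otimes> a = (a \<otimes> x \<ominus> x \<otimes> a) \<otimes> y \<oplus> x \<otimes> (a \<otimes> y \<ominus> y \<otimes> a)"
  by algebra

text \<open>
  An associative, not necessarily commutative algebra over the commutative ring \<open>K\<close>.
\<close>
locale k_algebra = A?: ring A + module K A
  for A :: "('k, 'a, 'n) module_scheme" (structure) and K :: "('k, 'm) ring_scheme" (structure) +
  assumes smult_mult_left: "\<lbrakk>c \<in> carrier K; x \<in> carrier A; y \<in> carrier A\<rbrakk> \<Longrightarrow>
      (c \<odot> x) \<otimes> y = c \<odot> (x \<otimes> y)"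
    and smult_mult_right: "\<lbrakk>c \<in> carrier K; x \<in> carrier A; y \<in> carrier A\<rbrakk> \<Longrightarrow>
      x \<otimes> (c \<odot> y) = c \<odot> (x \<otimes> y)"
begin

lemma derivation_closed: "\<lbrakk>d \<in> derivations K A; x \<in> carrier A\<rbrakk> \<Longrightarrow> d x \<in> carrier A"
  and derivation_add: "\<lbrakk>d \<in> derivations K A; x \<in> carrier A; y \<in> carrier A\<rbrakk> \<Longrightarrow>
    d (x \<oplus> y) = d x \<oplus> d y"
  and derivation_smult: "\<lbrakk>d \<in> derivations K A; c \<in> carrier K; x \<in> carrier A\<rbrakk> \<Longrightarrow>
    d (c \<odot> x) = c \<odot> d x"
  and derivation_mult: "\<lbrakk>d \<in> derivations K A; x \<in> carrier A; y \<in> carrier A\<rbrakk> \<Longrightarrow>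
    d (x \<otimes> y) = d x \<otimes> y \<oplus> x \<otimes> d y"
  and derivation_undefined: "\<lbrakk>d \<in> derivations K A; x \<notin> carrier A\<rbrakk> \<Longrightarrow> d x = undefined"
  unfolding derivations_def by (blast intro: PiE_arb)+

lemma derivation_zero: "d \<in> derivations K A \<Longrightarrow> d \<zero> = \<zero>"
  using derivation_smult[of d "\<zero>\<^bsub>K\<^esub>" \<zero>] derivation_closed[of d \<zero>] by simp

lemma derivation_neg: "\<lbrakk>d \<in> derivations K A; x \<in> carrier A\<rbrakk> \<Longrightarrow> d (\<ominus> x) = \<ominus> d x"
  using derivation_add[of d x "\<ominus> x"] derivation_zero[of d]
  by (metis A.a_inv_closed A.minus_equality A.r_neg A.a_comm derivation_closed)

lemma derivation_minus:
  "\<lbrakk>d \<in> derivations K A; x \<in> carrier A; y \<in> carrier A\<rbrakk> \<Longrightarrow> d (x \<ominus> y) = d x \<ominus> d y"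
  using derivation_add[of d x "\<ominus> y"] derivation_neg[of d y] by (simp add: A.minus_eq)

lemma derivation_one: "d \<in> derivations K A \<Longrightarrow> d \<one> = \<zero>"
  using derivation_mult[of d \<one> \<one>] derivation_closed[of d \<one>]
  by (simp add: A.add.l_cancel_one)

text \<open>
  These facts are instantiated at a given derivation before they are used for rewriting, because
  with a variable in head position they would match every term.
\<close>
lemmas derivation_rules = derivation_closed derivation_add derivation_smult derivation_mult
  derivation_zero derivation_neg derivation_minus derivation_one

lemma derivation_finsum:
  assumes "d \<in> derivations K A" "f \<in> I \<rightarrow> carrier A"
  shows "d (\<Oplus>i\<in>I. f i) = (\<Oplus>i\<in>I. d (f i))"
  using assms(2)
proof (induction I rule: infinite_finite_induct)
  case (insert i I)
  then have "d (\<Oplus>i\<in>insert i I. f i) = d (f i \<oplus> (\<Oplus>i\<in>I. f i))" by simp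
  also have "\<dots> = d (f i) \<oplus> d (\<Oplus>i\<in>I. f i)"
    using insert.prems by (intro derivation_add[OF assms(1)]) (auto intro: A.finsum_closed)
  finally show ?case using insert derivation_closed[OF assms(1)]
    by (subst A.finsum_insert) (auto simp: Pi_iff)
qed (simp_all add: derivation_zero[OF assms(1)])

lemma derivation_eqI:
  "\<lbrakk>d \<in> derivations K A; e \<in> derivations K A; \<And>x. x \<in> carrier A \<Longrightarrow> d x = e x\<rbrakk> \<Longrightarrow> d = e"
  by (rule ext) (metis derivation_undefined)

lemma restrict_derivation:
  assumes "\<And>x. x \<in> carrier A \<Longrightarrow> f x \<in> carrier A"
    "\<And>x y. \<lbrakk>x \<in> carrier A; y \<in> carrier A\<rbrakk> \<Longrightarrow> f (x \<oplus> y) = f x \<oplus> f y"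
    "\<And>c x. \<lbrakk>c \<in> carrier K; x \<in> carrier A\<rbrakk> \<Longrightarrow> f (c \<odot> x) = c \<odot> f x"
    "\<And>x y. \<lbrakk>x \<in> carrier A; y \<in> carrier A\<rbrakk> \<Longrightarrow> f (x \<otimes> y) = f x \<otimes> y \<oplus> x \<otimes> f y"
  shows "(\<lambda>x\<in>carrier A. f x) \<in> derivations K A"
  using assms by (auto simp: derivations_def)

abbreviation D where "D \<equiv> Der K A"

lemma Der_carrier [simp]: "carrier D = derivations K A"
  and Der_apply:
    "x \<in> carrier A \<Longrightarrow> (d \<oplus>\<^bsub>D\<^esub> e) x = d x \<oplus> e x"
    "x \<in> carrier A \<Longrightarrow> (c \<odot>\<^bsub>D\<^esub> d) x = c \<odot> d x"
    "x \<in> carrier A \<Longrightarrow> (d \<otimes>\<^bsub>D\<^esub> e) x = d (e x) \<ominus> e (d x)"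
    "x \<in> carrier A \<Longrightarrow> \<zero>\<^bsub>D\<^esub> x = \<zero>"
  by (simp_all add: Der_def)

lemma Der_add_closed:
  assumes "d \<in> derivations K A" "e \<in> derivations K A"
  shows "d \<oplus>\<^bsub>D\<^esub> e \<in> derivations K A"
  unfolding Der_def
  by (simp, rule restrict_derivation)
    (auto simp: derivation_rules[OF assms(1)] derivation_rules[OF assms(2)]
      A.a_ac A.l_distr A.r_distr smult_r_distr)

lemma Der_smult_closed:
  assumes "c \<in> carrier K" "d \<in> derivations K A"
  shows "c \<odot>\<^bsub>D\<^esub> d \<in> derivations K A"
  unfolding Der_def
  by (simp, rule restrict_derivation)
    (use assms(1) in \<open>auto simp: derivation_rules[OF assms(2)] smult_r_distr smult_mult_left
      smult_mult_right smult_assoc1[symmetric] R.m_comm\<close>)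

lemma Der_zero_closed: "\<zero>\<^bsub>D\<^esub> \<in> derivations K A"
  unfolding Der_def by (simp, rule restrict_derivation) auto

lemma Der_bracket_closed:
  assumes d: "d \<in> derivations K A" and e: "e \<in> derivations K A"
  shows "d \<otimes>\<^bsub>D\<^esub> e \<in> derivations K A"
  unfolding Der_def
proof (simp, rule restrict_derivation)
  note rules = derivation_rules[OF d] derivation_rules[OF e]
  fix x y assume xy: "x \<in> carrier A" "y \<in> carrier A"
  show "d (e (x \<oplus> y)) \<ominus> e (d (x \<oplus> y)) = d (e x) \<ominus> e (d x) \<oplus> (d (e y) \<ominus> e (d y))"
    using xy by (simp add: rules A.minus_add_add)
  show "d (e (x \<otimes> y)) \<ominus> e (d (x \<otimes> y)) =
      (d (e x) \<ominus> e (d x)) \<otimes> y \<oplus> x \<otimes> (d (e y) \<ominus> e (d y))"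
    using xy by (simp add: rules A.commutator_leibniz)
next
  fix c x assume "c \<in> carrier K" "x \<in> carrier A"
  then show "d (e (c \<odot> x)) \<ominus> e (d (c \<odot> x)) = c \<odot> (d (e x) \<ominus> e (d x))"
    by (simp add: derivation_rules[OF d] derivation_rules[OF e] A.minus_eq smult_r_distr smult_r_minus)
qed (simp add: derivation_closed d e)

lemma abelian_group_Der: "abelian_group D"
proof (rule abelian_groupI)
  fix d assume d: "d \<in> carrier D"
  note rules = derivation_closed[OF d[simplified]]
  show "\<exists>e\<in>carrier D. e \<oplus>\<^bsub>D\<^esub> d = \<zero>\<^bsub>D\<^esub>"
  proof (rule bexI[of _ "(\<ominus>\<^bsub>K\<^esub> \<one>\<^bsub>K\<^esub>) \<odot>\<^bsub>D\<^esub> d"])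
    show "(\<ominus>\<^bsub>K\<^esub> \<one>\<^bsub>K\<^esub>) \<odot>\<^bsub>D\<^esub> d \<oplus>\<^bsub>D\<^esub> d = \<zero>\<^bsub>D\<^esub>"
      using d by (rule_tac derivation_eqI)
        (simp_all add: Der_apply Der_add_closed Der_smult_closed Der_zero_closed smult_l_minus A.l_neg rules)
  qed (use d in \<open>simp add: Der_smult_closed\<close>)
next
  show "d \<oplus>\<^bsub>D\<^esub> e = e \<oplus>\<^bsub>D\<^esub> d"
    if "d \<in> carrier D" "e \<in> carrier D" for d e
    by (rule derivation_eqI)
      (use that in \<open>simp_all add: derivation_closed[of d] derivation_closed[of e] Der_add_closed Der_smult_closed
        Der_apply Der_zero_closed A.a_ac\<close>)
  show "d \<oplus>\<^bsub>D\<^esub> e \<oplus>\<^bsub>D\<^esub> f = d \<oplus>\<^bsub>D\<^esub> (e \<oplus>\<^bsub>D\<^esub> f)"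
    if "d \<in> carrier D" "e \<in> carrier D" "f \<in> carrier D" for d e f
    by (rule derivation_eqI)
      (use that in \<open>simp_all add: derivation_closed[of d] derivation_closed[of e] derivation_closed[of f] Der_add_closed Der_smult_closed
        Der_apply Der_zero_closed A.a_ac\<close>)
  show "\<zero>\<^bsub>D\<^esub> \<oplus>\<^bsub>D\<^esub> d = d"
    if "d \<in> carrier D" for d
    by (rule derivation_eqI)
      (use that in \<open>simp_all add: derivation_closed[of d] Der_add_closed Der_smult_closed
        Der_apply Der_zero_closed A.a_ac\<close>)
qed (simp_all add: Der_add_closed Der_zero_closed)

lemma module_Der: "module K D"
proof (rule moduleI)
  show "(a \<oplus>\<^bsub>K\<^esub> b) \<odot>\<^bsub>D\<^esub> d = a \<odot>\<^bsub>D\<^esub> d \<oplus>\<^bsub>D\<^esub> b \<odot>\<^bsub>D\<^esub> d"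
    if "a \<in> carrier K" "b \<in> carrier K" "d \<in> carrier D" for a b d
    by (rule derivation_eqI)
      (use that in \<open>simp_all add: derivation_closed[of d] Der_add_closed Der_smult_closed
        Der_apply smult_l_distr smult_r_distr smult_assoc1\<close>)
  show "a \<odot>\<^bsub>D\<^esub> (d \<oplus>\<^bsub>D\<^esub> e) = a \<odot>\<^bsub>D\<^esub> d \<oplus>\<^bsub>D\<^esub> a \<odot>\<^bsub>D\<^esub> e"
    if "a \<in> carrier K" "d \<in> carrier D" "e \<in> carrier D" for a d e
    by (rule derivation_eqI)
      (use that in \<open>simp_all add: derivation_closed[of d] derivation_closed[of e] Der_add_closed Der_smult_closed
        Der_apply smult_l_distr smult_r_distr smult_assoc1\<close>)
  show "a \<otimes>\<^bsub>K\<^esub> b \<odot>\<^bsub>D\<^esub> d = a \<odot>\<^bsub>D\<^esub> (b \<odot>\<^bsub>D\<^esub> d)"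
    if "a \<in> carrier K" "b \<in> carrier K" "d \<in> carrier D" for a b d
    by (rule derivation_eqI)
      (use that in \<open>simp_all add: derivation_closed[of d] Der_add_closed Der_smult_closed
        Der_apply smult_l_distr smult_r_distr smult_assoc1\<close>)
  show "\<one>\<^bsub>K\<^esub> \<odot>\<^bsub>D\<^esub> d = d"
    if "d \<in> carrier D" for d
    by (rule derivation_eqI)
      (use that in \<open>simp_all add: derivation_closed[of d] Der_add_closed Der_smult_closed
        Der_apply smult_l_distr smult_r_distr smult_assoc1\<close>)
qed (simp_all add: abelian_group_Der R.cring_axioms Der_smult_closed)

interpretation der_module: module K D by (rule module_Der)

lemma Der_neg_apply:
  assumes d: "d \<in> derivations K A" and x: "x \<in> carrier A"
  shows "(\<ominus>\<^bsub>D\<^esub> d) x = \<ominus> d x"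
proof -
  have "\<ominus>\<^bsub>D\<^esub> d = (\<ominus>\<^bsub>K\<^esub> \<one>\<^bsub>K\<^esub>) \<odot>\<^bsub>D\<^esub> d"
    using d by (simp add: der_module.smult_l_minus)
  then show ?thesis using x derivation_closed[OF d x] by (simp add: Der_apply smult_l_minus)
qed

lemma bracket_module_Der: "bracket_module D K"
proof (rule bracket_module.intro[OF module_Der], rule bracket_module_axioms.intro)
  note simps = Der_bracket_closed Der_add_closed Der_smult_closed Der_apply Der_neg_apply
    der_module.M.a_inv_closed[simplified]
  show "d \<otimes>\<^bsub>D\<^esub> e \<in> carrier D" if "d \<in> carrier D" "e \<in> carrier D" for d e
    using that by (simp add: Der_bracket_closed)
  show "d \<otimes>\<^bsub>D\<^esub> e = \<ominus>\<^bsub>D\<^esub> (e \<otimes>\<^bsub>D\<^esub> d)" if "d \<in> carrier D" "e \<in> carrier D" for d e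
    by (rule derivation_eqI) (use that in \<open>simp_all add: simps derivation_rules[of d] derivation_rules[of e]
      A.minus_eq A.minus_add A.a_comm\<close>)
  show "(d \<oplus>\<^bsub>D\<^esub> e) \<otimes>\<^bsub>D\<^esub> f = d \<otimes>\<^bsub>D\<^esub> f \<oplus>\<^bsub>D\<^esub> e \<otimes>\<^bsub>D\<^esub> f"
    if "d \<in> carrier D" "e \<in> carrier D" "f \<in> carrier D" for d e f
    by (rule derivation_eqI) (use that in \<open>simp_all add: simps derivation_rules[of d]
      derivation_rules[of e] derivation_rules[of f] A.minus_add_add\<close>)
  show "(c \<odot>\<^bsub>D\<^esub> d) \<otimes>\<^bsub>D\<^esub> e = c \<odot>\<^bsub>D\<^esub> (d \<otimes>\<^bsub>D\<^esub> e)"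
    if "c \<in> carrier K" "d \<in> carrier D" "e \<in> carrier D" for c d e
    by (rule derivation_eqI) (use that in \<open>simp_all add: simps derivation_rules[of d]
      derivation_rules[of e] A.minus_eq smult_r_distr smult_r_minus\<close>)
qed

sublocale der: bracket_module D K
  by (rule bracket_module_Der)

lemma Der_minus_apply:
  "\<lbrakk>d \<in> derivations K A; e \<in> derivations K A; x \<in> carrier A\<rbrakk> \<Longrightarrow> (d \<ominus>\<^bsub>D\<^esub> e) x = d x \<ominus> e x"
  by (simp add: a_minus_def Der_apply Der_neg_apply)

lemma Der_finsum_apply:
  assumes "f \<in> I \<rightarrow> derivations K A" "x \<in> carrier A"
  shows "(\<Oplus>\<^bsub>D\<^esub>i\<in>I. f i) x = (\<Oplus>i\<in>I. f i x)"
  using assms(1)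
proof (induction I rule: infinite_finite_induct)
  case (insert i I)
  have fi: "f i \<in> derivations K A" and fI: "f \<in> I \<rightarrow> derivations K A" using insert.prems by auto
  have "(\<lambda>i. f i x) \<in> I \<rightarrow> carrier A" using fI derivation_closed assms(2) by blast
  then show ?case
    using insert fi fI assms(2) derivation_closed[OF fi assms(2)] by (simp add: Der_apply)
qed (use assms(2) in \<open>auto simp: Der_apply\<close>)

subsection \<open>Inner derivations\<close>

definition inner :: "'a \<Rightarrow> 'a \<Rightarrow> 'a" where
  "inner x = (\<lambda>a\<in>carrier A. x \<otimes> a \<ominus> a \<otimes> x)"

lemma InnDer_eq: "InnDer A = inner ` carrier A"
  by (auto simp: InnDer_def inner_def)

lemma inner_apply: "a \<in> carrier A \<Longrightarrow> inner x a = x \<otimes> a \<ominus> a \<otimes> x"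
  by (simp add: inner_def)

lemma inner_derivation: "x \<in> carrier A \<Longrightarrow> inner x \<in> derivations K A"
  unfolding inner_def
proof (rule restrict_derivation)
  assume x: "x \<in> carrier A"
  fix a b assume a: "a \<in> carrier A" and b: "b \<in> carrier A"
  show "x \<otimes> (a \<oplus> b) \<ominus> (a \<oplus> b) \<otimes> x = x \<otimes> a \<ominus> a \<otimes> x \<oplus> (x \<otimes> b \<ominus> b \<otimes> x)"
    using x a b by (simp add: A.l_distr A.r_distr A.minus_add_add)
  show "x \<otimes> (a \<otimes> b) \<ominus> a \<otimes> b \<otimes> x =
      (x \<otimes> a \<ominus> a \<otimes> x) \<otimes> b \<oplus> a \<otimes> (x \<otimes> b \<ominus> b \<otimes> x)"
    using x a b by (rule A.inner_leibniz)
next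
  fix c a assume "x \<in> carrier A" "c \<in> carrier K" "a \<in> carrier A"
  then show "x \<otimes> (c \<odot> a) \<ominus> c \<odot> a \<otimes> x = c \<odot> (x \<otimes> a \<ominus> a \<otimes> x)"
    by (simp add: smult_mult_left smult_mult_right A.minus_eq smult_r_minus smult_r_distr)
qed simp

lemma inner_add: "\<lbrakk>x \<in> carrier A; y \<in> carrier A\<rbrakk> \<Longrightarrow> inner x \<oplus>\<^bsub>D\<^esub> inner y = inner (x \<oplus> y)"
  by (rule derivation_eqI) (auto simp: inner_derivation Der_add_closed Der_apply inner_apply
    A.l_distr A.r_distr A.minus_add_add)

lemma inner_smult: "\<lbrakk>c \<in> carrier K; x \<in> carrier A\<rbrakk> \<Longrightarrow> c \<odot>\<^bsub>D\<^esub> inner x = inner (c \<odot> x)"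
  by (rule derivation_eqI) (auto simp: inner_derivation Der_smult_closed Der_apply inner_apply
    smult_mult_left smult_mult_right A.minus_eq smult_r_distr smult_r_minus)

lemma inner_zero: "inner \<zero> = \<zero>\<^bsub>D\<^esub>"
  by (rule derivation_eqI) (auto simp: inner_derivation Der_zero_closed Der_apply inner_apply A.minus_eq)

text \<open>
  By the Leibniz rule; this is why the inner derivations form an ideal.
\<close>
lemma bracket_inner:
  assumes d: "d \<in> derivations K A" and x: "x \<in> carrier A"
  shows "d \<otimes>\<^bsub>D\<^esub> inner x = inner (d x)"
  by (rule derivation_eqI)
    (use x in \<open>simp_all add: d inner_derivation Der_bracket_closed derivation_rules[OF d] Der_apply
      inner_apply A.bracket_inner_aux\<close>)

lemma InnDer_submodule: "submodule (InnDer A) K D"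
proof (rule der_module.submoduleI')
  show "InnDer A \<subseteq> carrier D" by (auto simp: InnDer_eq inner_derivation)
  show "\<zero>\<^bsub>D\<^esub> \<in> InnDer A" unfolding InnDer_eq by (rule image_eqI[where f = inner, OF inner_zero[symmetric]]) simp
  show "d \<oplus>\<^bsub>D\<^esub> e \<in> InnDer A" if "d \<in> InnDer A" "e \<in> InnDer A" for d e
    using that unfolding InnDer_eq by (auto simp: inner_add)
  show "c \<odot>\<^bsub>D\<^esub> d \<in> InnDer A" if "c \<in> carrier K" "d \<in> InnDer A" for c d
    using that unfolding InnDer_eq by (auto simp: inner_smult)
qed

lemma bracket_InnDer: "\<lbrakk>d \<in> derivations K A; e \<in> InnDer A\<rbrakk> \<Longrightarrow> d \<otimes>\<^bsub>D\<^esub> e \<in> InnDer A"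
  unfolding InnDer_eq by (auto simp: bracket_inner derivation_closed)

lemma bracket_ideal_InnDer: "bracket_ideal D K (InnDer A)"
  by (rule bracket_ideal.intro[OF bracket_module_Der], rule bracket_ideal_axioms.intro)
    (simp_all add: InnDer_submodule bracket_InnDer)

theorem lie_solvable_HH1_iff:
  "lie_solvable K (HH1 K A) \<longleftrightarrow> solvable_modulo K D (InnDer A)"
  unfolding HH1_def by (rule bracket_ideal.lie_solvable_quotient_iff[OF bracket_ideal_InnDer])

end

section \<open>Central elements and central multiples of derivations\<close>

definition ring_center :: "('a, 'm) ring_scheme \<Rightarrow> 'a set" where
  "ring_center R = {z \<in> carrier R. \<forall>x\<in>carrier R. z \<otimes>\<^bsub>R\<^esub> x = x \<otimes>\<^bsub>R\<^esub> z}"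

context ring
begin

lemma center_carrier: "z \<in> ring_center R \<Longrightarrow> z \<in> carrier R"
  and center_comm: "\<lbrakk>z \<in> ring_center R; x \<in> carrier R\<rbrakk> \<Longrightarrow> x \<otimes> z = z \<otimes> x"
  by (auto simp: ring_center_def)

lemma center_closed:
  "\<zero> \<in> ring_center R" "\<one> \<in> ring_center R"
  "\<lbrakk>z \<in> ring_center R; w \<in> ring_center R\<rbrakk> \<Longrightarrow> z \<oplus> w \<in> ring_center R"
  "\<lbrakk>z \<in> ring_center R; w \<in> ring_center R\<rbrakk> \<Longrightarrow> z \<otimes> w \<in> ring_center R"
  "z \<in> ring_center R \<Longrightarrow> \<ominus> z \<in> ring_center R"
  "\<lbrakk>z \<in> ring_center R; w \<in> ring_center R\<rbrakk> \<Longrightarrow> z \<ominus> w \<in> ring_center R"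
proof -
  show mult: "z \<otimes> w \<in> ring_center R" if "z \<in> ring_center R" "w \<in> ring_center R" for z w
  proof -
    have zw: "z \<in> carrier R" "w \<in> carrier R" using that center_carrier by auto
    note zw_center = that
    have "z \<otimes> w \<otimes> x = x \<otimes> (z \<otimes> w)" if x: "x \<in> carrier R" for x
    proof -
      have "z \<otimes> w \<otimes> x = z \<otimes> (x \<otimes> w)" using zw x zw_center(2) center_comm[of w x] by (simp add: m_assoc)
      also have "\<dots> = x \<otimes> (z \<otimes> w)" using zw x zw_center(1) center_comm[of z x]
        by (simp add: m_assoc[symmetric])
      finally show ?thesis .
    qed
    then show ?thesis using zw by (simp add: ring_center_def)
  qed
qed (simp_all add: ring_center_def l_distr r_distr l_minus r_minus minus_eq)

lemma central_bracket_aux: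
  "\<lbrakk>z \<in> carrier R; w \<in> carrier R; dw \<in> carrier R; ez \<in> carrier R; dx \<in> carrier R; ex \<in> carrier R;
    dex \<in> carrier R; edx \<in> carrier R\<rbrakk> \<Longrightarrow>
    z \<otimes> (dw \<otimes> ex \<oplus> w \<otimes> dex) \<ominus> w \<otimes> (ez \<otimes> dx \<oplus> z \<otimes> edx) =
      (z \<otimes> dw) \<otimes> ex \<ominus> (w \<otimes> ez) \<otimes> dx \<oplus> ((z \<otimes> w) \<otimes> dex \<ominus> (w \<otimes> z) \<otimes> edx)"
  by algebra

end

context k_algebra
begin

abbreviation Z where "Z \<equiv> ring_center A"

lemma center_smult: "\<lbrakk>c \<in> carrier K; z \<in> Z\<rbrakk> \<Longrightarrow> c \<odot> z \<in> Z"
  by (auto simp: ring_center_def smult_mult_left smult_mult_right)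

text \<open>
  Apply \<open>d\<close> to both sides of \<open>z x = x z\<close> and cancel the terms with \<open>d x\<close>.
\<close>
lemma derivation_center:
  assumes d: "d \<in> derivations K A" and z: "z \<in> Z"
  shows "d z \<in> Z"
proof -
  have zc: "z \<in> carrier A" using z by (rule A.center_carrier)
  have "d z \<otimes> x = x \<otimes> d z" if x: "x \<in> carrier A" for x
  proof -
    have "d z \<otimes> x \<oplus> z \<otimes> d x = d (z \<otimes> x)" using x zc by (simp add: derivation_rules[OF d])
    also have "\<dots> = d (x \<otimes> z)" using A.center_comm[OF z x] by simp
    also have "\<dots> = x \<otimes> d z \<oplus> z \<otimes> d x"
      using x zc A.center_comm[OF z derivation_closed[OF d x]]
      by (simp add: derivation_rules[OF d] A.a_comm)
    finally show ?thesis using x zc by (simp add: derivation_closed[OF d])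
  qed
  then show ?thesis using zc by (simp add: ring_center_def derivation_closed[OF d])
qed

lemma inner_center: "\<lbrakk>x \<in> carrier A; z \<in> Z\<rbrakk> \<Longrightarrow> inner x z = \<zero>"
  using A.center_comm[of z x] by (simp add: inner_apply A.center_carrier A.minus_eq A.r_neg)

definition cmult :: "'a \<Rightarrow> ('a \<Rightarrow> 'a) \<Rightarrow> 'a \<Rightarrow> 'a" where
  "cmult z d = (\<lambda>x\<in>carrier A. z \<otimes> d x)"

lemma cmult_apply: "x \<in> carrier A \<Longrightarrow> cmult z d x = z \<otimes> d x"
  by (simp add: cmult_def)

lemma cmult_derivation:
  assumes z: "z \<in> Z" and d: "d \<in> derivations K A"
  shows "cmult z d \<in> derivations K A"
  unfolding cmult_def
proof (rule restrict_derivation)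
  note zc = A.center_carrier[OF z]
  fix x y assume x: "x \<in> carrier A" and y: "y \<in> carrier A"
  show "z \<otimes> d (x \<otimes> y) = z \<otimes> d x \<otimes> y \<oplus> x \<otimes> (z \<otimes> d y)"
    using x y zc A.center_comm[OF z x, symmetric] 
    by (simp add: derivation_rules[OF d] A.r_distr A.m_assoc[symmetric])
qed (use A.center_carrier[OF z] in \<open>auto simp: derivation_rules[OF d] A.r_distr smult_mult_right\<close>)

lemma cmult_simps:
  assumes "z \<in> Z" "w \<in> Z" "d \<in> derivations K A" "c \<in> carrier K"
  shows "cmult (z \<oplus> w) d = cmult z d \<oplus>\<^bsub>D\<^esub> cmult w d"
    "cmult (z \<otimes> w) d = cmult z (cmult w d)"
    "cmult (c \<odot> z) d = c \<odot>\<^bsub>D\<^esub> cmult z d"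
    "cmult \<one> d = d"
  by (rule derivation_eqI; use assms in \<open>simp add: cmult_derivation Der_apply Der_add_closed
    Der_smult_closed cmult_apply A.center_carrier derivation_closed[OF assms(3)] A.l_distr A.m_assoc
    smult_mult_left A.center_closed center_smult\<close>)+

text \<open>
  The central multiples of derivations are a Lie--Rinehart algebra over the centre. All estimates
  for the filtration by powers of a central ideal come from this formula.
\<close>
lemma bracket_cmult:
  assumes z: "z \<in> Z" and w: "w \<in> Z" and d: "d \<in> derivations K A" and e: "e \<in> derivations K A"
  shows "cmult z d \<otimes>\<^bsub>D\<^esub> cmult w e =
    cmult (z \<otimes> d w) e \<ominus>\<^bsub>D\<^esub> cmult (w \<otimes> e z) d \<oplus>\<^bsub>D\<^esub> cmult (z \<otimes> w) (d \<otimes>\<^bsub>D\<^esub> e)"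
proof -
  have cl: "z \<otimes> d w \<in> Z" "w \<otimes> e z \<in> Z" "z \<otimes> w \<in> Z"
    using z w d e by (auto intro: A.center_closed derivation_center)
  note cl' = cl[THEN A.center_carrier] z[THEN A.center_carrier] w[THEN A.center_carrier]
  have der: "cmult (z \<otimes> d w) e \<in> derivations K A" "cmult (w \<otimes> e z) d \<in> derivations K A"
    "cmult (z \<otimes> w) (d \<otimes>\<^bsub>D\<^esub> e) \<in> derivations K A" "cmult z d \<in> derivations K A" "cmult w e \<in> derivations K A"
    by (simp_all add: cmult_derivation cl z w d e Der_bracket_closed)
  show ?thesis
  proof (rule derivation_eqI)
    show "cmult z d \<otimes>\<^bsub>D\<^esub> cmult w e \<in> derivations K A" by (simp add: Der_bracket_closed der)
    show "cmult (z \<otimes> d w) e \<ominus>\<^bsub>D\<^esub> cmult (w \<otimes> e z) d \<oplus>\<^bsub>D\<^esub> cmult (z \<otimes> w) (d \<otimes>\<^bsub>D\<^esub> e) \<in> derivations K A"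
      using der by (intro Der_add_closed) (auto intro: der.M.minus_closed[simplified])
    fix x assume x: "x \<in> carrier A"
    have "(cmult z d \<otimes>\<^bsub>D\<^esub> cmult w e) x = z \<otimes> (d w \<otimes> e x \<oplus> w \<otimes> d (e x)) \<ominus> w \<otimes> (e z \<otimes> d x \<oplus> z \<otimes> e (d x))"
      using x cl' by (simp add: Der_apply cmult_apply derivation_rules[OF d] derivation_rules[OF e])
    also have "\<dots> = (z \<otimes> d w) \<otimes> e x \<ominus> (w \<otimes> e z) \<otimes> d x \<oplus> ((z \<otimes> w) \<otimes> d (e x) \<ominus> (w \<otimes> z) \<otimes> e (d x))"
      using x cl' by (intro A.central_bracket_aux) (auto simp: derivation_rules[OF d] derivation_rules[OF e])
    also have "w \<otimes> z = z \<otimes> w" using z w A.center_comm A.center_carrier by blast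
    also have "(z \<otimes> w) \<otimes> d (e x) \<ominus> (z \<otimes> w) \<otimes> e (d x) = (z \<otimes> w) \<otimes> (d (e x) \<ominus> e (d x))"
      using x cl' by (simp add: derivation_closed[OF d] derivation_closed[OF e] A.minus_eq A.r_distr A.r_minus)
    finally show "(cmult z d \<otimes>\<^bsub>D\<^esub> cmult w e) x =
      (cmult (z \<otimes> d w) e \<ominus>\<^bsub>D\<^esub> cmult (w \<otimes> e z) d \<oplus>\<^bsub>D\<^esub> cmult (z \<otimes> w) (d \<otimes>\<^bsub>D\<^esub> e)) x"
      using x by (simp add: Der_apply Der_minus_apply der cmult_apply)
  qed
qed

lemma bracket_cmult_same:
  assumes z: "z \<in> Z" and w: "w \<in> Z" and d: "d \<in> derivations K A"
  shows "cmult z d \<otimes>\<^bsub>D\<^esub> cmult w d = cmult (z \<otimes> d w \<ominus> w \<otimes> d z) d"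
proof -
  have cl: "z \<otimes> d w \<in> Z" "w \<otimes> d z \<in> Z" "z \<otimes> w \<in> Z" "z \<otimes> d w \<ominus> w \<otimes> d z \<in> Z"
    using z w d by (auto intro: A.center_closed derivation_center)
  note cl' = cl[THEN A.center_carrier]
  show ?thesis unfolding bracket_cmult[OF z w d d]
  proof (rule derivation_eqI)
    show "cmult (z \<otimes> d w) d \<ominus>\<^bsub>D\<^esub> cmult (w \<otimes> d z) d \<oplus>\<^bsub>D\<^esub> cmult (z \<otimes> w) (d \<otimes>\<^bsub>D\<^esub> d) \<in> derivations K A"
      using cl d by (intro Der_add_closed)
       (auto intro!: der.M.minus_closed[simplified] cmult_derivation Der_bracket_closed)
    show "cmult (z \<otimes> d w \<ominus> w \<otimes> d z) d \<in> derivations K A" by (rule cmult_derivation[OF cl(4) d])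
  qed (simp_all add: cmult_derivation cl d Der_bracket_closed Der_apply Der_minus_apply cmult_apply
      cl' derivation_closed[OF d] A.minus_eq A.r_neg A.l_distr A.l_minus)
qed

text \<open>
  A derivation \<open>e\<close> with \<open>e z = 1\<close> behaves like \<open>\<partial>/\<partial>z\<close>: together with its multiples by \<open>z\<close> and
  \<open>z\<^sup>2\<close> it spans a copy of the algebra \<open>sl\<^sub>2\<close>, which is perfect when \<open>2\<close> is invertible. It
  therefore lies in each term of every chain, while \<open>e\<close> is not inner.
\<close>
lemma derivative_of_central_not_unit:
  assumes solvable: "solvable_modulo K D (InnDer A)"
    and half: "h \<in> carrier K" "h \<otimes>\<^bsub>K\<^esub> (\<one>\<^bsub>K\<^esub> \<oplus>\<^bsub>K\<^esub> \<one>\<^bsub>K\<^esub>) = \<one>\<^bsub>K\<^esub>"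
    and nontrivial: "\<one> \<noteq> \<zero>"
    and d: "d \<in> derivations K A" and z: "z \<in> Z" and u: "u \<in> Z"
  shows "u \<otimes> d z \<noteq> \<one>"
proof
  assume unit: "u \<otimes> d z = \<one>"
  \<comment> \<open>The candidate for \<open>\<partial>/\<partial>z\<close>.\<close>
  define e where "e = cmult u d"
  have e: "e \<in> derivations K A" unfolding e_def by (rule cmult_derivation[OF u d])
  note zc = z[THEN A.center_carrier]
  have ez: "e z = \<one>" using unit zc by (simp add: e_def cmult_apply)
  have zz: "z \<otimes> z \<in> Z" using z by (intro A.center_closed)
  have ezz: "e (z \<otimes> z) = z \<oplus> z" using zc by (simp add: derivation_mult[OF e] ez)
  have b1: "e \<otimes>\<^bsub>D\<^esub> cmult z e = e"
    using bracket_cmult_same[OF A.center_closed(2) z e] zc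
    by (simp add: cmult_simps[OF z z e R.one_closed] ez derivation_one[OF e] A.minus_eq)
  have b2: "e \<otimes>\<^bsub>D\<^esub> cmult (z \<otimes> z) e = cmult (z \<oplus> z) e"
    using bracket_cmult_same[OF A.center_closed(2) zz e] zc
    by (simp add: cmult_simps(4)[OF z z e R.one_closed] ezz derivation_one[OF e] A.minus_eq)
  have b3: "cmult z e \<otimes>\<^bsub>D\<^esub> cmult (z \<otimes> z) e = cmult (z \<otimes> z) e"
    using bracket_cmult_same[OF z zz e] zc
    by (simp add: ez ezz A.r_distr A.minus_eq A.a_assoc A.r_neg)
  have half_twice: "h \<odot>\<^bsub>D\<^esub> cmult (z \<oplus> z) e = cmult z e"
  proof -
    have "h \<odot> (z \<oplus> z) = h \<odot> ((\<one>\<^bsub>K\<^esub> \<oplus>\<^bsub>K\<^esub> \<one>\<^bsub>K\<^esub>) \<odot> z)" using zc by (simp add: smult_l_distr)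
    also have "\<dots> = z" using half zc by (simp add: smult_assoc1[symmetric])
    finally show ?thesis
      using cmult_simps(3)[OF A.center_closed(3)[OF z z] z e half(1)] by simp
  qed
  obtain Y where Y: "(lie_step K D)\<^sup>*\<^sup>* (carrier D) Y" "Y \<subseteq> InnDer A"
    using solvable by (auto simp: solvable_modulo_def)
  have "e \<in> Y \<and> cmult z e \<in> Y \<and> cmult (z \<otimes> z) e \<in> Y"
    using Y(1)
  proof (induction rule: rtranclp_induct)
    case base
    then show ?case using e z zz by (simp add: cmult_derivation)
  next
    case (step X W)
    then have W: "submodule W K D" and br: "\<And>x y. x \<in> X \<Longrightarrow> y \<in> X \<Longrightarrow> x \<otimes>\<^bsub>D\<^esub> y \<in> W"
      by (auto simp: lie_step_def)
    have "e \<in> W" "cmult (z \<oplus> z) e \<in> W" "cmult (z \<otimes> z) e \<in> W"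
      using step.IH br[of e "cmult z e"] br[of e "cmult (z \<otimes> z) e"] br[of "cmult z e" "cmult (z \<otimes> z) e"]
      by (simp_all add: b1 b2 b3)
    then show ?case
      using der.submodule_smult[OF W half(1), of "cmult (z \<oplus> z) e"] by (simp add: half_twice)
  qed
  then obtain x where "x \<in> carrier A" "e = inner x" using Y(2) by (auto simp: InnDer_eq)
  then show False using inner_center[OF _ z] ez nontrivial by simp
qed

end

section \<open>Group algebras of finite groups\<close>

lemma (in abelian_monoid) finsum_swap:
  assumes "finite I" "finite J" "\<And>i j. \<lbrakk>i \<in> I; j \<in> J\<rbrakk> \<Longrightarrow> f i j \<in> carrier G"
  shows "(\<Oplus>i\<in>I. \<Oplus>j\<in>J. f i j) = (\<Oplus>j\<in>J. \<Oplus>i\<in>I. f i j)"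
  using assms(1,3)
proof (induction I rule: finite_induct)
  case (insert i I)
  have "(\<Oplus>i\<in>insert i I. \<Oplus>j\<in>J. f i j) = (\<Oplus>j\<in>J. f i j) \<oplus> (\<Oplus>i\<in>I. \<Oplus>j\<in>J. f i j)"
    using insert by (intro finsum_insert) (auto intro!: finsum_closed)
  also have "\<dots> = (\<Oplus>j\<in>J. f i j) \<oplus> (\<Oplus>j\<in>J. \<Oplus>i\<in>I. f i j)"
    using insert by simp
  also have "\<dots> = (\<Oplus>j\<in>J. f i j \<oplus> (\<Oplus>i\<in>I. f i j))"
    using insert by (intro finsum_addf[symmetric]) (auto intro!: finsum_closed)
  also have "\<dots> = (\<Oplus>j\<in>J. \<Oplus>i\<in>insert i I. f i j)"
    using insert by (intro finsum_cong') (auto intro!: finsum_closed)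
  finally show ?case .
qed (simp add: finsum_zero)

text \<open>
  For a finite group the elements of the group algebra are all functions on the group, and the
  convolution is a sum over the whole group, see lemma \<open>A_mult\<close>.
\<close>
locale finite_group_algebra = G?: group G + K?: cring K for G (structure) and K (structure) +
  assumes finite_group [simp, intro]: "finite (carrier G)"
begin

abbreviation A where "A \<equiv> group_algebra K G"

lemma A_carrier: "carrier A = carrier G \<rightarrow>\<^sub>E carrier K"
  using finite_group by (auto simp: group_algebra_def)

lemma A_apply: "\<lbrakk>u \<in> carrier A; g \<in> carrier G\<rbrakk> \<Longrightarrow> u g \<in> carrier K"
  by (auto simp: A_carrier)

lemma A_eqI: "\<lbrakk>u \<in> carrier A; v \<in> carrier A; \<And>g. g \<in> carrier G \<Longrightarrow> u g = v g\<rbrakk> \<Longrightarrow> u = v"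
  by (auto simp: A_carrier intro: PiE_ext)

lemma A_closed:
  "\<zero>\<^bsub>A\<^esub> \<in> carrier A" "\<one>\<^bsub>A\<^esub> \<in> carrier A"
  "\<lbrakk>u \<in> carrier A; v \<in> carrier A\<rbrakk> \<Longrightarrow> u \<oplus>\<^bsub>A\<^esub> v \<in> carrier A"
  "\<lbrakk>c \<in> carrier K; v \<in> carrier A\<rbrakk> \<Longrightarrow> c \<odot>\<^bsub>A\<^esub> v \<in> carrier A"
  "(\<And>g. g \<in> carrier G \<Longrightarrow> f g \<in> carrier K) \<Longrightarrow> (\<lambda>g\<in>carrier G. f g) \<in> carrier A"
  by (auto simp: A_carrier, auto simp: group_algebra_def)

lemma A_simps:
  assumes "g \<in> carrier G"
  shows "\<zero>\<^bsub>A\<^esub> g = \<zero>\<^bsub>K\<^esub>" "\<one>\<^bsub>A\<^esub> g = (if g = \<one> then \<one>\<^bsub>K\<^esub> else \<zero>\<^bsub>K\<^esub>)"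
    "(u \<oplus>\<^bsub>A\<^esub> v) g = u g \<oplus>\<^bsub>K\<^esub> v g" "(c \<odot>\<^bsub>A\<^esub> v) g = c \<otimes>\<^bsub>K\<^esub> v g"
  using assms by (auto simp: group_algebra_def)

lemma A_mult_closed: "\<lbrakk>u \<in> carrier A; v \<in> carrier A\<rbrakk> \<Longrightarrow> u \<otimes>\<^bsub>A\<^esub> v \<in> carrier A"
  by (simp add: A_carrier, fastforce simp: group_algebra_def PiE_iff intro!: K.finsum_closed)

lemma A_mult:
  assumes u: "u \<in> carrier A" and v: "v \<in> carrier A" and g: "g \<in> carrier G"
  shows "(u \<otimes>\<^bsub>A\<^esub> v) g = (\<Oplus>\<^bsub>K\<^esub>x\<in>carrier G. u x \<otimes>\<^bsub>K\<^esub> v (inv x \<otimes> g))"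
proof -
  note [simp] = A_apply[OF u] A_apply[OF v]
  have "(u \<otimes>\<^bsub>A\<^esub> v) g = (\<Oplus>\<^bsub>K\<^esub>x\<in>{x \<in> carrier G. u x \<noteq> \<zero>\<^bsub>K\<^esub>}. u x \<otimes>\<^bsub>K\<^esub> v (inv x \<otimes> g))"
    using g by (simp add: group_algebra_def)
  also have "\<dots> = (\<Oplus>\<^bsub>K\<^esub>x\<in>carrier G. u x \<otimes>\<^bsub>K\<^esub> v (inv x \<otimes> g))"
    using u v g by (intro K.add.finprod_mono_neutral_cong_left) auto
  finally show ?thesis .
qed

lemma sum_translate:
  assumes "x \<in> carrier G" "\<And>y. y \<in> carrier G \<Longrightarrow> f y \<in> carrier K"
  shows "(\<Oplus>\<^bsub>K\<^esub>y\<in>carrier G. f (x \<otimes> y)) = (\<Oplus>\<^bsub>K\<^esub>y\<in>carrier G. f y)"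
  using K.finsum_reindex[of f "\<lambda>y. x \<otimes> y" "carrier G"] G.surj_const_mult[of x] G.inj_on_cmult[of x] assms
  by auto

lemma abelian_group_A: "abelian_group A"
proof (rule abelian_groupI)
  fix u assume u: "u \<in> carrier A"
  note [simp] = A_apply[OF u]
  show "\<exists>v\<in>carrier A. v \<oplus>\<^bsub>A\<^esub> u = \<zero>\<^bsub>A\<^esub>"
    using u by (intro bexI[of _ "\<lambda>g\<in>carrier G. \<ominus>\<^bsub>K\<^esub> u g"] A_eqI)
      (auto simp: A_closed A_simps K.l_neg)
next
  fix u v w assume uvw: "u \<in> carrier A" "v \<in> carrier A" "w \<in> carrier A"
  then show "u \<oplus>\<^bsub>A\<^esub> v \<oplus>\<^bsub>A\<^esub> w = u \<oplus>\<^bsub>A\<^esub> (v \<oplus>\<^bsub>A\<^esub> w)"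
    by (rule_tac A_eqI) (simp_all add: A_closed A_simps A_apply[of u] A_apply[of v] A_apply[of w] K.a_assoc)
next
  fix u v assume uv: "u \<in> carrier A" "v \<in> carrier A"
  then show "u \<oplus>\<^bsub>A\<^esub> v = v \<oplus>\<^bsub>A\<^esub> u"
    by (rule_tac A_eqI) (simp_all add: A_closed A_simps A_apply[of u] A_apply[of v] K.a_comm)
next
  fix u assume u: "u \<in> carrier A"
  then show "\<zero>\<^bsub>A\<^esub> \<oplus>\<^bsub>A\<^esub> u = u"
    by (rule_tac A_eqI) (simp_all add: A_closed A_simps A_apply[of u])
qed (simp_all add: A_closed)

lemma A_mult_assoc:
  assumes u: "u \<in> carrier A" and v: "v \<in> carrier A" and w: "w \<in> carrier A"
  shows "u \<otimes>\<^bsub>A\<^esub> v \<otimes>\<^bsub>A\<^esub> w = u \<otimes>\<^bsub>A\<^esub> (v \<otimes>\<^bsub>A\<^esub> w)"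
proof (rule A_eqI)
  note [simp] = A_apply[OF u] A_apply[OF v] A_apply[OF w] A_apply[OF A_mult_closed[OF v w]]
  fix g assume g: "g \<in> carrier G"
  have "(u \<otimes>\<^bsub>A\<^esub> v \<otimes>\<^bsub>A\<^esub> w) g =
      (\<Oplus>\<^bsub>K\<^esub>y\<in>carrier G. (\<Oplus>\<^bsub>K\<^esub>x\<in>carrier G. u x \<otimes>\<^bsub>K\<^esub> v (inv x \<otimes> y)) \<otimes>\<^bsub>K\<^esub> w (inv y \<otimes> g))"
    using u v w g by (subst A_mult) (auto intro!: K.finsum_cong' K.finsum_closed simp: A_mult A_mult_closed)
  also have "\<dots> = (\<Oplus>\<^bsub>K\<^esub>y\<in>carrier G. \<Oplus>\<^bsub>K\<^esub>x\<in>carrier G. u x \<otimes>\<^bsub>K\<^esub> v (inv x \<otimes> y) \<otimes>\<^bsub>K\<^esub> w (inv y \<otimes> g))"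
    using u v w g by (intro K.finsum_cong' K.finsum_ldistr) (auto intro!: K.finsum_closed)
  also have "\<dots> = (\<Oplus>\<^bsub>K\<^esub>x\<in>carrier G. \<Oplus>\<^bsub>K\<^esub>y\<in>carrier G. u x \<otimes>\<^bsub>K\<^esub> v (inv x \<otimes> y) \<otimes>\<^bsub>K\<^esub> w (inv y \<otimes> g))"
    using u v w g by (intro K.finsum_swap) auto
  also have "\<dots> = (\<Oplus>\<^bsub>K\<^esub>x\<in>carrier G. u x \<otimes>\<^bsub>K\<^esub> (v \<otimes>\<^bsub>A\<^esub> w) (inv x \<otimes> g))"
  proof (intro K.finsum_cong' refl)
    fix x assume x: "x \<in> carrier G"
    have "(\<Oplus>\<^bsub>K\<^esub>y\<in>carrier G. u x \<otimes>\<^bsub>K\<^esub> v (inv x \<otimes> y) \<otimes>\<^bsub>K\<^esub> w (inv y \<otimes> g)) =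
        (\<Oplus>\<^bsub>K\<^esub>y\<in>carrier G. u x \<otimes>\<^bsub>K\<^esub> v (inv x \<otimes> (x \<otimes> y)) \<otimes>\<^bsub>K\<^esub> w (inv (x \<otimes> y) \<otimes> g))"
      using u v w g x by (intro sum_translate[symmetric]) auto
    also have "\<dots> = (\<Oplus>\<^bsub>K\<^esub>y\<in>carrier G. u x \<otimes>\<^bsub>K\<^esub> (v y \<otimes>\<^bsub>K\<^esub> w (inv y \<otimes> (inv x \<otimes> g))))"
      using u v w g x
      by (intro K.finsum_cong')
        (auto simp: G.m_assoc[symmetric] G.inv_mult_group K.m_assoc)
    also have "\<dots> = u x \<otimes>\<^bsub>K\<^esub> (v \<otimes>\<^bsub>A\<^esub> w) (inv x \<otimes> g)"
      using u v w g x by (subst A_mult) (auto intro!: K.finsum_rdistr[symmetric])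
    finally show "(\<Oplus>\<^bsub>K\<^esub>y\<in>carrier G. u x \<otimes>\<^bsub>K\<^esub> v (inv x \<otimes> y) \<otimes>\<^bsub>K\<^esub> w (inv y \<otimes> g)) =
      u x \<otimes>\<^bsub>K\<^esub> (v \<otimes>\<^bsub>A\<^esub> w) (inv x \<otimes> g)" .
  qed (use u v w g in \<open>auto simp: A_mult_closed\<close>)
  also have "\<dots> = (u \<otimes>\<^bsub>A\<^esub> (v \<otimes>\<^bsub>A\<^esub> w)) g"
    using u v w g by (simp add: A_mult A_mult_closed)
  finally show "(u \<otimes>\<^bsub>A\<^esub> v \<otimes>\<^bsub>A\<^esub> w) g = (u \<otimes>\<^bsub>A\<^esub> (v \<otimes>\<^bsub>A\<^esub> w)) g" .
qed (use u v w in \<open>auto intro!: A_mult_closed\<close>)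

text \<open>
  The group element \<open>x\<close> as an element of the group algebra.
\<close>
definition gelt :: "'a \<Rightarrow> 'a \<Rightarrow> 'c" where
  "gelt x = (\<lambda>g\<in>carrier G. if g = x then \<one>\<^bsub>K\<^esub> else \<zero>\<^bsub>K\<^esub>)"

lemma gelt_closed [simp, intro]: "gelt x \<in> carrier A"
  by (auto simp: gelt_def A_carrier)

lemma gelt_one: "gelt \<one> = \<one>\<^bsub>A\<^esub>"
  by (auto simp: gelt_def group_algebra_def)

lemma gelt_mult_apply:
  assumes x: "x \<in> carrier G" and u: "u \<in> carrier A" and g: "g \<in> carrier G"
  shows "(gelt x \<otimes>\<^bsub>A\<^esub> u) g = u (inv x \<otimes> g)"
proof -
  note [simp] = A_apply[OF u]
  have "(gelt x \<otimes>\<^bsub>A\<^esub> u) g = (\<Oplus>\<^bsub>K\<^esub>y\<in>carrier G. if x = y then u (inv y \<otimes> g) else \<zero>\<^bsub>K\<^esub>)"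
    using assms by (simp add: A_mult) (auto intro!: K.finsum_cong' simp: gelt_def)
  also have "\<dots> = u (inv x \<otimes> g)"
    using assms by (intro K.add.finprod_singleton) auto
  finally show ?thesis .
qed

lemma mult_gelt_apply:
  assumes x: "x \<in> carrier G" and u: "u \<in> carrier A" and g: "g \<in> carrier G"
  shows "(u \<otimes>\<^bsub>A\<^esub> gelt x) g = u (g \<otimes> inv x)"
proof -
  note [simp] = A_apply[OF u]
  have eq: "inv y \<otimes> g = x \<longleftrightarrow> g \<otimes> inv x = y" if "y \<in> carrier G" for y
    using that x g G.inv_solve_left[of x y g] G.inv_solve_right[of y g x] by auto
  have "(u \<otimes>\<^bsub>A\<^esub> gelt x) g = (\<Oplus>\<^bsub>K\<^esub>y\<in>carrier G. if g \<otimes> inv x = y then u y else \<zero>\<^bsub>K\<^esub>)"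
    using assms by (simp add: A_mult) (auto intro!: K.finsum_cong' simp: gelt_def eq)
  also have "\<dots> = u (g \<otimes> inv x)"
    using assms by (intro K.add.finprod_singleton) auto
  finally show ?thesis .
qed

sublocale alg: k_algebra A K
proof -
  have "ring A"
  proof (rule ringI[OF abelian_group_A])
    show "Group.monoid A"
    proof (rule monoidI)
      fix u assume u: "u \<in> carrier A"
      show "\<one>\<^bsub>A\<^esub> \<otimes>\<^bsub>A\<^esub> u = u" "u \<otimes>\<^bsub>A\<^esub> \<one>\<^bsub>A\<^esub> = u"
        using u by (auto intro!: A_eqI A_mult_closed simp: gelt_one[symmetric] gelt_mult_apply mult_gelt_apply)
    qed (auto simp: A_closed A_mult_closed A_mult_assoc)
    fix u v w assume uvw: "u \<in> carrier A" "v \<in> carrier A" "w \<in> carrier A"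
    note [simp] = uvw[THEN A_apply]
    show "(u \<oplus>\<^bsub>A\<^esub> v) \<otimes>\<^bsub>A\<^esub> w = u \<otimes>\<^bsub>A\<^esub> w \<oplus>\<^bsub>A\<^esub> v \<otimes>\<^bsub>A\<^esub> w"
    proof (rule A_eqI)
      fix g assume g: "g \<in> carrier G"
      have "((u \<oplus>\<^bsub>A\<^esub> v) \<otimes>\<^bsub>A\<^esub> w) g =
          (\<Oplus>\<^bsub>K\<^esub>x\<in>carrier G. u x \<otimes>\<^bsub>K\<^esub> w (inv x \<otimes> g) \<oplus>\<^bsub>K\<^esub> v x \<otimes>\<^bsub>K\<^esub> w (inv x \<otimes> g))"
        using uvw g unfolding A_mult[OF A_closed(3)[OF uvw(1,2)] uvw(3) g]
        by (intro K.finsum_cong') (auto simp: A_simps K.l_distr)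
      then show "((u \<oplus>\<^bsub>A\<^esub> v) \<otimes>\<^bsub>A\<^esub> w) g = (u \<otimes>\<^bsub>A\<^esub> w \<oplus>\<^bsub>A\<^esub> v \<otimes>\<^bsub>A\<^esub> w) g"
        using uvw g by (simp add: A_simps A_mult)
    qed (use uvw in \<open>auto intro: A_closed A_mult_closed\<close>)
    show "w \<otimes>\<^bsub>A\<^esub> (u \<oplus>\<^bsub>A\<^esub> v) = w \<otimes>\<^bsub>A\<^esub> u \<oplus>\<^bsub>A\<^esub> w \<otimes>\<^bsub>A\<^esub> v"
    proof (rule A_eqI)
      fix g assume g: "g \<in> carrier G"
      have "(w \<otimes>\<^bsub>A\<^esub> (u \<oplus>\<^bsub>A\<^esub> v)) g =
          (\<Oplus>\<^bsub>K\<^esub>x\<in>carrier G. w x \<otimes>\<^bsub>K\<^esub> u (inv x \<otimes> g) \<oplus>\<^bsub>K\<^esub> w x \<otimes>\<^bsub>K\<^esub> v (inv x \<otimes> g))"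
        using uvw g unfolding A_mult[OF uvw(3) A_closed(3)[OF uvw(1,2)] g]
        by (intro K.finsum_cong') (auto simp: A_simps K.r_distr)
      then show "(w \<otimes>\<^bsub>A\<^esub> (u \<oplus>\<^bsub>A\<^esub> v)) g = (w \<otimes>\<^bsub>A\<^esub> u \<oplus>\<^bsub>A\<^esub> w \<otimes>\<^bsub>A\<^esub> v) g"
        using uvw g by (simp add: A_simps A_mult)
    qed (use uvw in \<open>auto intro: A_closed A_mult_closed\<close>)
  qed
  moreover have "module K A"
  proof (rule moduleI[OF K.cring_axioms abelian_group_A])
    show "\<one>\<^bsub>K\<^esub> \<odot>\<^bsub>A\<^esub> u = u" if "u \<in> carrier A" for u
      using that by (intro A_eqI) (simp_all add: A_closed A_simps A_apply[of u])
    show "(a \<oplus>\<^bsub>K\<^esub> b) \<odot>\<^bsub>A\<^esub> u = a \<odot>\<^bsub>A\<^esub> u \<oplus>\<^bsub>A\<^esub> b \<odot>\<^bsub>A\<^esub> u" "a \<otimes>\<^bsub>K\<^esub> b \<odot>\<^bsub>A\<^esub> u = a \<odot>\<^bsub>A\<^esub> (b \<odot>\<^bsub>A\<^esub> u)"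
      if "a \<in> carrier K" "b \<in> carrier K" "u \<in> carrier A" for a b u
      using that by (auto intro!: A_eqI A_closed simp: A_simps A_apply[of u] K.l_distr K.m_assoc)
    show "a \<odot>\<^bsub>A\<^esub> (u \<oplus>\<^bsub>A\<^esub> v) = a \<odot>\<^bsub>A\<^esub> u \<oplus>\<^bsub>A\<^esub> a \<odot>\<^bsub>A\<^esub> v"
      if "a \<in> carrier K" "u \<in> carrier A" "v \<in> carrier A" for a u v
      using that by (auto intro!: A_eqI A_closed simp: A_simps A_apply[of u] A_apply[of v] K.r_distr)
  qed (rule A_closed)
  moreover have "k_algebra_axioms A K"
  proof
    fix c u v assume cuv: "c \<in> carrier K" "u \<in> carrier A" "v \<in> carrier A"
    note [simp] = A_apply[OF cuv(2)] A_apply[OF cuv(3)]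
    show "(c \<odot>\<^bsub>A\<^esub> u) \<otimes>\<^bsub>A\<^esub> v = c \<odot>\<^bsub>A\<^esub> (u \<otimes>\<^bsub>A\<^esub> v)"
    proof (rule A_eqI)
      fix g assume g: "g \<in> carrier G"
      have "((c \<odot>\<^bsub>A\<^esub> u) \<otimes>\<^bsub>A\<^esub> v) g =
          (\<Oplus>\<^bsub>K\<^esub>x\<in>carrier G. c \<otimes>\<^bsub>K\<^esub> (u x \<otimes>\<^bsub>K\<^esub> v (inv x \<otimes> g)))"
        using cuv g unfolding A_mult[OF A_closed(4)[OF cuv(1,2)] cuv(3) g]
        by (intro K.finsum_cong') (auto simp: A_simps K.m_assoc)
      also have "\<dots> = c \<otimes>\<^bsub>K\<^esub> (\<Oplus>\<^bsub>K\<^esub>x\<in>carrier G. u x \<otimes>\<^bsub>K\<^esub> v (inv x \<otimes> g))"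
        using cuv g by (intro K.finsum_rdistr[symmetric]) auto
      finally show "((c \<odot>\<^bsub>A\<^esub> u) \<otimes>\<^bsub>A\<^esub> v) g = (c \<odot>\<^bsub>A\<^esub> (u \<otimes>\<^bsub>A\<^esub> v)) g"
        using cuv g by (simp add: A_simps A_mult)
    qed (use cuv in \<open>auto intro: A_closed A_mult_closed\<close>)
    show "u \<otimes>\<^bsub>A\<^esub> (c \<odot>\<^bsub>A\<^esub> v) = c \<odot>\<^bsub>A\<^esub> (u \<otimes>\<^bsub>A\<^esub> v)"
    proof (rule A_eqI)
      fix g assume g: "g \<in> carrier G"
      have "(u \<otimes>\<^bsub>A\<^esub> (c \<odot>\<^bsub>A\<^esub> v)) g =
          (\<Oplus>\<^bsub>K\<^esub>x\<in>carrier G. c \<otimes>\<^bsub>K\<^esub> (u x \<otimes>\<^bsub>K\<^esub> v (inv x \<otimes> g)))"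
        using cuv g unfolding A_mult[OF cuv(2) A_closed(4)[OF cuv(1,3)] g]
        by (intro K.finsum_cong') (auto simp: A_simps K.m_lcomm)
      also have "\<dots> = c \<otimes>\<^bsub>K\<^esub> (\<Oplus>\<^bsub>K\<^esub>x\<in>carrier G. u x \<otimes>\<^bsub>K\<^esub> v (inv x \<otimes> g))"
        using cuv g by (intro K.finsum_rdistr[symmetric]) auto
      finally show "(u \<otimes>\<^bsub>A\<^esub> (c \<odot>\<^bsub>A\<^esub> v)) g = (c \<odot>\<^bsub>A\<^esub> (u \<otimes>\<^bsub>A\<^esub> v)) g"
        using cuv g by (simp add: A_simps A_mult)
    qed (use cuv in \<open>auto intro: A_closed A_mult_closed\<close>)
  qed
  ultimately show "k_algebra A K" by (simp add: k_algebra_def)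
qed

lemma A_finsum_apply:
  assumes "f \<in> I \<rightarrow> carrier A" "g \<in> carrier G"
  shows "(\<Oplus>\<^bsub>A\<^esub>i\<in>I. f i) g = (\<Oplus>\<^bsub>K\<^esub>i\<in>I. f i g)"
  using assms(1)
proof (induction I rule: infinite_finite_induct)
  case (insert i I)
  have "(\<lambda>i. f i g) \<in> I \<rightarrow> carrier K" "f i g \<in> carrier K" using insert.prems assms(2) A_apply by auto
  then show ?case
    using insert assms(2) by (simp add: A_simps)
qed (use assms(2) in \<open>auto simp: A_simps\<close>)

lemma A_expand:
  assumes u: "u \<in> carrier A"
  shows "u = (\<Oplus>\<^bsub>A\<^esub>x\<in>carrier G. u x \<odot>\<^bsub>A\<^esub> gelt x)"
proof (rule A_eqI[OF u])
  note [simp] = A_apply[OF u]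
  fix g assume g: "g \<in> carrier G"
  have "(\<Oplus>\<^bsub>A\<^esub>x\<in>carrier G. u x \<odot>\<^bsub>A\<^esub> gelt x) g = (\<Oplus>\<^bsub>K\<^esub>x\<in>carrier G. if g = x then u x else \<zero>\<^bsub>K\<^esub>)"
    using u g by (subst A_finsum_apply) (auto intro!: K.finsum_cong' A_closed(4), auto simp: A_simps gelt_def)
  also have "\<dots> = u g" using u g by (intro K.add.finprod_singleton) auto
  finally show "u g = (\<Oplus>\<^bsub>A\<^esub>x\<in>carrier G. u x \<odot>\<^bsub>A\<^esub> gelt x) g" by simp
qed (use A_apply[OF u] in \<open>auto intro!: alg.A.finsum_closed A_closed(4)\<close>)

lemma A_induct [consumes 1, case_names zero add gelt]:
  assumes u: "u \<in> carrier A"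
    and zero: "P \<zero>\<^bsub>A\<^esub>"
    and add: "\<And>v w. \<lbrakk>v \<in> carrier A; w \<in> carrier A; P v; P w\<rbrakk> \<Longrightarrow> P (v \<oplus>\<^bsub>A\<^esub> w)"
    and gelt: "\<And>c x. \<lbrakk>c \<in> carrier K; x \<in> carrier G\<rbrakk> \<Longrightarrow> P (c \<odot>\<^bsub>A\<^esub> gelt x)"
  shows "P u"
proof -
  have "P (\<Oplus>\<^bsub>A\<^esub>x\<in>X. u x \<odot>\<^bsub>A\<^esub> gelt x)" if "X \<subseteq> carrier G" for X
    using finite_subset[OF that finite_group] that
  proof (induction X rule: finite_induct)
    case (insert x X)
    have cl: "(\<lambda>x. u x \<odot>\<^bsub>A\<^esub> gelt x) \<in> X \<rightarrow> carrier A" "u x \<odot>\<^bsub>A\<^esub> gelt x \<in> carrier A"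
      using insert.prems A_apply[OF u] by (auto intro: A_closed(4))
    show ?case
      using insert cl A_apply[OF u] by (simp, intro add gelt) (auto intro: alg.A.finsum_closed)
  qed (simp add: zero)
  then show ?thesis using A_expand[OF u] by (metis subset_refl)
qed

lemma gelt_mult: "\<lbrakk>x \<in> carrier G; y \<in> carrier G\<rbrakk> \<Longrightarrow> gelt x \<otimes>\<^bsub>A\<^esub> gelt y = gelt (x \<otimes> y)"
proof (rule A_eqI)
  fix g assume "x \<in> carrier G" "y \<in> carrier G" "g \<in> carrier G"
  then show "(gelt x \<otimes>\<^bsub>A\<^esub> gelt y) g = gelt (x \<otimes> y) g"
    using G.inv_solve_left[of y x g] by (simp add: gelt_mult_apply) (auto simp: gelt_def)
qed (auto intro: A_mult_closed)

text \<open>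
  Substitute \<open>x = g y\<^sup>-\<^sup>1\<close> in the convolution sum for \<open>u v\<close> at \<open>g\<close>.
\<close>
lemma class_function_central:
  assumes u: "u \<in> carrier A" and cl: "\<And>x y. \<lbrakk>x \<in> carrier G; y \<in> carrier G\<rbrakk> \<Longrightarrow> u (x \<otimes> y) = u (y \<otimes> x)"
  shows "u \<in> ring_center A"
  unfolding ring_center_def
proof (intro CollectI conjI ballI u A_eqI)
  fix v g assume v: "v \<in> carrier A" and g: "g \<in> carrier G"
  note [simp] = A_apply[OF u] A_apply[OF v]
  have bij: "(\<lambda>y. g \<otimes> inv y) ` carrier G = carrier G" "inj_on (\<lambda>y. g \<otimes> inv y) (carrier G)"
  proof -
    show "inj_on (\<lambda>y. g \<otimes> inv y) (carrier G)"
      using g by (intro inj_onI) (metis G.Units_eq G.Units_l_cancel G.inv_closed G.inv_inv)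
    show "(\<lambda>y. g \<otimes> inv y) ` carrier G = carrier G"
    proof (intro equalityI subsetI)
      fix x assume x: "x \<in> carrier G"
      have "x = g \<otimes> inv (inv x \<otimes> g)"
        using x g by (simp add: G.inv_mult_group G.m_assoc[symmetric])
      then show "x \<in> (\<lambda>y. g \<otimes> inv y) ` carrier G"
        by (rule image_eqI) (use x g in simp)
    qed (use g in auto)
  qed
  have "(u \<otimes>\<^bsub>A\<^esub> v) g = (\<Oplus>\<^bsub>K\<^esub>x\<in>(\<lambda>y. g \<otimes> inv y) ` carrier G. u x \<otimes>\<^bsub>K\<^esub> v (inv x \<otimes> g))"
    using u v g by (simp add: A_mult bij(1))
  also have "\<dots> = (\<Oplus>\<^bsub>K\<^esub>y\<in>carrier G. u (g \<otimes> inv y) \<otimes>\<^bsub>K\<^esub> v (inv (g \<otimes> inv y) \<otimes> g))"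
    using u v g by (intro K.finsum_reindex bij(2)) auto
  also have "\<dots> = (\<Oplus>\<^bsub>K\<^esub>y\<in>carrier G. v y \<otimes>\<^bsub>K\<^esub> u (inv y \<otimes> g))"
  proof (intro K.finsum_cong' refl)
    fix y assume y: "y \<in> carrier G"
    have "inv (g \<otimes> inv y) \<otimes> g = y" using g y by (simp add: G.inv_mult_group G.m_assoc)
    then show "u (g \<otimes> inv y) \<otimes>\<^bsub>K\<^esub> v (inv (g \<otimes> inv y) \<otimes> g) = v y \<otimes>\<^bsub>K\<^esub> u (inv y \<otimes> g)"
      using cl[of g "inv y"] g y by (simp add: K.m_comm)
  qed (use g in auto)
  also have "\<dots> = (v \<otimes>\<^bsub>A\<^esub> u) g" using u v g by (simp add: A_mult)
  finally show "(u \<otimes>\<^bsub>A\<^esub> v) g = (v \<otimes>\<^bsub>A\<^esub> u) g" .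
qed (use u in \<open>auto intro!: A_mult_closed\<close>)

subsection \<open>The augmentation\<close>

definition aug :: "('a \<Rightarrow> 'c) \<Rightarrow> 'c" where
  "aug u = (\<Oplus>\<^bsub>K\<^esub>g\<in>carrier G. u g)"

lemma aug_closed [simp]: "u \<in> carrier A \<Longrightarrow> aug u \<in> carrier K"
  by (auto simp: aug_def A_apply[of u] intro!: K.finsum_closed)

lemma aug_add:
  assumes u: "u \<in> carrier A" and v: "v \<in> carrier A"
  shows "aug (u \<oplus>\<^bsub>A\<^esub> v) = aug u \<oplus>\<^bsub>K\<^esub> aug v"
proof -
  note [simp] = A_apply[OF u] A_apply[OF v]
  have "aug (u \<oplus>\<^bsub>A\<^esub> v) = (\<Oplus>\<^bsub>K\<^esub>g\<in>carrier G. u g \<oplus>\<^bsub>K\<^esub> v g)"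
    unfolding aug_def by (intro K.finsum_cong') (auto simp: A_simps)
  also have "\<dots> = (\<Oplus>\<^bsub>K\<^esub>g\<in>carrier G. u g) \<oplus>\<^bsub>K\<^esub> (\<Oplus>\<^bsub>K\<^esub>g\<in>carrier G. v g)"
    by (intro K.finsum_addf) auto
  finally show ?thesis by (simp add: aug_def)
qed

lemma aug_smult: "\<lbrakk>c \<in> carrier K; v \<in> carrier A\<rbrakk> \<Longrightarrow> aug (c \<odot>\<^bsub>A\<^esub> v) = c \<otimes>\<^bsub>K\<^esub> aug v"
  unfolding aug_def by (subst K.finsum_rdistr) (auto intro!: K.finsum_cong' simp: A_simps A_apply[of v])

lemma aug_gelt: "x \<in> carrier G \<Longrightarrow> aug (gelt x) = \<one>\<^bsub>K\<^esub>"
  using K.add.finprod_singleton_swap[of x "carrier G" "\<lambda>_. \<one>\<^bsub>K\<^esub>"]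
  unfolding aug_def by (subst K.finsum_cong'[OF refl]) (auto simp: gelt_def)

lemma aug_mult:
  assumes u: "u \<in> carrier A" and v: "v \<in> carrier A"
  shows "aug (u \<otimes>\<^bsub>A\<^esub> v) = aug u \<otimes>\<^bsub>K\<^esub> aug v"
proof -
  note [simp] = A_apply[OF u] A_apply[OF v]
  have "aug (u \<otimes>\<^bsub>A\<^esub> v) = (\<Oplus>\<^bsub>K\<^esub>g\<in>carrier G. \<Oplus>\<^bsub>K\<^esub>x\<in>carrier G. u x \<otimes>\<^bsub>K\<^esub> v (inv x \<otimes> g))"
    unfolding aug_def using u v by (intro K.finsum_cong') (auto simp: A_mult intro!: K.finsum_closed)
  also have "\<dots> = (\<Oplus>\<^bsub>K\<^esub>x\<in>carrier G. \<Oplus>\<^bsub>K\<^esub>g\<in>carrier G. u x \<otimes>\<^bsub>K\<^esub> v (inv x \<otimes> g))"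
    using u v by (intro K.finsum_swap) auto
  also have "\<dots> = (\<Oplus>\<^bsub>K\<^esub>x\<in>carrier G. u x \<otimes>\<^bsub>K\<^esub> aug v)"
  proof (intro K.finsum_cong' refl)
    fix x assume x: "x \<in> carrier G"
    have "(\<Oplus>\<^bsub>K\<^esub>g\<in>carrier G. u x \<otimes>\<^bsub>K\<^esub> v (inv x \<otimes> g)) = (\<Oplus>\<^bsub>K\<^esub>g\<in>carrier G. u x \<otimes>\<^bsub>K\<^esub> v g)"
      using u v x sum_translate[of "inv x" "\<lambda>g. u x \<otimes>\<^bsub>K\<^esub> v g"] by auto
    also have "\<dots> = u x \<otimes>\<^bsub>K\<^esub> aug v"
      unfolding aug_def using u v x by (subst K.finsum_rdistr) auto
    finally show "(\<Oplus>\<^bsub>K\<^esub>g\<in>carrier G. u x \<otimes>\<^bsub>K\<^esub> v (inv x \<otimes> g)) = u x \<otimes>\<^bsub>K\<^esub> aug v" .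
  qed (use u v in auto)
  also have "\<dots> = aug u \<otimes>\<^bsub>K\<^esub> aug v"
    using u v by (subst aug_def) (subst K.finsum_ldistr, auto)
  finally show ?thesis .
qed

lemma aug_one: "aug \<one>\<^bsub>A\<^esub> = \<one>\<^bsub>K\<^esub>"
  using aug_gelt[of \<one>] by (simp add: gelt_one)

lemma aug_zero: "aug \<zero>\<^bsub>A\<^esub> = \<zero>\<^bsub>K\<^esub>"
  using aug_smult[of "\<zero>\<^bsub>K\<^esub>" "\<zero>\<^bsub>A\<^esub>"] by (simp add: A_closed)

lemma aug_neg: "u \<in> carrier A \<Longrightarrow> aug (\<ominus>\<^bsub>A\<^esub> u) = \<ominus>\<^bsub>K\<^esub> aug u"
  using aug_add[of "\<ominus>\<^bsub>A\<^esub> u" u]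
  by (intro K.minus_equality[symmetric]) (simp_all add: alg.A.l_neg aug_zero)

lemma aug_minus: "\<lbrakk>u \<in> carrier A; v \<in> carrier A\<rbrakk> \<Longrightarrow> aug (u \<ominus>\<^bsub>A\<^esub> v) = aug u \<ominus>\<^bsub>K\<^esub> aug v"
  by (simp add: a_minus_def aug_add aug_neg)

end

section \<open>The augmentation ideal of a p-group in characteristic p\<close>

subsection \<open>The Frobenius identity\<close>

context ring
begin

text \<open>
  The binomial theorem, for the only pair of commuting elements that is needed. With \<open>1 + x\<close> in place
  of \<open>x - 1\<close> no signs occur.
\<close>
lemma one_add_power:
  assumes x: "x \<in> carrier R"
  shows "(\<one> \<oplus> x) [^] (n::nat) = (\<Oplus>i\<in>{..n}. [(n choose i)] \<cdot> (x [^] i))"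
proof (induction n)
  case 0
  then show ?case using x by simp
next
  case (Suc n)
  let ?t = "\<lambda>n i. [(n choose i)] \<cdot> (x [^] (i::nat))"
  have cl [simp]: "?t n i \<in> carrier R" for n i using x by simp
  have 1: "(\<Oplus>i\<in>{..n}. ?t n i) \<otimes> x = (\<Oplus>i\<in>{..n}. [(n choose i)] \<cdot> (x [^] Suc i))"
    using x by (subst finsum_ldistr) (auto simp: add_pow_ldistr Pi_def)
  have "?t n (Suc n) = \<zero>" by (simp add: binomial_eq_0)
  then have "(\<Oplus>i\<in>{..n}. ?t n i) = (\<Oplus>i\<in>{..Suc n}. ?t n i)"
    using x by (subst finsum_Suc) (auto simp: Pi_def intro!: finsum_closed)
  also have "\<dots> = (\<Oplus>i\<in>{..n}. ?t n (Suc i)) \<oplus> \<one>"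
    using x by (subst finsum_Suc2) (auto simp: Pi_def)
  finally have 2: "(\<Oplus>i\<in>{..n}. ?t n i) = (\<Oplus>i\<in>{..n}. ?t n (Suc i)) \<oplus> \<one>" .
  have "(\<one> \<oplus> x) [^] Suc n = (\<Oplus>i\<in>{..n}. ?t n i) \<oplus> (\<Oplus>i\<in>{..n}. ?t n i) \<otimes> x"
    using x Suc.IH by (simp add: r_distr Pi_def)
  also have "\<dots> = (\<Oplus>i\<in>{..n}. [(n choose i)] \<cdot> (x [^] Suc i)) \<oplus> (\<Oplus>i\<in>{..n}. ?t n (Suc i)) \<oplus> \<one>"
    unfolding 1 using x by (subst 2) (simp add: a_ac Pi_def)
  also have "\<dots> = (\<Oplus>i\<in>{..n}. [(n choose i)] \<cdot> (x [^] Suc i) \<oplus> ?t n (Suc i)) \<oplus> \<one>"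
    using x by (subst finsum_addf) (auto simp: Pi_def)
  also have "\<dots> = (\<Oplus>i\<in>{..n}. ?t (Suc n) (Suc i)) \<oplus> \<one>"
    using x add.nat_pow_mult[of "x [^] Suc _"] by simp
  also have "\<dots> = (\<Oplus>i\<in>{..Suc n}. ?t (Suc n) i)"
    using x by (subst finsum_Suc2) (auto simp: Pi_def)
  finally show ?case .
qed

lemma one_add_power_prime:
  assumes p: "prime (p::nat)" and char: "\<And>y. y \<in> carrier R \<Longrightarrow> [p] \<cdot> y = \<zero>" and x: "x \<in> carrier R"
  shows "(\<one> \<oplus> x) [^] p = \<one> \<oplus> x [^] p"
proof -
  obtain q where q: "p = Suc q" using p prime_gt_0_nat[of p] gr0_implies_Suc by auto
  have 0: "[(p choose Suc i)] \<cdot> (x [^] Suc i) = \<zero>" if "i < q" for i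
  proof -
    have "p dvd (p choose Suc i)"
    proof -
      have "Suc i * (p choose Suc i) = p * (q choose i)" using Suc_times_binomial[of i q] q by simp
      then have "p dvd Suc i * (p choose Suc i)" by simp
      moreover have "\<not> p dvd Suc i" using that q by (auto dest: dvd_imp_le)
      ultimately show ?thesis using p prime_dvd_mult_iff by blast
    qed
    then obtain k where "p choose Suc i = p * k" by auto
    then show ?thesis using x char[of "[k] \<cdot> (x [^] Suc i)"] by (simp add: add.nat_pow_pow mult.commute)
  qed
  have "(\<one> \<oplus> x) [^] p = (\<Oplus>i\<in>{..q}. [(p choose Suc i)] \<cdot> (x [^] Suc i)) \<oplus> \<one>"
    using x unfolding one_add_power[OF x] q by (subst finsum_Suc2) (auto simp: Pi_def)
  also have "(\<Oplus>i\<in>{..q}. [(p choose Suc i)] \<cdot> (x [^] Suc i)) = (\<Oplus>i\<in>{..q}. if q = i then x [^] p else \<zero>)"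
    using x 0 by (intro finsum_cong') (auto simp: q binomial_eq_0)
  also have "\<dots> = x [^] p"
    using x by (intro add.finprod_singleton) auto
  finally show ?thesis using x by (simp add: a_comm)
qed

lemma one_add_power_prime_power:
  assumes p: "prime (p::nat)" and char: "\<And>y. y \<in> carrier R \<Longrightarrow> [p] \<cdot> y = \<zero>" and x: "x \<in> carrier R"
  shows "(\<one> \<oplus> x) [^] (p ^ n) = \<one> \<oplus> x [^] (p ^ n)"
proof (induction n)
  case (Suc n)
  have "(\<one> \<oplus> x) [^] (p ^ Suc n) = ((\<one> \<oplus> x) [^] (p ^ n)) [^] p"
    using x by (simp add: nat_pow_pow mult.commute)
  also have "\<dots> = \<one> \<oplus> (x [^] (p ^ n)) [^] p"
    using x Suc.IH one_add_power_prime[OF p char, of "x [^] (p ^ n)"] by simp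
  finally show ?case using x by (simp add: nat_pow_pow mult.commute)
qed (use x in simp)

end

subsection \<open>The centre of a p-group\<close>

text \<open>
  The class equation. If only the unit were central, then the orbit of the unit under conjugation
  would be the only one whose size is not divisible by \<open>p\<close>.
\<close>
lemma (in group) p_group_center_nontrivial:
  assumes p: "prime (p::nat)" and order: "order G = p ^ n" and n: "n > 0"
  shows "\<exists>z\<in>carrier G. z \<noteq> \<one> \<and> (\<forall>x\<in>carrier G. z \<otimes> x = x \<otimes> z)"
proof (rule ccontr)
  assume no: "\<not> ?thesis"
  have fin: "finite (carrier G)"
    using order p order_gt_0_iff_finite by (simp add: prime_gt_0_nat)
  define \<phi> where "\<phi> = (\<lambda>g. \<lambda>h\<in>carrier G. g \<otimes> h \<otimes> inv g)"
  interpret conj: group_action G "carrier G" \<phi>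
    unfolding \<phi>_def by (rule action_by_conjugation)
  let ?O = "orbits G (carrier G) \<phi>"
  have orb1: "orbit G \<phi> \<one> = {\<one>}"
    by (auto simp: orbit_def \<phi>_def intro!: exI[of _ \<one>])
  have dvd: "p dvd card X" if X: "X \<in> ?O - {{\<one>}}" for X
  proof -
    obtain x where x: "x \<in> carrier G" "X = orbit G \<phi> x" using X by (auto simp: orbits_def)
    have x1: "x \<noteq> \<one>" using X x orb1 by auto
    have "card X dvd p ^ n"
      using conj.orbit_stabilizer_theorem[OF x(1)] order x(2) by (metis dvd_triv_left)
    moreover have "card X \<noteq> 1"
    proof
      assume "card X = 1"
      then have X1: "X = {x}" using conj.orbit_refl[OF x(1)] x(2) by (metis card_1_singletonE singletonD)
      have "x \<otimes> g = g \<otimes> x" if g: "g \<in> carrier G" for g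
      proof -
        have "g \<otimes> x \<otimes> inv g \<in> X" using g x by (auto simp: orbit_def \<phi>_def)
        then have "g \<otimes> x \<otimes> inv g = x" using X1 by simp
        then show ?thesis using g x(1) inv_solve_right'[of x "g \<otimes> x" g] by simp
      qed
      then show False using no x(1) x1 by auto
    qed
    ultimately show ?thesis
      using p by (metis divides_primepow_nat dvd_power not_gr_zero power_0)
  qed
  have O1: "{\<one>} \<in> ?O" using orb1 by (auto simp: orbits_def)
  have finO: "finite ?O" using fin by (auto simp: orbits_def)
  have "card (carrier G) = (\<Sum>X\<in>?O. card X)"
    using conj.disjoint_sum[OF fin, of "\<lambda>_. 1::nat"] by simp
  also have "\<dots> = 1 + (\<Sum>X\<in>?O - {{\<one>}}. card X)"
    using sum.remove[OF finO O1, of card] by simp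
  finally have "order G = 1 + (\<Sum>X\<in>?O - {{\<one>}}. card X)" by (simp add: order_def)
  moreover have "p dvd (\<Sum>X\<in>?O - {{\<one>}}. card X)" using dvd by (intro dvd_sum) auto
  moreover have "p dvd order G" using order n by simp
  ultimately have "p dvd 1" by (metis dvd_add_left_iff)
  then show False using p by simp
qed

text \<open>
  A nontrivial central element of the quotient by \<open>N\<close>, phrased in \<open>G\<close>. This keeps the induction on
  the group inside one fixed group algebra.
\<close>
lemma (in group) p_group_central_modulo_normal:
  assumes p: "prime (p::nat)" and order: "order G = p ^ n" and N: "N \<lhd> G" and ne: "N \<noteq> carrier G"
  shows "\<exists>g\<in>carrier G - N. \<forall>x\<in>carrier G. g \<otimes> x \<otimes> inv g \<otimes> inv x \<in> N"
proof -
  interpret N: normal N G by (rule N)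
  interpret Q: group "G Mod N" by (rule N.factorgroup_is_group)
  have fin: "finite (carrier G)"
    using order p order_gt_0_iff_finite by (simp add: prime_gt_0_nat)
  have N0: "card N > 0" by (rule N.finite_imp_card_positive[OF fin])
  have lag: "order (G Mod N) * card N = p ^ n"
    using lagrange[OF N.subgroup_axioms] order by (simp add: FactGroup_def order_def)
  then obtain m where m: "order (G Mod N) = p ^ m"
    using divides_primepow_nat[OF p, of "order (G Mod N)" n] by (metis dvd_triv_left)
  have "m \<noteq> 0"
  proof
    assume "m = 0"
    then have "card N = card (carrier G)" using m lag order by (simp add: order_def)
    then show False using ne fin card_subset_eq[OF fin N.subset] by simp
  qed
  then obtain z where z: "z \<in> carrier (G Mod N)" "z \<noteq> \<one>\<^bsub>G Mod N\<^esub>"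
    "\<And>x. x \<in> carrier (G Mod N) \<Longrightarrow> z \<otimes>\<^bsub>G Mod N\<^esub> x = x \<otimes>\<^bsub>G Mod N\<^esub> z"
    using Q.p_group_center_nontrivial[OF p m] by auto
  then obtain g where g: "g \<in> carrier G" "z = N #> g" by (auto simp: FactGroup_def RCOSETS_def)
  have "g \<notin> N"
    using z(2) g N.rcos_const[OF is_group] by (auto simp: FactGroup_def)
  moreover have "g \<otimes> x \<otimes> inv g \<otimes> inv x \<in> N" if x: "x \<in> carrier G" for x
  proof -
    have "N #> (g \<otimes> x) = N #> (x \<otimes> g)"
      using z(3)[of "N #> x"] x g N.rcos_sum by (auto simp: FactGroup_def RCOSETS_def)
    then have "g \<otimes> x \<in> N #> (x \<otimes> g)" using g x rcos_self[OF _ N.subgroup_axioms] by auto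
    then have "g \<otimes> x \<otimes> inv (x \<otimes> g) \<in> N"
      using g x by (intro N.rcos_module_imp[OF is_group]) auto
    then show ?thesis using g x by (simp add: inv_mult_group m_assoc)
  qed
  ultimately show ?thesis using g by auto
qed

subsection \<open>Nilpotency of the augmentation ideal\<close>

context ring
begin

lemma commutator_minus_one:
  "\<lbrakk>a \<in> carrier R; b \<in> carrier R\<rbrakk> \<Longrightarrow> b \<otimes> (a \<ominus> \<one>) \<ominus> (a \<ominus> \<one>) \<otimes> b = b \<otimes> a \<ominus> a \<otimes> b"
proof -
  assume ab: "a \<in> carrier R" "b \<in> carrier R"
  have "b \<otimes> (a \<ominus> c) \<ominus> (a \<ominus> c) \<otimes> b = (b \<otimes> a \<ominus> a \<otimes> b) \<ominus> (b \<otimes> c \<ominus> c \<otimes> b)"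
    if "c \<in> carrier R" for c
    using ab that by algebra
  from this[of \<one>] show ?thesis using ab by (simp add: minus_eq r_neg)
qed

definition lprod :: "'a list \<Rightarrow> 'a" where
  "lprod xs = foldl (\<otimes>) \<one> xs"

lemma lprod_Nil [simp]: "lprod [] = \<one>"
  and lprod_snoc: "lprod (xs @ [x]) = lprod xs \<otimes> x"
  by (simp_all add: lprod_def)

lemma lprod_closed: "set xs \<subseteq> carrier R \<Longrightarrow> lprod xs \<in> carrier R"
  by (induction xs rule: rev_induct) (auto simp: lprod_snoc)

lemma lprod_append:
  "\<lbrakk>set xs \<subseteq> carrier R; set ys \<subseteq> carrier R\<rbrakk> \<Longrightarrow> lprod (xs @ ys) = lprod xs \<otimes> lprod ys"
proof (induction ys rule: rev_induct)
  case (snoc y ys)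
  then show ?case
    using lprod_snoc[of "xs @ ys" y] lprod_snoc[of ys y] lprod_closed[of xs] lprod_closed[of ys]
    by (simp add: m_assoc)
qed (simp add: lprod_closed)

text \<open>
  Nilpotency of an ideal is stated for products of lists of elements: in this form it is passed
  from one ideal to another by cutting lists into blocks.
\<close>
definition nil_set :: "'a set \<Rightarrow> nat \<Rightarrow> bool" where
  "nil_set I m \<longleftrightarrow> (\<forall>xs. set xs \<subseteq> I \<and> length xs = m \<longrightarrow> lprod xs = \<zero>)"

lemma nil_set_blocks:
  assumes S: "S \<subseteq> carrier R" and I: "I \<subseteq> carrier R" and nil: "nil_set I m"
    and block: "\<And>xs. \<lbrakk>set xs \<subseteq> S; length xs = q\<rbrakk> \<Longrightarrow> lprod xs \<in> I"
  shows "nil_set S (m * q)"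
proof -
  have "\<exists>ys. set ys \<subseteq> I \<and> length ys = k \<and> lprod xs = lprod ys"
    if "set xs \<subseteq> S" "length xs = k * q" for k xs
    using that
  proof (induction k arbitrary: xs)
    case 0
    then show ?case by (intro exI[of _ "[]"]) simp
  next
    case (Suc k)
    define as bs where "as = take (k * q) xs" "bs = drop (k * q) xs"
    have xs: "xs = as @ bs" by (simp add: as_bs_def)
    have as: "set as \<subseteq> S" "length as = k * q" and bs: "set bs \<subseteq> S" "length bs = q"
      using Suc.prems set_take_subset[of "k * q" xs] set_drop_subset[of "k * q" xs]
      by (auto simp: as_bs_def)
    obtain ys where ys: "set ys \<subseteq> I" "length ys = k" "lprod as = lprod ys"
      using Suc.IH[OF as] by blast
    have "lprod xs = lprod as \<otimes> lprod bs"
      unfolding xs using as(1) bs(1) S by (intro lprod_append) auto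
    also have "\<dots> = lprod (ys @ [lprod bs])" by (simp add: ys(3) lprod_snoc)
    finally show ?case
      using ys block[OF bs] by (intro exI[of _ "ys @ [lprod bs]"]) auto
  qed
  then show ?thesis using nil unfolding nil_set_def by metis
qed

text \<open>
  If \<open>y\<close> is nilpotent and central modulo the nilpotent ideal \<open>I\<close>, then \<open>I + y R\<close> is again a nilpotent
  ideal: modulo \<open>I\<close> a product of \<open>q\<close> of its elements is a multiple of \<open>y\<^sup>q\<close>.
\<close>
lemma nil_set_extend:
  assumes I: "ideal I R" and nil: "nil_set I m" and y: "y \<in> carrier R"
    and comm: "\<And>a. a \<in> carrier R \<Longrightarrow> a \<otimes> y \<ominus> y \<otimes> a \<in> I"
    and pow: "y [^] (q::nat) = \<zero>"
  defines "S \<equiv> {r \<oplus> y \<otimes> a | r a. r \<in> I \<and> a \<in> carrier R}"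
  shows "ideal S R" "nil_set S (m * q)"
proof -
  interpret I: ideal I R by (rule I)
  have S_carrier: "S \<subseteq> carrier R" using y by (auto simp: S_def)
  show "ideal S R"
  proof (rule idealI[OF ring_axioms])
    show "subgroup S (add_monoid R)"
    proof (rule add.subgroupI)
      have "\<zero> \<oplus> y \<otimes> \<zero> \<in> S" unfolding S_def using I.zero_closed by blast
      then show "S \<noteq> {}" by blast
      show "\<ominus> s \<in> S" if s: "s \<in> S" for s
      proof -
        obtain r a where ra: "r \<in> I" "a \<in> carrier R" "s = r \<oplus> y \<otimes> a" using s by (auto simp: S_def)
        then have "\<ominus> s = \<ominus> r \<oplus> y \<otimes> (\<ominus> a)" using y by (simp add: minus_add r_minus)
        then show ?thesis using ra unfolding S_def by blast
      qed
      show "s \<oplus> t \<in> S" if st: "s \<in> S" "t \<in> S" for s t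
      proof -
        obtain r a r' a' where ra: "r \<in> I" "a \<in> carrier R" "s = r \<oplus> y \<otimes> a"
            "r' \<in> I" "a' \<in> carrier R" "t = r' \<oplus> y \<otimes> a'"
          using st by (auto simp: S_def)
        then have "s \<oplus> t = (r \<oplus> r') \<oplus> y \<otimes> (a \<oplus> a')" using y by (simp add: r_distr a_ac)
        then show ?thesis using ra unfolding S_def by blast
      qed
    qed (rule S_carrier)
    fix s x assume s: "s \<in> S" and x: "x \<in> carrier R"
    obtain r a where ra: "r \<in> I" "a \<in> carrier R" "s = r \<oplus> y \<otimes> a" using s by (auto simp: S_def)
    have "s \<otimes> x = r \<otimes> x \<oplus> y \<otimes> (a \<otimes> x)" using ra x y by (simp add: l_distr m_assoc)
    then show "s \<otimes> x \<in> S" using ra x I.I_r_closed unfolding S_def by blast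
    have "x \<otimes> s = (x \<otimes> r \<oplus> (x \<otimes> y \<ominus> y \<otimes> x) \<otimes> a) \<oplus> y \<otimes> (x \<otimes> a)"
      using ra x y by (simp add: l_distr r_distr m_assoc minus_eq l_minus a_assoc l_neg)
    moreover have "x \<otimes> r \<oplus> (x \<otimes> y \<ominus> y \<otimes> x) \<otimes> a \<in> I"
      using ra x comm[OF x] I.I_l_closed I.I_r_closed by blast
    ultimately show "x \<otimes> s \<in> S" using ra x unfolding S_def by blast
  qed
  have powers: "\<exists>r a. r \<in> I \<and> a \<in> carrier R \<and> lprod xs = r \<oplus> y [^] length xs \<otimes> a"
    if "set xs \<subseteq> S" for xs
    using that
  proof (induction xs rule: rev_induct)
    case Nil
    show ?case by (intro exI[of _ \<zero>] exI[of _ \<one>]) (simp add: I.zero_closed)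
  next
    case (snoc s xs)
    then obtain r a where ra: "r \<in> I" "a \<in> carrier R" "lprod xs = r \<oplus> y [^] length xs \<otimes> a" by auto
    obtain r' b where rb: "r' \<in> I" "b \<in> carrier R" "s = r' \<oplus> y \<otimes> b" using snoc.prems by (auto simp: S_def)
    let ?k = "length xs" and ?c = "a \<otimes> y \<ominus> y \<otimes> a"
    have c: "?c \<in> I" by (rule comm[OF ra(2)])
    let ?t = "r \<otimes> s \<oplus> y [^] ?k \<otimes> a \<otimes> r' \<oplus> y [^] ?k \<otimes> ?c \<otimes> b"
    have t: "?t \<in> I"
      using ra rb c y snoc.prems S_carrier I.I_l_closed I.I_r_closed by (intro I.a_closed) auto
    have carr: "r \<in> carrier R" "r' \<in> carrier R" using ra rb by auto
    have "lprod (xs @ [s]) = r \<otimes> s \<oplus> y [^] ?k \<otimes> a \<otimes> r' \<oplus> y [^] ?k \<otimes> (a \<otimes> y) \<otimes> b"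
      using ra rb y carr by (simp add: lprod_snoc l_distr r_distr m_assoc a_ac)
    also have "a \<otimes> y = ?c \<oplus> y \<otimes> a" using ra y by (simp add: minus_eq a_assoc l_neg)
    also have "r \<otimes> s \<oplus> y [^] ?k \<otimes> a \<otimes> r' \<oplus> y [^] ?k \<otimes> (?c \<oplus> y \<otimes> a) \<otimes> b =
        ?t \<oplus> y [^] length (xs @ [s]) \<otimes> (a \<otimes> b)"
    proof -
      have cc: "?c \<in> carrier R" "s \<in> carrier R" using c snoc.prems S_carrier by auto
      have "r \<otimes> s \<oplus> y [^] ?k \<otimes> a \<otimes> r' \<oplus> y [^] ?k \<otimes> (d \<oplus> y \<otimes> a) \<otimes> b =
          (r \<otimes> s \<oplus> y [^] ?k \<otimes> a \<otimes> r' \<oplus> y [^] ?k \<otimes> d \<otimes> b) \<oplus> y [^] length (xs @ [s]) \<otimes> (a \<otimes> b)"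
        if "d \<in> carrier R" for d
        using that ra(2) rb(2) y carr cc(2) by (simp add: l_distr r_distr m_assoc a_assoc)
      then show ?thesis using cc(1) .
    qed
    finally show ?case using t ra rb by blast
  qed
  have "lprod xs \<in> I" if "set xs \<subseteq> S" "length xs = q" for xs
    using powers[OF that(1)] that(2) pow by auto
  then show "nil_set S (m * q)" using nil by (intro nil_set_blocks S_carrier) auto
qed

end

locale modular_group_algebra = finite_group_algebra G K for G (structure) and K (structure) +
  fixes p n :: nat
  assumes prime: "prime p" and order: "order G = p ^ n"
    and characteristic: "[p] \<cdot>\<^bsub>K\<^esub> \<one>\<^bsub>K\<^esub> = \<zero>\<^bsub>K\<^esub>"
begin

lemma char_A: "u \<in> carrier A \<Longrightarrow> [p] \<cdot>\<^bsub>A\<^esub> u = \<zero>\<^bsub>A\<^esub>"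
proof -
  assume u: "u \<in> carrier A"
  have "[k] \<cdot>\<^bsub>A\<^esub> u = ([k] \<cdot>\<^bsub>K\<^esub> \<one>\<^bsub>K\<^esub>) \<odot>\<^bsub>A\<^esub> u" for k :: nat
    using u by (induction k) (simp_all add: alg.smult_l_distr)
  then show ?thesis using characteristic u by simp
qed

lemma gelt_pow: "x \<in> carrier G \<Longrightarrow> gelt x [^]\<^bsub>A\<^esub> (k::nat) = gelt (x [^] k)"
  by (induction k) (simp_all add: gelt_one gelt_mult)

text \<open>
  The elements \<open>x - 1\<close>, which span the augmentation ideal.
\<close>
definition gdiff :: "'a \<Rightarrow> 'a \<Rightarrow> 'c" where
  "gdiff x = gelt x \<ominus>\<^bsub>A\<^esub> \<one>\<^bsub>A\<^esub>"

lemma gdiff_closed [simp, intro]: "gdiff x \<in> carrier A"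
  by (simp add: gdiff_def)

lemma gelt_gdiff: "gelt x = \<one>\<^bsub>A\<^esub> \<oplus>\<^bsub>A\<^esub> gdiff x"
  unfolding gdiff_def
  by (subst alg.A.a_comm) (simp_all add: alg.A.minus_eq alg.A.a_assoc alg.A.l_neg)

lemma gdiff_mult:
  assumes "x \<in> carrier G" "y \<in> carrier G"
  shows "gdiff (x \<otimes> y) = gdiff x \<otimes>\<^bsub>A\<^esub> gelt y \<oplus>\<^bsub>A\<^esub> gdiff y"
proof -
  have "(a \<ominus>\<^bsub>A\<^esub> \<one>\<^bsub>A\<^esub>) \<otimes>\<^bsub>A\<^esub> b \<oplus>\<^bsub>A\<^esub> (b \<ominus>\<^bsub>A\<^esub> \<one>\<^bsub>A\<^esub>) = a \<otimes>\<^bsub>A\<^esub> b \<ominus>\<^bsub>A\<^esub> \<one>\<^bsub>A\<^esub>" if "a \<in> carrier A" "b \<in> carrier A" for a b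
    using that by (simp add: alg.A.minus_eq alg.A.l_distr alg.A.l_minus alg.A.a_assoc alg.A.r_neg1)
  then show ?thesis using assms by (simp add: gdiff_def gelt_mult)
qed

text \<open>
  Since \<open>x\<close> has order dividing \<open>p\<^sup>n\<close>, the Frobenius identity gives
  \<open>(x - 1) ^ p\<^sup>n = x ^ p\<^sup>n - 1 = 0\<close>.
\<close>
lemma gdiff_pow: "x \<in> carrier G \<Longrightarrow> gdiff x [^]\<^bsub>A\<^esub> (p ^ n) = \<zero>\<^bsub>A\<^esub>"
proof -
  assume x: "x \<in> carrier G"
  have "\<one>\<^bsub>A\<^esub> \<oplus>\<^bsub>A\<^esub> gdiff x [^]\<^bsub>A\<^esub> (p ^ n) = gelt x [^]\<^bsub>A\<^esub> (p ^ n)"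
    using alg.A.one_add_power_prime_power[OF prime char_A, of "gdiff x" n] by (simp add: gelt_gdiff)
  also have "\<dots> = \<one>\<^bsub>A\<^esub>"
    using x G.pow_order_eq_1[OF x] order by (simp add: gelt_pow gelt_one)
  finally show ?thesis by (simp add: alg.A.add.l_cancel_one)
qed

lemma ideal_smult:
  assumes I: "ideal I A" and c: "c \<in> carrier K" and r: "r \<in> I"
  shows "c \<odot>\<^bsub>A\<^esub> r \<in> I"
proof -
  interpret I: ideal I A by (rule I)
  have "c \<odot>\<^bsub>A\<^esub> r = (c \<odot>\<^bsub>A\<^esub> \<one>\<^bsub>A\<^esub>) \<otimes>\<^bsub>A\<^esub> r"
    using c r by (simp add: alg.smult_mult_left)
  then show ?thesis using c r I.I_l_closed by simp
qed

text \<open>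
  These are the elements that become trivial in the quotient by \<open>I\<close>.
\<close>
lemma gdiff_ideal_normal:
  assumes I: "ideal I A"
  shows "{x \<in> carrier G. gdiff x \<in> I} \<lhd> G"
proof -
  interpret I: ideal I A by (rule I)
  let ?N = "{x \<in> carrier G. gdiff x \<in> I}"
  have mult: "x \<otimes> y \<in> ?N" if "x \<in> ?N" "y \<in> ?N" for x y
    using that gdiff_mult I.I_r_closed by auto
  have conj: "g \<otimes> x \<otimes> inv g \<in> ?N" if g: "g \<in> carrier G" and x: "x \<in> ?N" for g x
  proof -
    have "a \<otimes>\<^bsub>A\<^esub> (b \<ominus>\<^bsub>A\<^esub> \<one>\<^bsub>A\<^esub>) \<otimes>\<^bsub>A\<^esub> c = a \<otimes>\<^bsub>A\<^esub> b \<otimes>\<^bsub>A\<^esub> c \<ominus>\<^bsub>A\<^esub> a \<otimes>\<^bsub>A\<^esub> c"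
      if "a \<in> carrier A" "b \<in> carrier A" "c \<in> carrier A" for a b c
      using that by (simp add: alg.A.minus_eq alg.A.l_distr alg.A.r_distr alg.A.l_minus alg.A.r_minus)
    then have "gdiff (g \<otimes> x \<otimes> inv g) = gelt g \<otimes>\<^bsub>A\<^esub> gdiff x \<otimes>\<^bsub>A\<^esub> gelt (inv g)"
      using g x by (simp add: gdiff_def gelt_mult gelt_one)
    then show ?thesis using g x I.I_l_closed I.I_r_closed by simp
  qed
  have "subgroup ?N G"
  proof (rule G.subgroupI)
    show "?N \<noteq> {}"
    proof -
      have "gdiff \<one> = \<zero>\<^bsub>A\<^esub>" by (simp add: gdiff_def gelt_one alg.A.minus_eq alg.A.r_neg)
      then show ?thesis using I.zero_closed by auto
    qed
    show "inv x \<in> ?N" if x: "x \<in> ?N" for x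
    proof -
      have "a \<otimes>\<^bsub>A\<^esub> (b \<ominus>\<^bsub>A\<^esub> \<one>\<^bsub>A\<^esub>) = a \<otimes>\<^bsub>A\<^esub> b \<ominus>\<^bsub>A\<^esub> a" if "a \<in> carrier A" "b \<in> carrier A" for a b
        using that by (simp add: alg.A.minus_eq alg.A.r_distr alg.A.r_minus)
      then have "gelt (inv x) \<otimes>\<^bsub>A\<^esub> gdiff x = \<one>\<^bsub>A\<^esub> \<ominus>\<^bsub>A\<^esub> gelt (inv x)"
        using x by (simp add: gdiff_def gelt_mult gelt_one)
      also have "\<dots> = \<ominus>\<^bsub>A\<^esub> gdiff (inv x)"
        by (simp add: gdiff_def alg.A.minus_eq alg.A.minus_add alg.A.a_comm)
      finally have "gdiff (inv x) = \<ominus>\<^bsub>A\<^esub> (gelt (inv x) \<otimes>\<^bsub>A\<^esub> gdiff x)" by simp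
      then show ?thesis using x I.I_l_closed by simp
    qed
  qed (use mult in auto)
  then show ?thesis using conj by (auto intro!: G.normal_invI)
qed

text \<open>
  Choose a nilpotent ideal \<open>I\<close> for which the normal subgroup \<open>N\<close> of the elements congruent to \<open>1\<close>
  modulo \<open>I\<close> is as large as possible. If \<open>N\<close> were a proper subgroup, then some \<open>g\<close> outside of \<open>N\<close> would
  be central modulo \<open>N\<close>, so \<open>g - 1\<close> would be central modulo \<open>I\<close> and nilpotent, and adjoining it to
  \<open>I\<close> would enlarge \<open>N\<close>. Hence all \<open>x - 1\<close> lie in \<open>I\<close>.
\<close>
theorem augmentation_ideal_nilpotent: "\<exists>m. alg.A.nil_set {u \<in> carrier A. aug u = \<zero>\<^bsub>K\<^esub>} m"
proof -
  \<comment> \<open>Maximality refers to the set of group elements, of which there are only finitely many subsets.\<close>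
  define nilp where "nilp I \<longleftrightarrow> ideal I A \<and> (\<exists>m. alg.A.nil_set I m)" for I
  define N where "N I = {x \<in> carrier G. gdiff x \<in> I}" for I
  have "finite (N ` Collect nilp)"
    by (rule finite_subset[of _ "Pow (carrier G)"]) (auto simp: N_def)
  moreover have "nilp {\<zero>\<^bsub>A\<^esub>}"
    using alg.A.zeroideal unfolding nilp_def alg.A.nil_set_def
    by (intro conjI exI[of _ 1]) (auto simp: length_Suc_conv alg.A.lprod_def)
  ultimately obtain X where X: "X \<in> N ` Collect nilp" "\<And>Y. Y \<in> N ` Collect nilp \<Longrightarrow> X \<subseteq> Y \<Longrightarrow> X = Y"
    using finite_has_maximal[of "N ` Collect nilp"] by blast
  then obtain I where I: "nilp I" "X = N I" by auto
  then obtain m where m: "alg.A.nil_set I m" by (auto simp: nilp_def)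
  have ideal: "ideal I A" using I by (simp add: nilp_def)
  interpret I: ideal I A by (rule ideal)
  have "N I = carrier G"
  proof (rule ccontr)
    assume "N I \<noteq> carrier G"
    then obtain g where g: "g \<in> carrier G" "g \<notin> N I"
        and comm: "\<And>x. x \<in> carrier G \<Longrightarrow> g \<otimes> x \<otimes> inv g \<otimes> inv x \<in> N I"
      using G.p_group_central_modulo_normal[OF prime order, of "N I"] gdiff_ideal_normal[OF ideal]
      unfolding N_def by blast
    let ?y = "gdiff g"
    have central: "a \<otimes>\<^bsub>A\<^esub> ?y \<ominus>\<^bsub>A\<^esub> ?y \<otimes>\<^bsub>A\<^esub> a \<in> I" if "a \<in> carrier A" for a
      using that
    proof (induction a rule: A_induct)
      case (add v w)
      have "(v \<oplus>\<^bsub>A\<^esub> w) \<otimes>\<^bsub>A\<^esub> ?y \<ominus>\<^bsub>A\<^esub> ?y \<otimes>\<^bsub>A\<^esub> (v \<oplus>\<^bsub>A\<^esub> w) =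
          (v \<otimes>\<^bsub>A\<^esub> ?y \<ominus>\<^bsub>A\<^esub> ?y \<otimes>\<^bsub>A\<^esub> v) \<oplus>\<^bsub>A\<^esub> (w \<otimes>\<^bsub>A\<^esub> ?y \<ominus>\<^bsub>A\<^esub> ?y \<otimes>\<^bsub>A\<^esub> w)"
        using add by (simp add: alg.A.l_distr alg.A.r_distr alg.A.minus_add_add)
      then show ?case using add by simp
    next
      case (gelt c x)
      let ?h = "g \<otimes> x \<otimes> inv g \<otimes> inv x"
      have h: "gdiff ?h \<in> I" using comm[OF gelt(2)] by (simp add: N_def)
      have "inv x \<otimes> (x \<otimes> g) = g" using g gelt by (simp add: G.m_assoc[symmetric])
      then have "?h \<otimes> (x \<otimes> g) = g \<otimes> x" using g gelt by (simp add: G.m_assoc)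
      then have gx: "gelt ?h \<otimes>\<^bsub>A\<^esub> gelt (x \<otimes> g) = gelt (g \<otimes> x)"
        using g gelt by (simp add: gelt_mult)
      have "(b \<ominus>\<^bsub>A\<^esub> \<one>\<^bsub>A\<^esub>) \<otimes>\<^bsub>A\<^esub> a = b \<otimes>\<^bsub>A\<^esub> a \<ominus>\<^bsub>A\<^esub> a" if "a \<in> carrier A" "b \<in> carrier A" for a b
        using that by (simp add: alg.A.minus_eq alg.A.l_distr alg.A.l_minus)
      then have "gdiff ?h \<otimes>\<^bsub>A\<^esub> gelt (x \<otimes> g) = gelt (g \<otimes> x) \<ominus>\<^bsub>A\<^esub> gelt (x \<otimes> g)"
        using gx by (simp add: gdiff_def)
      then have "\<ominus>\<^bsub>A\<^esub> (gdiff ?h \<otimes>\<^bsub>A\<^esub> gelt (x \<otimes> g)) = gelt (x \<otimes> g) \<ominus>\<^bsub>A\<^esub> gelt (g \<otimes> x)"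
        by (simp add: alg.A.minus_eq alg.A.minus_add alg.A.a_comm)
      also have "\<dots> = gelt x \<otimes>\<^bsub>A\<^esub> ?y \<ominus>\<^bsub>A\<^esub> ?y \<otimes>\<^bsub>A\<^esub> gelt x"
      proof -
        have "gelt x \<otimes>\<^bsub>A\<^esub> ?y \<ominus>\<^bsub>A\<^esub> ?y \<otimes>\<^bsub>A\<^esub> gelt x =
            gelt x \<otimes>\<^bsub>A\<^esub> gelt g \<ominus>\<^bsub>A\<^esub> gelt g \<otimes>\<^bsub>A\<^esub> gelt x"
          unfolding gdiff_def by (rule alg.A.commutator_minus_one) auto
        then show ?thesis using g gelt by (simp add: gelt_mult)
      qed
      finally have "gelt x \<otimes>\<^bsub>A\<^esub> ?y \<ominus>\<^bsub>A\<^esub> ?y \<otimes>\<^bsub>A\<^esub> gelt x \<in> I"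
        using h I.I_r_closed by (metis gelt_closed I.a_inv_closed)
      then have "c \<odot>\<^bsub>A\<^esub> (gelt x \<otimes>\<^bsub>A\<^esub> ?y \<ominus>\<^bsub>A\<^esub> ?y \<otimes>\<^bsub>A\<^esub> gelt x) \<in> I"
        using gelt(1) by (intro ideal_smult[OF ideal])
      then show ?case
        using gelt(1) by (simp add: alg.smult_mult_left alg.smult_mult_right alg.A.minus_eq
          alg.smult_r_distr alg.smult_r_minus)
    qed (simp add: alg.A.minus_eq)
    define S where "S = {r \<oplus>\<^bsub>A\<^esub> ?y \<otimes>\<^bsub>A\<^esub> a | r a. r \<in> I \<and> a \<in> carrier A}"
    have "nilp S"
      using alg.A.nil_set_extend[OF ideal m gdiff_closed central gdiff_pow[OF g(1)]]
      unfolding nilp_def S_def by blast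
    moreover have "I \<subseteq> S"
    proof
      fix r assume r: "r \<in> I"
      then have "r = r \<oplus>\<^bsub>A\<^esub> ?y \<otimes>\<^bsub>A\<^esub> \<zero>\<^bsub>A\<^esub>" by simp
      then show "r \<in> S" using r unfolding S_def by blast
    qed
    moreover have "?y \<in> S"
    proof -
      have "?y = \<zero>\<^bsub>A\<^esub> \<oplus>\<^bsub>A\<^esub> ?y \<otimes>\<^bsub>A\<^esub> \<one>\<^bsub>A\<^esub>" by simp
      then show ?thesis using I.zero_closed unfolding S_def by blast
    qed
    ultimately have "N I = N S" using X(2)[of "N S"] I(2) by (auto simp: N_def)
    then show False using g \<open>?y \<in> S\<close> by (auto simp: N_def)
  qed
  then have gdiff: "gdiff x \<in> I" if "x \<in> carrier G" for x using that by (auto simp: N_def)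
  have "u \<ominus>\<^bsub>A\<^esub> aug u \<odot>\<^bsub>A\<^esub> \<one>\<^bsub>A\<^esub> \<in> I" if "u \<in> carrier A" for u
    using that
  proof (induction u rule: A_induct)
    case (add v w)
    have "v \<oplus>\<^bsub>A\<^esub> w \<ominus>\<^bsub>A\<^esub> aug (v \<oplus>\<^bsub>A\<^esub> w) \<odot>\<^bsub>A\<^esub> \<one>\<^bsub>A\<^esub> = (v \<ominus>\<^bsub>A\<^esub> aug v \<odot>\<^bsub>A\<^esub> \<one>\<^bsub>A\<^esub>) \<oplus>\<^bsub>A\<^esub> (w \<ominus>\<^bsub>A\<^esub> aug w \<odot>\<^bsub>A\<^esub> \<one>\<^bsub>A\<^esub>)"
      using add by (simp add: aug_add alg.smult_l_distr alg.A.minus_add_add)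
    then show ?case using add by simp
  next
    case (gelt c x)
    have "c \<odot>\<^bsub>A\<^esub> gelt x \<ominus>\<^bsub>A\<^esub> aug (c \<odot>\<^bsub>A\<^esub> gelt x) \<odot>\<^bsub>A\<^esub> \<one>\<^bsub>A\<^esub> = c \<odot>\<^bsub>A\<^esub> gdiff x"
      using gelt by (simp add: aug_smult aug_gelt gdiff_def alg.A.minus_eq alg.smult_r_distr alg.smult_r_minus)
    then show ?case using gelt gdiff ideal_smult[OF ideal] by simp
  qed (simp add: aug_zero alg.A.minus_eq)
  then have "{u \<in> carrier A. aug u = \<zero>\<^bsub>K\<^esub>} \<subseteq> I" by (force simp: alg.A.minus_eq)
  then show ?thesis using m unfolding alg.A.nil_set_def by blast
qed

end

section \<open>Derivatives of central elements\<close>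

lemma (in ring) lprod_replicate: "x \<in> carrier R \<Longrightarrow> lprod (replicate k x) = x [^] k"
  by (induction k) (simp_all add: lprod_snoc replicate_append_same[symmetric] del: replicate_Suc,
      simp add: lprod_snoc replicate_append_same[symmetric])

text \<open>
  The factor \<open>s\<close> is the geometric sum \<open>1 + t + \<dots> + t\<^sup>k\<^sup>-\<^sup>1\<close>.
\<close>
lemma (in ring) center_geometric:
  assumes t: "t \<in> ring_center R"
  shows "\<exists>s\<in>ring_center R. s \<otimes> (\<one> \<ominus> t) = \<one> \<ominus> t [^] (k::nat)"
proof (induction k)
  case 0
  then show ?case using t by (intro bexI[of _ \<zero>]) (simp_all add: center_closed center_carrier minus_eq r_neg)
next
  case (Suc k)
  then obtain s where s: "s \<in> ring_center R" "s \<otimes> (\<one> \<ominus> t) = \<one> \<ominus> t [^] k" by auto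
  note carr = t[THEN center_carrier] s(1)[THEN center_carrier]
  have tk: "t [^] k \<in> ring_center R" using t by (induction k) (simp_all add: center_closed)
  have "(s \<oplus> t [^] k) \<otimes> (\<one> \<ominus> t) = \<one> \<ominus> t [^] Suc k"
    using carr s(2) by (simp add: l_distr) (simp add: r_distr minus_eq r_minus a_assoc r_neg1)
  then show ?case using s(1) tk by (blast intro: center_closed)
qed

context modular_group_algebra
begin

text \<open>
  Up to a scalar, such an element is \<open>1 - t\<close> with \<open>t\<close> in the augmentation ideal, hence nilpotent.
\<close>
lemma central_unit:
  assumes K: "field K" and u: "u \<in> ring_center A" and nz: "aug u \<noteq> \<zero>\<^bsub>K\<^esub>"
  shows "\<exists>w\<in>ring_center A. w \<otimes>\<^bsub>A\<^esub> u = \<one>\<^bsub>A\<^esub>"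
proof -
  interpret F: field K by (rule K)
  note uc = alg.A.center_carrier[OF u]
  define c where "c = inv\<^bsub>K\<^esub> (aug u)"
  have c: "c \<in> carrier K" "c \<otimes>\<^bsub>K\<^esub> aug u = \<one>\<^bsub>K\<^esub>"
    using nz uc F.field_Units by (auto simp: c_def)
  define t where "t = \<one>\<^bsub>A\<^esub> \<ominus>\<^bsub>A\<^esub> c \<odot>\<^bsub>A\<^esub> u"
  have t: "t \<in> ring_center A"
    unfolding t_def using u c by (intro alg.A.center_closed alg.center_smult)
  note tc = alg.A.center_carrier[OF t]
  have "aug t = \<zero>\<^bsub>K\<^esub>"
    using uc c by (simp add: t_def aug_minus aug_one aug_smult K.minus_eq K.r_neg)
  moreover obtain m where "alg.A.nil_set {u \<in> carrier A. aug u = \<zero>\<^bsub>K\<^esub>} m"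
    using augmentation_ideal_nilpotent by auto
  ultimately have "t [^]\<^bsub>A\<^esub> m = \<zero>\<^bsub>A\<^esub>"
    using tc unfolding alg.A.nil_set_def
    by (subst alg.A.lprod_replicate[symmetric]) (auto dest: in_set_replicate[THEN iffD1])
  then obtain s where s: "s \<in> ring_center A" "s \<otimes>\<^bsub>A\<^esub> (\<one>\<^bsub>A\<^esub> \<ominus>\<^bsub>A\<^esub> t) = \<one>\<^bsub>A\<^esub>"
    using alg.A.center_geometric[OF t, of m] by (auto simp: alg.A.minus_eq)
  have "\<one>\<^bsub>A\<^esub> \<ominus>\<^bsub>A\<^esub> t = c \<odot>\<^bsub>A\<^esub> u"
    using uc c by (simp add: t_def alg.A.minus_eq alg.A.minus_add alg.A.r_neg1 alg.A.r_neg2)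
  then have "(c \<odot>\<^bsub>A\<^esub> s) \<otimes>\<^bsub>A\<^esub> u = \<one>\<^bsub>A\<^esub>"
    using s uc c alg.A.center_carrier[OF s(1)] by (simp add: alg.smult_mult_left alg.smult_mult_right)
  then show ?thesis using s(1) c alg.center_smult by blast
qed

text \<open>
  If \<open>p = 2 k + 1\<close>, then \<open>- k\<close> is an inverse of \<open>2\<close>.
\<close>
lemma half_exists:
  assumes odd: "p \<noteq> 2"
  shows "\<exists>h\<in>carrier K. h \<otimes>\<^bsub>K\<^esub> (\<one>\<^bsub>K\<^esub> \<oplus>\<^bsub>K\<^esub> \<one>\<^bsub>K\<^esub>) = \<one>\<^bsub>K\<^esub>"
proof -
  have "odd p" using prime odd primes_dvd_imp_eq two_is_prime_nat by blast
  then obtain k where k: "p = Suc (2 * k)" by (metis oddE Suc_eq_plus1)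
  define a where "a = [k] \<cdot>\<^bsub>K\<^esub> \<one>\<^bsub>K\<^esub>"
  have a: "a \<in> carrier K" by (simp add: a_def)
  have "a \<oplus>\<^bsub>K\<^esub> a = [(2 * k)] \<cdot>\<^bsub>K\<^esub> \<one>\<^bsub>K\<^esub>"
    unfolding a_def by (simp add: K.add.nat_pow_mult mult_2)
  then have "a \<oplus>\<^bsub>K\<^esub> a \<oplus>\<^bsub>K\<^esub> \<one>\<^bsub>K\<^esub> = \<zero>\<^bsub>K\<^esub>"
    using characteristic k by simp
  then have "\<ominus>\<^bsub>K\<^esub> (a \<oplus>\<^bsub>K\<^esub> a) = \<one>\<^bsub>K\<^esub>"
    using a by (metis K.add.m_closed K.minus_equality K.one_closed K.a_comm)
  then show ?thesis
    using a by (intro bexI[of _ "\<ominus>\<^bsub>K\<^esub> a"]) (simp_all add: K.r_distr K.minus_add)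
qed

theorem aug_derivation_central:
  assumes K: "field K" and odd: "p \<noteq> 2"
    and solvable: "solvable_modulo K (Der K A) (InnDer A)"
    and d: "d \<in> derivations K A" and z: "z \<in> ring_center A"
  shows "aug (d z) = \<zero>\<^bsub>K\<^esub>"
proof (rule ccontr)
  assume "aug (d z) \<noteq> \<zero>\<^bsub>K\<^esub>"
  then obtain w where w: "w \<in> ring_center A" "w \<otimes>\<^bsub>A\<^esub> d z = \<one>\<^bsub>A\<^esub>"
    using central_unit[OF K alg.derivation_center[OF d z]] by auto
  obtain h where h: "h \<in> carrier K" "h \<otimes>\<^bsub>K\<^esub> (\<one>\<^bsub>K\<^esub> \<oplus>\<^bsub>K\<^esub> \<one>\<^bsub>K\<^esub>) = \<one>\<^bsub>K\<^esub>"
    using half_exists[OF odd] by auto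
  have "\<one>\<^bsub>A\<^esub> \<noteq> \<zero>\<^bsub>A\<^esub>"
    using aug_one aug_zero domain.one_not_zero[OF field.axioms(1)[OF K]] by auto
  then show False
    using alg.derivative_of_central_not_unit[OF solvable h _ d z w(1)] w(2) by simp
qed

end

section \<open>The group algebra of a direct product\<close>

lemma (in abelian_monoid) finsum_cartesian:
  assumes "finite I" "finite J" "\<And>i j. \<lbrakk>i \<in> I; j \<in> J\<rbrakk> \<Longrightarrow> f (i, j) \<in> carrier G"
  shows "(\<Oplus>x\<in>I \<times> J. f x) = (\<Oplus>i\<in>I. \<Oplus>j\<in>J. f (i, j))"
  using assms(1,3)
proof (induction I rule: finite_induct)
  case (insert i I)
  have split: "insert i I \<times> J = Pair i ` J \<union> I \<times> J" by auto
  have "(\<Oplus>x\<in>insert i I \<times> J. f x) = (\<Oplus>x\<in>Pair i ` J. f x) \<oplus> (\<Oplus>x\<in>I \<times> J. f x)"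
    unfolding split using insert assms(2) by (intro finsum_Un_disjoint) auto
  also have "(\<Oplus>x\<in>Pair i ` J. f x) = (\<Oplus>j\<in>J. f (i, j))"
    using insert.prems by (intro finsum_reindex) (auto simp: inj_on_def)
  also have "(\<Oplus>x\<in>I \<times> J. f x) = (\<Oplus>i\<in>I. \<Oplus>j\<in>J. f (i, j))"
    using insert by simp
  also have "(\<Oplus>j\<in>J. f (i, j)) \<oplus> (\<Oplus>i\<in>I. \<Oplus>j\<in>J. f (i, j)) = (\<Oplus>i\<in>insert i I. \<Oplus>j\<in>J. f (i, j))"
    using insert by (intro finsum_insert[symmetric]) (auto intro!: finsum_closed)
  finally show ?case .
qed simp

text \<open>
  The group \<open>P\<close> is the internal product of \<open>G\<close> and \<open>H\<close> by way of the bijection \<open>m\<close>. With an abstract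
  pairing the two factors play symmetric roles, and everything that is proved for the first one holds
  for the second one as well, by lemma \<open>swap\<close>.
\<close>
locale product_group_algebra =
  G?: finite_group_algebra G K + H?: finite_group_algebra H K + P?: finite_group_algebra P K
  for G (structure) and H (structure) and P (structure) and K (structure) +
  fixes m
  assumes m_bij: "bij_betw (\<lambda>(g, h). m g h) (carrier G \<times> carrier H) (carrier P)"
    and m_mult: "\<lbrakk>g \<in> carrier G; g' \<in> carrier G; h \<in> carrier H; h' \<in> carrier H\<rbrakk> \<Longrightarrow>
      m g h \<otimes>\<^bsub>P\<^esub> m g' h' = m (g \<otimes>\<^bsub>G\<^esub> g') (h \<otimes>\<^bsub>H\<^esub> h')"
begin

lemma swap: "product_group_algebra H G P K (\<lambda>h g. m g h)"
proof (unfold_locales, goal_cases)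
  case 1
  have "bij_betw ((\<lambda>(g, h). m g h) \<circ> prod.swap) (carrier H \<times> carrier G) (carrier P)"
    by (rule bij_betw_trans[OF _ m_bij]) (auto simp: bij_betw_def inj_on_def image_iff)
  then show ?case by (simp add: comp_def case_prod_unfold)
qed (simp add: m_mult)

lemma m_closed [simp, intro]: "\<lbrakk>g \<in> carrier G; h \<in> carrier H\<rbrakk> \<Longrightarrow> m g h \<in> carrier P"
  using m_bij by (auto simp: bij_betw_def)

lemma m_eq_iff: "\<lbrakk>g \<in> carrier G; h \<in> carrier H; g' \<in> carrier G; h' \<in> carrier H\<rbrakk> \<Longrightarrow>
    m g h = m g' h' \<longleftrightarrow> g = g' \<and> h = h'"
  using m_bij by (auto simp: bij_betw_def inj_on_def)

lemma m_cases:
  assumes "x \<in> carrier P"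
  obtains g h where "g \<in> carrier G" "h \<in> carrier H" "x = m g h"
proof -
  have "x \<in> (\<lambda>(g, h). m g h) ` (carrier G \<times> carrier H)"
    using assms m_bij by (simp add: bij_betw_def)
  then show thesis using that by auto
qed

lemma m_one: "m \<one>\<^bsub>G\<^esub> \<one>\<^bsub>H\<^esub> = \<one>\<^bsub>P\<^esub>"
proof -
  have "m \<one>\<^bsub>G\<^esub> \<one>\<^bsub>H\<^esub> \<otimes>\<^bsub>P\<^esub> m \<one>\<^bsub>G\<^esub> \<one>\<^bsub>H\<^esub> = m \<one>\<^bsub>G\<^esub> \<one>\<^bsub>H\<^esub>" by (simp add: m_mult)
  then show ?thesis by (simp add: P.G.l_cancel_one)
qed

lemma m_inv: "\<lbrakk>g \<in> carrier G; h \<in> carrier H\<rbrakk> \<Longrightarrow> inv\<^bsub>P\<^esub> (m g h) = m (inv\<^bsub>G\<^esub> g) (inv\<^bsub>H\<^esub> h)"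
  by (rule P.G.inv_equality) (auto simp: m_mult m_one)

abbreviation A where "A \<equiv> group_algebra K G"
abbreviation B where "B \<equiv> group_algebra K H"
abbreviation C where "C \<equiv> group_algebra K P"

text \<open>
  The algebra \<open>C = A \<otimes> B\<close> is the direct sum of the \<open>A\<close>-bimodules \<open>A h\<close> for \<open>h\<close> in \<open>H\<close>; the slice of \<open>u\<close>
  at \<open>h\<close> is its coefficient in \<open>A\<close>, and \<open>glue\<close> puts an element together from its coefficients. In this
  way \<open>C\<close> is handled as the group algebra of \<open>H\<close> with coefficients in \<open>A\<close>.
\<close>
definition slice where
  "slice u h = (\<lambda>g\<in>carrier G. u (m g h))"

definition glue where
  "glue f = (\<lambda>x\<in>carrier P. case the_inv_into (carrier G \<times> carrier H) (\<lambda>(g, h). m g h) x of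
     (g, h) \<Rightarrow> f h g)"

lemma sum_P:
  assumes "\<And>x. x \<in> carrier P \<Longrightarrow> f x \<in> carrier K"
  shows "(\<Oplus>\<^bsub>K\<^esub>x\<in>carrier P. f x) = (\<Oplus>\<^bsub>K\<^esub>h\<in>carrier H. \<Oplus>\<^bsub>K\<^esub>g\<in>carrier G. f (m g h))"
proof -
  have "(\<Oplus>\<^bsub>K\<^esub>x\<in>carrier P. f x) = (\<Oplus>\<^bsub>K\<^esub>x\<in>(\<lambda>(g, h). m g h) ` (carrier G \<times> carrier H). f x)"
    using m_bij by (simp add: bij_betw_def)
  also have "\<dots> = (\<Oplus>\<^bsub>K\<^esub>x\<in>carrier G \<times> carrier H. f (case x of (g, h) \<Rightarrow> m g h))"
    using m_bij assms by (intro G.K.finsum_reindex) (auto simp: bij_betw_def)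
  also have "\<dots> = (\<Oplus>\<^bsub>K\<^esub>g\<in>carrier G. \<Oplus>\<^bsub>K\<^esub>h\<in>carrier H. f (m g h))"
    using assms by (subst G.K.finsum_cartesian) auto
  also have "\<dots> = (\<Oplus>\<^bsub>K\<^esub>h\<in>carrier H. \<Oplus>\<^bsub>K\<^esub>g\<in>carrier G. f (m g h))"
    using assms by (intro G.K.finsum_swap) auto
  finally show ?thesis .
qed

lemma slice_apply: "g \<in> carrier G \<Longrightarrow> slice u h g = u (m g h)"
  by (simp add: slice_def)

lemma slice_closed: "\<lbrakk>u \<in> carrier C; h \<in> carrier H\<rbrakk> \<Longrightarrow> slice u h \<in> carrier A"
  using P.A_apply[of u] by (auto simp: slice_def intro!: G.A_closed)

lemma glue_apply: "\<lbrakk>g \<in> carrier G; h \<in> carrier H\<rbrakk> \<Longrightarrow> glue f (m g h) = f h g"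
  using the_inv_into_f_f[of "\<lambda>(g, h). m g h" "carrier G \<times> carrier H" "(g, h)"] m_bij
  by (auto simp: glue_def bij_betw_def)

lemma glue_closed: "(\<And>h. h \<in> carrier H \<Longrightarrow> f h \<in> carrier A) \<Longrightarrow> glue f \<in> carrier C"
proof -
  assume f: "\<And>h. h \<in> carrier H \<Longrightarrow> f h \<in> carrier A"
  have "glue f x \<in> carrier K" if "x \<in> carrier P" for x
    using that f G.A_apply by (metis m_cases glue_apply)
  moreover have "glue f \<in> extensional (carrier P)" by (auto simp: glue_def)
  ultimately show ?thesis by (auto simp: P.A_carrier PiE_iff)
qed

lemma slice_glue: "\<lbrakk>h \<in> carrier H; f h \<in> carrier A\<rbrakk> \<Longrightarrow> slice (glue f) h = f h"
  by (rule G.A_eqI) (auto simp: slice_def glue_apply G.A_closed G.A_apply)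

lemma slice_eqI:
  assumes "u \<in> carrier C" "v \<in> carrier C" "\<And>h. h \<in> carrier H \<Longrightarrow> slice u h = slice v h"
  shows "u = v"
proof (rule P.A_eqI[OF assms(1,2)])
  fix x assume "x \<in> carrier P"
  then obtain g h where x: "g \<in> carrier G" "h \<in> carrier H" "x = m g h" by (rule m_cases)
  then show "u x = v x" using fun_cong[OF assms(3)[OF x(2)], of g] by (simp add: slice_apply)
qed

lemma slice_add: "h \<in> carrier H \<Longrightarrow> slice (u \<oplus>\<^bsub>C\<^esub> v) h = slice u h \<oplus>\<^bsub>A\<^esub> slice v h"
  by (auto simp: slice_def group_algebra_def)

lemma slice_smult: "h \<in> carrier H \<Longrightarrow> slice (c \<odot>\<^bsub>C\<^esub> u) h = c \<odot>\<^bsub>A\<^esub> slice u h"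
  by (auto simp: slice_def group_algebra_def)

lemma slice_zero: "h \<in> carrier H \<Longrightarrow> slice \<zero>\<^bsub>C\<^esub> h = \<zero>\<^bsub>A\<^esub>"
  by (auto simp: slice_def group_algebra_def)

lemma slice_neg: "\<lbrakk>u \<in> carrier C; h \<in> carrier H\<rbrakk> \<Longrightarrow> slice (\<ominus>\<^bsub>C\<^esub> u) h = \<ominus>\<^bsub>A\<^esub> slice u h"
  by (rule G.alg.A.minus_equality[symmetric])
    (simp_all add: slice_closed slice_add[symmetric] P.alg.A.l_neg slice_zero)

lemma slice_minus: "\<lbrakk>u \<in> carrier C; v \<in> carrier C; h \<in> carrier H\<rbrakk> \<Longrightarrow>
    slice (u \<ominus>\<^bsub>C\<^esub> v) h = slice u h \<ominus>\<^bsub>A\<^esub> slice v h"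
  by (simp add: a_minus_def slice_add slice_neg)

lemma slice_finsum:
  "\<lbrakk>f \<in> I \<rightarrow> carrier C; h \<in> carrier H\<rbrakk> \<Longrightarrow> slice (\<Oplus>\<^bsub>C\<^esub>i\<in>I. f i) h = (\<Oplus>\<^bsub>A\<^esub>i\<in>I. slice (f i) h)"
  by (induction I rule: infinite_finite_induct)
    (auto simp: slice_zero slice_add slice_closed Pi_iff)

text \<open>
  The convolution product of \<open>H\<close> with coefficients in \<open>A\<close>.
\<close>
lemma slice_mult:
  assumes u: "u \<in> carrier C" and v: "v \<in> carrier C" and h: "h \<in> carrier H"
  shows "slice (u \<otimes>\<^bsub>C\<^esub> v) h = (\<Oplus>\<^bsub>A\<^esub>k\<in>carrier H. slice u k \<otimes>\<^bsub>A\<^esub> slice v (inv\<^bsub>H\<^esub> k \<otimes>\<^bsub>H\<^esub> h))"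
proof (rule G.A_eqI)
  have cl: "(\<lambda>k. slice u k \<otimes>\<^bsub>A\<^esub> slice v (inv\<^bsub>H\<^esub> k \<otimes>\<^bsub>H\<^esub> h)) \<in> carrier H \<rightarrow> carrier A"
    using u v h by (auto simp: slice_closed)
  show "(\<Oplus>\<^bsub>A\<^esub>k\<in>carrier H. slice u k \<otimes>\<^bsub>A\<^esub> slice v (inv\<^bsub>H\<^esub> k \<otimes>\<^bsub>H\<^esub> h)) \<in> carrier A"
    using cl by (rule G.alg.A.finsum_closed)
  note [simp] = P.A_apply[OF u] P.A_apply[OF v]
  fix g assume g: "g \<in> carrier G"
  have "slice (u \<otimes>\<^bsub>C\<^esub> v) h g = (\<Oplus>\<^bsub>K\<^esub>x\<in>carrier P. u x \<otimes>\<^bsub>K\<^esub> v (inv\<^bsub>P\<^esub> x \<otimes>\<^bsub>P\<^esub> m g h))"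
    using u v g h by (simp add: slice_apply P.A_mult)
  also have "\<dots> = (\<Oplus>\<^bsub>K\<^esub>k\<in>carrier H. \<Oplus>\<^bsub>K\<^esub>l\<in>carrier G. u (m l k) \<otimes>\<^bsub>K\<^esub> v (inv\<^bsub>P\<^esub> (m l k) \<otimes>\<^bsub>P\<^esub> m g h))"
    using g h by (intro sum_P) auto
  also have "\<dots> = (\<Oplus>\<^bsub>K\<^esub>k\<in>carrier H. (slice u k \<otimes>\<^bsub>A\<^esub> slice v (inv\<^bsub>H\<^esub> k \<otimes>\<^bsub>H\<^esub> h)) g)"
  proof (intro G.K.finsum_cong' refl)
    fix k assume k: "k \<in> carrier H"
    show "(\<Oplus>\<^bsub>K\<^esub>l\<in>carrier G. u (m l k) \<otimes>\<^bsub>K\<^esub> v (inv\<^bsub>P\<^esub> (m l k) \<otimes>\<^bsub>P\<^esub> m g h)) =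
        (slice u k \<otimes>\<^bsub>A\<^esub> slice v (inv\<^bsub>H\<^esub> k \<otimes>\<^bsub>H\<^esub> h)) g"
      unfolding G.A_mult[OF slice_closed[OF u k] slice_closed[OF v H.G.m_closed[OF H.G.inv_closed[OF k] h]] g]
      using g h k by (intro G.K.finsum_cong') (auto simp: slice_apply m_inv m_mult)
  qed (use cl g G.A_apply in blast)
  also have "\<dots> = (\<Oplus>\<^bsub>A\<^esub>k\<in>carrier H. slice u k \<otimes>\<^bsub>A\<^esub> slice v (inv\<^bsub>H\<^esub> k \<otimes>\<^bsub>H\<^esub> h)) g"
    using cl g by (simp add: G.A_finsum_apply)
  finally show "slice (u \<otimes>\<^bsub>C\<^esub> v) h g =
    (\<Oplus>\<^bsub>A\<^esub>k\<in>carrier H. slice u k \<otimes>\<^bsub>A\<^esub> slice v (inv\<^bsub>H\<^esub> k \<otimes>\<^bsub>H\<^esub> h)) g" .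
qed (use u v h in \<open>auto intro: slice_closed\<close>)

lemma aug_slice:
  assumes u: "u \<in> carrier C"
  shows "P.aug u = (\<Oplus>\<^bsub>K\<^esub>h\<in>carrier H. G.aug (slice u h))"
  using P.A_apply[OF u] unfolding P.aug_def G.aug_def
  by (subst sum_P) (auto intro!: G.K.finsum_cong' G.K.finsum_closed simp: slice_apply)

subsection \<open>The two factors as commuting subalgebras\<close>

definition emb where "emb a = glue (\<lambda>h. if h = \<one>\<^bsub>H\<^esub> then a else \<zero>\<^bsub>A\<^esub>)"

lemma emb_closed [simp, intro]: "a \<in> carrier A \<Longrightarrow> emb a \<in> carrier C"
  unfolding emb_def by (rule glue_closed) simp

lemma slice_emb: "\<lbrakk>a \<in> carrier A; h \<in> carrier H\<rbrakk> \<Longrightarrow> slice (emb a) h = (if h = \<one>\<^bsub>H\<^esub> then a else \<zero>\<^bsub>A\<^esub>)"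
  unfolding emb_def by (subst slice_glue) auto

text \<open>
  The element \<open>1 \<otimes> h\<close>.
\<close>
abbreviation helt where "helt h \<equiv> P.gelt (m \<one>\<^bsub>G\<^esub> h)"

lemma slice_helt_mult:
  "\<lbrakk>u \<in> carrier C; h \<in> carrier H; k \<in> carrier H\<rbrakk> \<Longrightarrow> slice (helt k \<otimes>\<^bsub>C\<^esub> u) h = slice u (inv\<^bsub>H\<^esub> k \<otimes>\<^bsub>H\<^esub> h)"
  by (rule G.A_eqI) (auto simp: slice_closed slice_apply P.gelt_mult_apply m_inv m_mult)

lemma slice_mult_helt:
  "\<lbrakk>u \<in> carrier C; h \<in> carrier H; k \<in> carrier H\<rbrakk> \<Longrightarrow> slice (u \<otimes>\<^bsub>C\<^esub> helt k) h = slice u (h \<otimes>\<^bsub>H\<^esub> inv\<^bsub>H\<^esub> k)"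
  by (rule G.A_eqI) (auto simp: slice_closed slice_apply P.mult_gelt_apply m_inv m_mult)

lemma slice_helt:
  "\<lbrakk>h \<in> carrier H; k \<in> carrier H\<rbrakk> \<Longrightarrow> slice (helt k) h = (if h = k then \<one>\<^bsub>A\<^esub> else \<zero>\<^bsub>A\<^esub>)"
  by (rule G.A_eqI, simp add: slice_closed)
    (auto simp: slice_apply P.gelt_def G.A_simps G.A_closed m_eq_iff)

lemma slice_emb_mult:
  assumes a: "a \<in> carrier A" and u: "u \<in> carrier C" and h: "h \<in> carrier H"
  shows "slice (emb a \<otimes>\<^bsub>C\<^esub> u) h = a \<otimes>\<^bsub>A\<^esub> slice u h"
proof -
  have "slice (emb a \<otimes>\<^bsub>C\<^esub> u) h =
      (\<Oplus>\<^bsub>A\<^esub>k\<in>carrier H. if \<one>\<^bsub>H\<^esub> = k then a \<otimes>\<^bsub>A\<^esub> slice u (inv\<^bsub>H\<^esub> k \<otimes>\<^bsub>H\<^esub> h) else \<zero>\<^bsub>A\<^esub>)"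
    unfolding slice_mult[OF emb_closed[OF a] u h]
    using a u h by (intro G.alg.A.finsum_cong') (auto simp: slice_emb slice_closed)
  also have "\<dots> = a \<otimes>\<^bsub>A\<^esub> slice u h"
    using a u h by (subst G.alg.A.add.finprod_singleton) (auto simp: slice_closed)
  finally show ?thesis .
qed

lemma slice_mult_emb:
  assumes a: "a \<in> carrier A" and u: "u \<in> carrier C" and h: "h \<in> carrier H"
  shows "slice (u \<otimes>\<^bsub>C\<^esub> emb a) h = slice u h \<otimes>\<^bsub>A\<^esub> a"
proof -
  have eq: "inv\<^bsub>H\<^esub> k \<otimes>\<^bsub>H\<^esub> h = \<one>\<^bsub>H\<^esub> \<longleftrightarrow> h = k" if "k \<in> carrier H" for k
    using that h H.G.inv_solve_left'[of "\<one>\<^bsub>H\<^esub>" k h] by auto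
  have "slice (u \<otimes>\<^bsub>C\<^esub> emb a) h =
      (\<Oplus>\<^bsub>A\<^esub>k\<in>carrier H. if h = k then slice u k \<otimes>\<^bsub>A\<^esub> a else \<zero>\<^bsub>A\<^esub>)"
    unfolding slice_mult[OF u emb_closed[OF a] h]
    using a u h by (intro G.alg.A.finsum_cong') (auto simp: slice_emb slice_closed eq)
  also have "\<dots> = slice u h \<otimes>\<^bsub>A\<^esub> a"
    using a u h by (subst G.alg.A.add.finprod_singleton) (auto simp: slice_closed)
  finally show ?thesis .
qed

lemma emb_add: "\<lbrakk>a \<in> carrier A; b \<in> carrier A\<rbrakk> \<Longrightarrow> emb (a \<oplus>\<^bsub>A\<^esub> b) = emb a \<oplus>\<^bsub>C\<^esub> emb b"
  by (rule slice_eqI) (auto simp: slice_emb slice_add)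

lemma emb_smult: "\<lbrakk>c \<in> carrier K; a \<in> carrier A\<rbrakk> \<Longrightarrow> emb (c \<odot>\<^bsub>A\<^esub> a) = c \<odot>\<^bsub>C\<^esub> emb a"
  by (rule slice_eqI) (auto simp: slice_emb slice_smult)

lemma emb_mult: "\<lbrakk>a \<in> carrier A; b \<in> carrier A\<rbrakk> \<Longrightarrow> emb (a \<otimes>\<^bsub>A\<^esub> b) = emb a \<otimes>\<^bsub>C\<^esub> emb b"
  by (rule slice_eqI) (auto simp: slice_emb slice_emb_mult)

lemma emb_helt_comm: "\<lbrakk>a \<in> carrier A; k \<in> carrier H\<rbrakk> \<Longrightarrow> emb a \<otimes>\<^bsub>C\<^esub> helt k = helt k \<otimes>\<^bsub>C\<^esub> emb a"
  by (rule slice_eqI) (auto simp: slice_emb_mult slice_mult_emb slice_helt)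

lemma emb_gelt_helt: "\<lbrakk>g \<in> carrier G; h \<in> carrier H\<rbrakk> \<Longrightarrow> emb (G.gelt g) \<otimes>\<^bsub>C\<^esub> helt h = P.gelt (m g h)"
proof (rule slice_eqI)
  fix k assume *: "g \<in> carrier G" "h \<in> carrier H" "k \<in> carrier H"
  show "slice (emb (G.gelt g) \<otimes>\<^bsub>C\<^esub> helt h) k = slice (P.gelt (m g h)) k"
  proof (rule G.A_eqI)
    fix l assume "l \<in> carrier G"
    then show "slice (emb (G.gelt g) \<otimes>\<^bsub>C\<^esub> helt h) k l = slice (P.gelt (m g h)) k l"
      using * by (simp add: slice_emb_mult slice_helt) (auto simp: slice_apply P.gelt_def G.gelt_def G.A_simps m_eq_iff)
  qed (use * in \<open>auto intro!: slice_closed\<close>)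
qed auto

lemma slice_center:
  assumes z: "z \<in> ring_center C" and h: "h \<in> carrier H"
  shows "slice z h \<in> ring_center A"
proof -
  note zc = P.alg.A.center_carrier[OF z]
  have "slice z h \<otimes>\<^bsub>A\<^esub> a = a \<otimes>\<^bsub>A\<^esub> slice z h" if "a \<in> carrier A" for a
    using P.alg.A.center_comm[OF z, of "emb a"] that zc h
    by (metis emb_closed slice_emb_mult slice_mult_emb)
  then show ?thesis using zc h by (auto simp: ring_center_def slice_closed)
qed

end

section \<open>Derivations of the group algebra of a direct product\<close>

lemma (in abelian_group) add_eq_add_imp_eq_minus:
  assumes "x \<in> carrier G" "u \<in> carrier G" "v \<in> carrier G" "y \<in> carrier G"
    and eq: "x \<oplus> u = v \<oplus> y"
  shows "x = y \<oplus> (v \<ominus> u)"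
proof -
  have "x = v \<oplus> y \<ominus> u"
    using assms add.inv_solve_right[of x "v \<oplus> y" u] by (simp add: minus_eq)
  then show ?thesis using assms by (simp add: minus_eq a_ac)
qed

context product_group_algebra
begin

text \<open>
  The derivation \<open>d \<otimes> 1\<close>, which acts on coefficients.
\<close>
definition lift where
  "lift d = (\<lambda>u\<in>carrier C. glue (\<lambda>h. d (slice u h)))"

lemma slice_lift:
  "\<lbrakk>d \<in> derivations K A; u \<in> carrier C; h \<in> carrier H\<rbrakk> \<Longrightarrow> slice (lift d u) h = d (slice u h)"
  by (simp add: lift_def slice_glue slice_closed G.alg.derivation_closed)

lemma lift_closed:
  assumes "d \<in> derivations K A" "u \<in> carrier C"
  shows "lift d u \<in> carrier C"
  using assms G.alg.derivation_closed[OF assms(1)]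
  by (auto simp: lift_def intro!: glue_closed slice_closed)

lemma lift_derivation:
  assumes d: "d \<in> derivations K A"
  shows "lift d \<in> derivations K C"
proof -
  note rules = G.alg.derivation_rules[OF d] slice_lift[OF d] lift_closed[OF d]
  have "(\<lambda>u\<in>carrier C. lift d u) \<in> derivations K C"
  proof (rule P.alg.restrict_derivation)
    fix u v assume u: "u \<in> carrier C" and v: "v \<in> carrier C"
    show "lift d (u \<oplus>\<^bsub>C\<^esub> v) = lift d u \<oplus>\<^bsub>C\<^esub> lift d v"
      using u v by (intro slice_eqI) (simp_all add: rules slice_add slice_closed)
    show "lift d (u \<otimes>\<^bsub>C\<^esub> v) = lift d u \<otimes>\<^bsub>C\<^esub> v \<oplus>\<^bsub>C\<^esub> u \<otimes>\<^bsub>C\<^esub> lift d v"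
    proof (rule slice_eqI)
      fix h assume h: "h \<in> carrier H"
      have hk: "inv\<^bsub>H\<^esub> k \<otimes>\<^bsub>H\<^esub> h \<in> carrier H" if "k \<in> carrier H" for k using that h by simp
      have "slice (lift d (u \<otimes>\<^bsub>C\<^esub> v)) h =
          d (\<Oplus>\<^bsub>A\<^esub>k\<in>carrier H. slice u k \<otimes>\<^bsub>A\<^esub> slice v (inv\<^bsub>H\<^esub> k \<otimes>\<^bsub>H\<^esub> h))"
        using u v h by (simp add: rules slice_mult)
      also have "\<dots> = (\<Oplus>\<^bsub>A\<^esub>k\<in>carrier H. d (slice u k \<otimes>\<^bsub>A\<^esub> slice v (inv\<^bsub>H\<^esub> k \<otimes>\<^bsub>H\<^esub> h)))"
        using u v hk by (intro G.alg.derivation_finsum[OF d]) (simp add: slice_closed)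
      also have "\<dots> = (\<Oplus>\<^bsub>A\<^esub>k\<in>carrier H. slice (lift d u) k \<otimes>\<^bsub>A\<^esub> slice v (inv\<^bsub>H\<^esub> k \<otimes>\<^bsub>H\<^esub> h) \<oplus>\<^bsub>A\<^esub>
          slice u k \<otimes>\<^bsub>A\<^esub> slice (lift d v) (inv\<^bsub>H\<^esub> k \<otimes>\<^bsub>H\<^esub> h))"
        using u v hk by (intro G.alg.A.finsum_cong') (simp_all add: rules slice_closed)
      also have "\<dots> = slice (lift d u \<otimes>\<^bsub>C\<^esub> v) h \<oplus>\<^bsub>A\<^esub> slice (u \<otimes>\<^bsub>C\<^esub> lift d v) h"
        unfolding slice_mult[OF lift_closed[OF d u] v h] slice_mult[OF u lift_closed[OF d v] h]
        using u v hk by (intro G.alg.A.finsum_addf) (simp_all add: rules slice_closed)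
      finally show "slice (lift d (u \<otimes>\<^bsub>C\<^esub> v)) h = slice (lift d u \<otimes>\<^bsub>C\<^esub> v \<oplus>\<^bsub>C\<^esub> u \<otimes>\<^bsub>C\<^esub> lift d v) h"
        using h by (simp add: slice_add)
    qed (use u v in \<open>simp_all add: rules\<close>)
  next
    fix c u assume "c \<in> carrier K" "u \<in> carrier C"
    then show "lift d (c \<odot>\<^bsub>C\<^esub> u) = c \<odot>\<^bsub>C\<^esub> lift d u"
      by (intro slice_eqI) (simp_all add: rules slice_smult slice_closed)
  qed (simp add: rules)
  moreover have "(\<lambda>u\<in>carrier C. lift d u) = lift d" by (auto simp: lift_def)
  ultimately show ?thesis by simp
qed

lemma lift_add:
  "\<lbrakk>d \<in> derivations K A; e \<in> derivations K A\<rbrakk> \<Longrightarrow>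
    lift (d \<oplus>\<^bsub>Der K A\<^esub> e) = lift d \<oplus>\<^bsub>Der K C\<^esub> lift e"
  and lift_smult:
  "\<lbrakk>c \<in> carrier K; d \<in> derivations K A\<rbrakk> \<Longrightarrow> lift (c \<odot>\<^bsub>Der K A\<^esub> d) = c \<odot>\<^bsub>Der K C\<^esub> lift d"
  and lift_bracket:
  "\<lbrakk>d \<in> derivations K A; e \<in> derivations K A\<rbrakk> \<Longrightarrow>
    lift (d \<otimes>\<^bsub>Der K A\<^esub> e) = lift d \<otimes>\<^bsub>Der K C\<^esub> lift e"
  and lift_zero: "lift \<zero>\<^bsub>Der K A\<^esub> = \<zero>\<^bsub>Der K C\<^esub>"
  by (rule P.alg.derivation_eqI; (rule slice_eqI)?;
    simp add: lift_derivation G.alg.Der_add_closed P.alg.Der_add_closed G.alg.Der_smult_closed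
      P.alg.Der_smult_closed G.alg.Der_bracket_closed P.alg.Der_bracket_closed
      G.alg.Der_zero_closed P.alg.Der_zero_closed lift_closed slice_lift slice_closed slice_zero
      P.alg.Der_apply G.alg.Der_apply slice_add slice_smult slice_minus)+

lemma lift_emb:
  assumes "d \<in> derivations K A" "a \<in> carrier A"
  shows "lift d (emb a) = emb (d a)"
  using assms G.alg.derivation_closed[OF assms] G.alg.derivation_zero[OF assms(1)]
  by (intro slice_eqI) (auto simp: lift_closed slice_lift slice_emb)

lemma lift_helt:
  assumes "d \<in> derivations K A" "k \<in> carrier H"
  shows "lift d (helt k) = \<zero>\<^bsub>C\<^esub>"
  using assms G.alg.derivation_zero[OF assms(1)] G.alg.derivation_one[OF assms(1)]
  by (intro slice_eqI) (auto simp: lift_closed slice_lift slice_helt slice_zero)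

lemma lift_inner:
  assumes x: "x \<in> carrier A"
  shows "lift (G.alg.inner x) = P.alg.inner (emb x)"
proof (rule P.alg.derivation_eqI)
  fix u assume u: "u \<in> carrier C"
  show "lift (G.alg.inner x) u = P.alg.inner (emb x) u"
    using x u by (intro slice_eqI) (simp_all add: lift_closed G.alg.inner_derivation slice_lift slice_closed
      P.alg.inner_apply G.alg.inner_apply slice_minus slice_emb_mult slice_mult_emb)
qed (use x in \<open>simp_all add: lift_derivation G.alg.inner_derivation P.alg.inner_derivation\<close>)

text \<open>
  Compare coefficients at the unit of \<open>H\<close>. So the map that \<open>lift\<close> induces on \<open>HH1\<close> is injective.
\<close>
lemma inner_of_lift_inner:
  assumes d: "d \<in> derivations K A" and x: "x \<in> carrier C" and eq: "lift d = P.alg.inner x"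
  shows "d = G.alg.inner (slice x \<one>\<^bsub>H\<^esub>)"
proof (rule G.alg.derivation_eqI[OF d])
  show "G.alg.inner (slice x \<one>\<^bsub>H\<^esub>) \<in> derivations K A"
    using x by (simp add: G.alg.inner_derivation slice_closed)
  fix a assume a: "a \<in> carrier A"
  have "slice (lift d (emb a)) \<one>\<^bsub>H\<^esub> = d a"
    using d a by (simp add: slice_lift slice_emb)
  moreover have "slice (P.alg.inner x (emb a)) \<one>\<^bsub>H\<^esub> = G.alg.inner (slice x \<one>\<^bsub>H\<^esub>) a"
    using x a by (simp add: P.alg.inner_apply G.alg.inner_apply slice_minus slice_emb_mult slice_mult_emb)
  ultimately show "d a = G.alg.inner (slice x \<one>\<^bsub>H\<^esub>) a" using eq by simp
qed

lemma derivation_determined: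
  assumes D: "D \<in> derivations K C" and E: "E \<in> derivations K C"
    and emb: "\<And>a. a \<in> carrier A \<Longrightarrow> D (emb a) = E (emb a)"
    and helt: "\<And>k. k \<in> carrier H \<Longrightarrow> D (helt k) = E (helt k)"
  shows "D = E"
proof (rule P.alg.derivation_eqI[OF D E])
  fix u assume "u \<in> carrier C"
  then show "D u = E u"
  proof (induction u rule: P.A_induct)
    case (gelt c x)
    obtain g h where x: "g \<in> carrier G" "h \<in> carrier H" "x = m g h" using gelt by (auto elim: m_cases)
    have "D (P.gelt x) = E (P.gelt x)"
      unfolding x(3) emb_gelt_helt[OF x(1,2), symmetric] using x
      by (simp add: P.alg.derivation_mult[OF D] P.alg.derivation_mult[OF E] emb helt)
    then show ?case using gelt by (simp add: P.alg.derivation_smult[OF D] P.alg.derivation_smult[OF E])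
  qed (simp_all add: P.alg.derivation_rules[OF D] P.alg.derivation_rules[OF E])
qed

text \<open>
  The restriction of a derivation of \<open>C\<close> to \<open>A\<close> takes values in the direct sum of the bimodules \<open>A h\<close>,
  so it is a family of derivations of \<open>A\<close>, indexed by \<open>H\<close>.
\<close>
definition component where
  "component D h = (\<lambda>a\<in>carrier A. slice (D (emb a)) h)"

lemma component_derivation:
  assumes D: "D \<in> derivations K C" and h: "h \<in> carrier H"
  shows "component D h \<in> derivations K A"
  unfolding component_def
  by (rule G.alg.restrict_derivation)
    (use h in \<open>simp_all add: P.alg.derivation_rules[OF D] slice_closed emb_add emb_smult emb_mult
      slice_add slice_smult slice_emb_mult slice_mult_emb\<close>)

text \<open>
  Apply \<open>D\<close> to the relation \<open>a k = k a\<close> between commuting elements of \<open>A\<close> and \<open>H\<close>, and compare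
  coefficients at \<open>k h\<close>. Hence the class of a component in \<open>HH1(A)\<close> depends only on the conjugacy
  class of its index.
\<close>
lemma component_conjugate:
  assumes D: "D \<in> derivations K C" and h: "h \<in> carrier H" and k: "k \<in> carrier H" and a: "a \<in> carrier A"
  shows "component D (k \<otimes>\<^bsub>H\<^esub> h \<otimes>\<^bsub>H\<^esub> inv\<^bsub>H\<^esub> k) a =
    component D h a \<oplus>\<^bsub>A\<^esub> G.alg.inner (slice (D (helt k)) (k \<otimes>\<^bsub>H\<^esub> h)) a"
proof -
  note D_closed = P.alg.derivation_closed[OF D]
  let ?x = "slice (D (helt k)) (k \<otimes>\<^bsub>H\<^esub> h)"
  have x: "?x \<in> carrier A" using h k D_closed by (simp add: slice_closed)
  have kh: "k \<otimes>\<^bsub>H\<^esub> h \<in> carrier H" using h k by simp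
  have "D (emb a) \<otimes>\<^bsub>C\<^esub> helt k \<oplus>\<^bsub>C\<^esub> emb a \<otimes>\<^bsub>C\<^esub> D (helt k) = D (emb a \<otimes>\<^bsub>C\<^esub> helt k)"
    using a k by (simp add: P.alg.derivation_mult[OF D])
  also have "\<dots> = D (helt k) \<otimes>\<^bsub>C\<^esub> emb a \<oplus>\<^bsub>C\<^esub> helt k \<otimes>\<^bsub>C\<^esub> D (emb a)"
    using a k by (simp add: emb_helt_comm P.alg.derivation_mult[OF D])
  finally have "slice (D (emb a) \<otimes>\<^bsub>C\<^esub> helt k \<oplus>\<^bsub>C\<^esub> emb a \<otimes>\<^bsub>C\<^esub> D (helt k)) (k \<otimes>\<^bsub>H\<^esub> h) =
      slice (D (helt k) \<otimes>\<^bsub>C\<^esub> emb a \<oplus>\<^bsub>C\<^esub> helt k \<otimes>\<^bsub>C\<^esub> D (emb a)) (k \<otimes>\<^bsub>H\<^esub> h)" by simp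
  moreover have "inv\<^bsub>H\<^esub> k \<otimes>\<^bsub>H\<^esub> (k \<otimes>\<^bsub>H\<^esub> h) = h" using h k by (simp add: H.G.m_assoc[symmetric])
  ultimately have "component D (k \<otimes>\<^bsub>H\<^esub> h \<otimes>\<^bsub>H\<^esub> inv\<^bsub>H\<^esub> k) a \<oplus>\<^bsub>A\<^esub> a \<otimes>\<^bsub>A\<^esub> ?x = ?x \<otimes>\<^bsub>A\<^esub> a \<oplus>\<^bsub>A\<^esub> component D h a"
    using a h k kh by (simp add: slice_add slice_emb_mult slice_mult_emb slice_helt_mult slice_mult_helt
      D_closed component_def)
  moreover have "component D (k \<otimes>\<^bsub>H\<^esub> h \<otimes>\<^bsub>H\<^esub> inv\<^bsub>H\<^esub> k) a \<in> carrier A" "component D h a \<in> carrier A"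
    using a h k by (simp_all add: G.alg.derivation_closed[OF component_derivation[OF D]])
  ultimately show ?thesis
    using a x G.alg.A.add_eq_add_imp_eq_minus[of _ "a \<otimes>\<^bsub>A\<^esub> ?x" "?x \<otimes>\<^bsub>A\<^esub> a" "component D h a"]
    by (simp add: G.alg.inner_apply)
qed

definition conj_class where
  "conj_class h = {k \<otimes>\<^bsub>H\<^esub> h \<otimes>\<^bsub>H\<^esub> inv\<^bsub>H\<^esub> k | k. k \<in> carrier H}"

definition class_rep where
  "class_rep h = (SOME h'. h' \<in> conj_class h)"

lemma class_rep_conjugate:
  assumes h: "h \<in> carrier H"
  obtains k where "k \<in> carrier H" "class_rep h = k \<otimes>\<^bsub>H\<^esub> h \<otimes>\<^bsub>H\<^esub> inv\<^bsub>H\<^esub> k"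
proof -
  have "h \<in> conj_class h"
    using h unfolding conj_class_def by (intro CollectI exI[of _ "\<one>\<^bsub>H\<^esub>"]) simp
  then have "class_rep h \<in> conj_class h" unfolding class_rep_def by (rule someI)
  then show thesis using that by (auto simp: conj_class_def)
qed

lemma class_rep_closed: "h \<in> carrier H \<Longrightarrow> class_rep h \<in> carrier H"
  using class_rep_conjugate by (metis H.G.inv_closed H.G.m_closed)

lemma conj_class_subset:
  assumes h: "h \<in> carrier H" and k: "k \<in> carrier H"
  shows "conj_class (k \<otimes>\<^bsub>H\<^esub> h \<otimes>\<^bsub>H\<^esub> inv\<^bsub>H\<^esub> k) \<subseteq> conj_class h"
proof
  fix x assume "x \<in> conj_class (k \<otimes>\<^bsub>H\<^esub> h \<otimes>\<^bsub>H\<^esub> inv\<^bsub>H\<^esub> k)"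
  then obtain l where "l \<in> carrier H" "x = l \<otimes>\<^bsub>H\<^esub> (k \<otimes>\<^bsub>H\<^esub> h \<otimes>\<^bsub>H\<^esub> inv\<^bsub>H\<^esub> k) \<otimes>\<^bsub>H\<^esub> inv\<^bsub>H\<^esub> l"
    by (auto simp: conj_class_def)
  then have "x = (l \<otimes>\<^bsub>H\<^esub> k) \<otimes>\<^bsub>H\<^esub> h \<otimes>\<^bsub>H\<^esub> inv\<^bsub>H\<^esub> (l \<otimes>\<^bsub>H\<^esub> k)" "l \<otimes>\<^bsub>H\<^esub> k \<in> carrier H"
    using h k by (simp_all add: H.G.m_assoc H.G.inv_mult_group)
  then show "x \<in> conj_class h" unfolding conj_class_def by blast
qed

lemma class_rep_conj_eq:
  assumes h: "h \<in> carrier H" and k: "k \<in> carrier H"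
  shows "class_rep (k \<otimes>\<^bsub>H\<^esub> h \<otimes>\<^bsub>H\<^esub> inv\<^bsub>H\<^esub> k) = class_rep h"
proof -
  let ?h = "k \<otimes>\<^bsub>H\<^esub> h \<otimes>\<^bsub>H\<^esub> inv\<^bsub>H\<^esub> k"
  have "inv\<^bsub>H\<^esub> k \<otimes>\<^bsub>H\<^esub> ?h \<otimes>\<^bsub>H\<^esub> inv\<^bsub>H\<^esub> (inv\<^bsub>H\<^esub> k) = h"
  proof -
    have "inv\<^bsub>H\<^esub> k \<otimes>\<^bsub>H\<^esub> (k \<otimes>\<^bsub>H\<^esub> h) = h" using h k by (simp add: H.G.m_assoc[symmetric])
    then show ?thesis using h k by (simp add: H.G.m_assoc)
  qed
  then have "conj_class ?h = conj_class h"
    using conj_class_subset[OF h k] conj_class_subset[of ?h "inv\<^bsub>H\<^esub> k"] h k by auto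
  then show ?thesis by (simp add: class_rep_def)
qed

lemma class_rep_comm: "\<lbrakk>h \<in> carrier H; k \<in> carrier H\<rbrakk> \<Longrightarrow> class_rep (k \<otimes>\<^bsub>H\<^esub> h) = class_rep (h \<otimes>\<^bsub>H\<^esub> k)"
  using class_rep_conj_eq[of "h \<otimes>\<^bsub>H\<^esub> k" k] by (simp add: H.G.m_assoc)

text \<open>
  The element \<open>1 \<otimes> (\<Sum>h. h)\<close>, where \<open>h\<close> runs over the conjugacy class with representative \<open>r\<close>. It is
  \<open>0\<close> if \<open>r\<close> is not a chosen representative.
\<close>
definition class_sum where
  "class_sum r = glue (\<lambda>h. if class_rep h = r then \<one>\<^bsub>A\<^esub> else \<zero>\<^bsub>A\<^esub>)"

lemma class_sum_closed: "class_sum r \<in> carrier C"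
  unfolding class_sum_def by (rule glue_closed) simp

lemma slice_class_sum: "h \<in> carrier H \<Longrightarrow> slice (class_sum r) h = (if class_rep h = r then \<one>\<^bsub>A\<^esub> else \<zero>\<^bsub>A\<^esub>)"
  unfolding class_sum_def by (subst slice_glue) auto

lemma class_sum_central: "class_sum r \<in> ring_center C"
proof (rule P.class_function_central[OF class_sum_closed])
  fix x y assume "x \<in> carrier P" "y \<in> carrier P"
  then obtain g h g' h' where x: "g \<in> carrier G" "h \<in> carrier H" "x = m g h"
    and y: "g' \<in> carrier G" "h' \<in> carrier H" "y = m g' h'" by (metis m_cases)
  have "g \<otimes>\<^bsub>G\<^esub> g' = \<one>\<^bsub>G\<^esub> \<longleftrightarrow> g' \<otimes>\<^bsub>G\<^esub> g = \<one>\<^bsub>G\<^esub>"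
    using x y by (metis G.G.inv_comm)
  then show "class_sum r (x \<otimes>\<^bsub>P\<^esub> y) = class_sum r (y \<otimes>\<^bsub>P\<^esub> x)"
    using x y class_rep_comm[of h h'] by (simp add: m_mult class_sum_def glue_apply G.A_simps)
qed

definition multiples where
  "multiples = {P.alg.cmult z (lift d) | z d. z \<in> ring_center C \<and> d \<in> derivations K A}"

lemma multiples_closed: "multiples \<subseteq> derivations K C"
  by (auto simp: multiples_def P.alg.cmult_derivation lift_derivation)

text \<open>
  The sum of \<open>D\<^sub>r \<otimes> c\<^sub>r\<close> over the conjugacy classes of \<open>H\<close>, with the component \<open>D\<^sub>r\<close> at the
  representative \<open>r\<close> and the class sum \<open>c\<^sub>r\<close>. It is obtained from \<open>D\<close> when all components in one
  class are replaced by the one at the representative.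
\<close>
definition class_part where
  "class_part D = (\<Oplus>\<^bsub>Der K C\<^esub>r\<in>class_rep ` carrier H. P.alg.cmult (class_sum r) (lift (component D r)))"

lemma class_part_terms:
  "D \<in> derivations K C \<Longrightarrow>
    (\<lambda>r. P.alg.cmult (class_sum r) (lift (component D r))) \<in> class_rep ` carrier H \<rightarrow> derivations K C"
  by (auto intro!: P.alg.cmult_derivation class_sum_central lift_derivation component_derivation class_rep_closed)

lemma class_part_in_span:
  assumes D: "D \<in> derivations K C"
  shows "class_part D \<in> module_span K (Der K C) multiples" "class_part D \<in> derivations K C"
proof -
  let ?S = "module_span K (Der K C) multiples"
  have S: "submodule ?S K (Der K C)"
    using multiples_closed by (intro P.alg.der.module_span_submodule) simp
  have "(\<Oplus>\<^bsub>Der K C\<^esub>r\<in>R. P.alg.cmult (class_sum r) (lift (component D r))) \<in> ?S"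
    if "R \<subseteq> class_rep ` carrier H" for R
    using finite_subset[OF that finite_imageI[OF H.finite_group]] that
  proof (induction R rule: finite_induct)
    case (insert r R)
    have "P.alg.cmult (class_sum r) (lift (component D r)) \<in> multiples"
      unfolding multiples_def using insert.prems class_sum_central component_derivation[OF D] class_rep_closed by blast
    then have "P.alg.cmult (class_sum r) (lift (component D r)) \<in> ?S"
      using P.alg.der.module_span_superset by blast
    moreover have "(\<lambda>r. P.alg.cmult (class_sum r) (lift (component D r))) \<in> insert r R \<rightarrow> carrier (Der K C)"
      using class_part_terms[OF D] insert.prems by auto
    ultimately show ?case
      using insert by (subst P.alg.der.M.finsum_insert) (auto intro!: P.alg.der.submodule_add[OF S])
  qed (simp add: P.alg.der.submodule_zero[OF S])
  then show "class_part D \<in> ?S" by (simp add: class_part_def)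
  then show "class_part D \<in> derivations K C" using P.alg.der.submodule_subset[OF S] by auto
qed

lemma class_part_apply:
  assumes D: "D \<in> derivations K C" and u: "u \<in> carrier C"
  shows "class_part D u = (\<Oplus>\<^bsub>C\<^esub>r\<in>class_rep ` carrier H. class_sum r \<otimes>\<^bsub>C\<^esub> lift (component D r) u)"
  unfolding class_part_def P.alg.Der_finsum_apply[OF class_part_terms[OF D] u]
  using u D by (intro P.alg.A.finsum_cong')
    (auto simp: P.alg.cmult_apply intro!: class_sum_closed lift_closed component_derivation class_rep_closed)

lemma class_part_emb:
  assumes D: "D \<in> derivations K C" and a: "a \<in> carrier A" and h: "h \<in> carrier H"
  shows "slice (class_part D (emb a)) h = component D (class_rep h) a"
proof -
  have cl: "component D r a \<in> carrier A" if "r \<in> carrier H" for r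
    using G.alg.derivation_closed[OF component_derivation[OF D that] a] .
  have "slice (class_part D (emb a)) h =
      (\<Oplus>\<^bsub>A\<^esub>r\<in>class_rep ` carrier H. slice (class_sum r \<otimes>\<^bsub>C\<^esub> emb (component D r a)) h)"
  proof -
    have "class_part D (emb a) = (\<Oplus>\<^bsub>C\<^esub>r\<in>class_rep ` carrier H. class_sum r \<otimes>\<^bsub>C\<^esub> emb (component D r a))"
      unfolding class_part_apply[OF D emb_closed[OF a]] using a D
      by (intro P.alg.A.finsum_cong') (auto simp: lift_emb component_derivation class_rep_closed cl class_sum_closed)
    then show ?thesis using h cl by (simp, subst slice_finsum) (auto simp: class_rep_closed class_sum_closed)
  qed
  also have "\<dots> = (\<Oplus>\<^bsub>A\<^esub>r\<in>class_rep ` carrier H. if class_rep h = r then component D r a else \<zero>\<^bsub>A\<^esub>)"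
    using h cl by (intro G.alg.A.finsum_cong')
      (auto simp: slice_mult_emb class_sum_closed slice_class_sum class_rep_closed)
  also have "\<dots> = component D (class_rep h) a"
    using h cl by (intro G.alg.A.add.finprod_singleton) (auto simp: class_rep_closed)
  finally show ?thesis .
qed

lemma class_part_helt:
  assumes D: "D \<in> derivations K C" and k: "k \<in> carrier H"
  shows "class_part D (helt k) = \<zero>\<^bsub>C\<^esub>"
  unfolding class_part_apply[OF D P.gelt_closed]
  by (intro P.alg.A.add.finprod_one_eqI) (auto simp: lift_helt[OF component_derivation[OF D] k] class_rep_closed class_sum_closed)

text \<open>
  The components of \<open>D\<close> and of its class part differ by inner derivations of \<open>A\<close>; the elements that
  induce them are the coefficients of one element of \<open>C\<close>.
\<close>
lemma derivation_on_emb: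
  assumes D: "D \<in> derivations K C"
  shows "\<exists>x\<in>carrier C. \<forall>a\<in>carrier A. D (emb a) = class_part D (emb a) \<oplus>\<^bsub>C\<^esub> P.alg.inner x (emb a)"
proof -
  have "\<exists>y\<in>carrier A. \<forall>a\<in>carrier A. component D h a = component D (class_rep h) a \<oplus>\<^bsub>A\<^esub> G.alg.inner y a"
    if h: "h \<in> carrier H" for h
  proof -
    obtain k where k: "k \<in> carrier H" "class_rep h = k \<otimes>\<^bsub>H\<^esub> h \<otimes>\<^bsub>H\<^esub> inv\<^bsub>H\<^esub> k" using class_rep_conjugate[OF h] .
    have "inv\<^bsub>H\<^esub> k \<otimes>\<^bsub>H\<^esub> class_rep h \<otimes>\<^bsub>H\<^esub> inv\<^bsub>H\<^esub> (inv\<^bsub>H\<^esub> k) = h"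
    proof -
      have "inv\<^bsub>H\<^esub> k \<otimes>\<^bsub>H\<^esub> (k \<otimes>\<^bsub>H\<^esub> h) = h" using h k by (simp add: H.G.m_assoc[symmetric])
      then show ?thesis using h k by (simp add: H.G.m_assoc)
    qed
    then have "component D h a = component D (class_rep h) a \<oplus>\<^bsub>A\<^esub>
        G.alg.inner (slice (D (helt (inv\<^bsub>H\<^esub> k))) (inv\<^bsub>H\<^esub> k \<otimes>\<^bsub>H\<^esub> class_rep h)) a" if "a \<in> carrier A" for a
      using component_conjugate[OF D class_rep_closed[OF h] H.G.inv_closed[OF k(1)] that] by simp
    then show ?thesis
      using k h by (intro bexI[of _ "slice (D (helt (inv\<^bsub>H\<^esub> k))) (inv\<^bsub>H\<^esub> k \<otimes>\<^bsub>H\<^esub> class_rep h)"])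
        (auto intro!: slice_closed P.alg.derivation_closed[OF D] class_rep_closed)
  qed
  then obtain y where y: "\<And>h. h \<in> carrier H \<Longrightarrow> y h \<in> carrier A"
      "\<And>h a. \<lbrakk>h \<in> carrier H; a \<in> carrier A\<rbrakk> \<Longrightarrow> component D h a = component D (class_rep h) a \<oplus>\<^bsub>A\<^esub> G.alg.inner (y h) a"
    by metis
  have gy: "glue y \<in> carrier C" using y(1) by (rule glue_closed)
  have "D (emb a) = class_part D (emb a) \<oplus>\<^bsub>C\<^esub> P.alg.inner (glue y) (emb a)" if a: "a \<in> carrier A" for a
  proof (rule slice_eqI)
    fix h assume h: "h \<in> carrier H"
    have "slice (P.alg.inner (glue y) (emb a)) h = G.alg.inner (y h) a"
      using a h gy y(1) by (simp add: P.alg.inner_apply G.alg.inner_apply slice_minus slice_emb_mult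
        slice_mult_emb slice_glue)
    then show "slice (D (emb a)) h = slice (class_part D (emb a) \<oplus>\<^bsub>C\<^esub> P.alg.inner (glue y) (emb a)) h"
      using y(2)[OF h a] a h by (simp add: slice_add class_part_emb[OF D a h]) (simp add: component_def)
  qed (use a gy in \<open>auto intro!: P.alg.derivation_closed[OF D] P.alg.A.a_closed
      P.alg.derivation_closed[OF class_part_in_span(2)[OF D]]
      P.alg.derivation_closed[OF P.alg.inner_derivation]\<close>)
  then show ?thesis using gy by blast
qed

text \<open>
  Here the inner derivations that relate the components at conjugate elements are zero.
\<close>
lemma derivation_vanishing_on_helt:
  assumes D: "D \<in> derivations K C" and zero: "\<And>k. k \<in> carrier H \<Longrightarrow> D (helt k) = \<zero>\<^bsub>C\<^esub>"
  shows "D = class_part D"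
proof (rule derivation_determined[OF D class_part_in_span(2)[OF D]])
  fix a assume a: "a \<in> carrier A"
  show "D (emb a) = class_part D (emb a)"
  proof (rule slice_eqI)
    fix h assume h: "h \<in> carrier H"
    obtain k where k: "k \<in> carrier H" "class_rep h = k \<otimes>\<^bsub>H\<^esub> h \<otimes>\<^bsub>H\<^esub> inv\<^bsub>H\<^esub> k" using class_rep_conjugate[OF h] .
    have "component D (class_rep h) a = component D h a \<oplus>\<^bsub>A\<^esub> G.alg.inner \<zero>\<^bsub>A\<^esub> a"
      using component_conjugate[OF D h k(1) a] k h by (simp add: zero slice_zero)
    also have "\<dots> = component D h a"
      using a G.alg.derivation_closed[OF component_derivation[OF D h] a]
      by (simp add: G.alg.inner_apply G.alg.A.minus_eq)
    finally show "slice (D (emb a)) h = slice (class_part D (emb a)) h"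
      using a by (simp add: class_part_emb[OF D a h]) (simp add: component_def)
  qed (use a in \<open>auto intro!: P.alg.derivation_closed[OF D] P.alg.derivation_closed[OF class_part_in_span(2)[OF D]]\<close>)
qed (simp add: zero class_part_helt[OF D])

end

section \<open>A filtration by powers of a central ideal\<close>

context k_algebra
begin

text \<open>
  The powers of the ideal \<open>M\<close> of the centre.
\<close>
inductive central_pow :: "'a set \<Rightarrow> nat \<Rightarrow> 'a \<Rightarrow> bool" for M where
  base: "z \<in> Z \<Longrightarrow> central_pow M 0 z"
| step: "\<lbrakk>x \<in> M; central_pow M a y\<rbrakk> \<Longrightarrow> central_pow M (Suc a) (x \<otimes> y)"
| add: "\<lbrakk>central_pow M a x; central_pow M a y\<rbrakk> \<Longrightarrow> central_pow M a (x \<oplus> y)"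

text \<open>
  The space \<open>M\<^sup>a Der(A)\<close>, enlarged by the inner derivations.
\<close>
definition filtration :: "'a set \<Rightarrow> nat \<Rightarrow> ('a \<Rightarrow> 'a) set" where
  "filtration M a = module_span K D
     (InnDer A \<union> {cmult z d | z d. central_pow M a z \<and> d \<in> derivations K A})"

context
  fixes M
  assumes M_central: "M \<subseteq> Z"
    and derivation_M: "\<forall>d\<in>derivations K A. \<forall>z\<in>Z. d z \<in> M"
begin

lemma central_pow_center: "central_pow M a x \<Longrightarrow> x \<in> Z"
  by (induction rule: central_pow.induct) (use M_central in \<open>auto intro: A.center_closed\<close>)

lemma central_pow_mult:
  assumes "central_pow M a x" and y: "central_pow M b y"
  shows "central_pow M (a + b) (x \<otimes> y)"
  using assms(1)
proof (induction rule: central_pow.induct)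
  case (base z)
  show ?case using y base
  proof (induction rule: central_pow.induct)
    case (base w)
    then show ?case by (auto intro: central_pow.base A.center_closed)
  next
    case (step x a y)
    have xc: "x \<in> carrier A" using step.hyps(1) M_central A.center_carrier by auto
    have yc: "y \<in> carrier A" using step.hyps(2) central_pow_center A.center_carrier by auto
    have "z \<otimes> (x \<otimes> y) = (z \<otimes> x) \<otimes> y"
      using xc yc A.center_carrier[OF step.prems] by (simp add: A.m_assoc)
    also have "z \<otimes> x = x \<otimes> z" using A.center_comm[OF step.prems xc] by simp
    also have "x \<otimes> z \<otimes> y = x \<otimes> (z \<otimes> y)"
      using xc yc A.center_carrier[OF step.prems] by (simp add: A.m_assoc)
    finally have "z \<otimes> (x \<otimes> y) = x \<otimes> (z \<otimes> y)" .
    then show ?case using step by (auto intro: central_pow.step)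
  next
    case (add a x y)
    have "x \<in> carrier A" "y \<in> carrier A" using add.hyps central_pow_center A.center_carrier by auto
    then show ?case using add A.center_carrier[of z] by (auto simp: A.r_distr intro: central_pow.add)
  qed
next
  case (step x a z)
  have "x \<in> carrier A" "z \<in> carrier A" "y \<in> carrier A"
    using step.hyps y M_central central_pow_center A.center_carrier by auto
  then show ?case using step by (auto simp: A.m_assoc intro: central_pow.step)
next
  case (add a x z)
  have "x \<in> carrier A" "z \<in> carrier A" "y \<in> carrier A"
    using add.hyps y central_pow_center A.center_carrier by auto
  then show ?case using add by (auto simp: A.l_distr intro: central_pow.add)
qed

lemma central_pow_le: "central_pow M a x \<Longrightarrow> b \<le> a \<Longrightarrow> central_pow M b x"
proof (induction arbitrary: b rule: central_pow.induct)
  case (step x a y)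
  show ?case
  proof (cases b)
    case 0
    have "x \<otimes> y \<in> Z" using step.hyps M_central central_pow_center by (auto intro: A.center_closed)
    then show ?thesis using 0 by (simp add: central_pow.base)
  next
    case (Suc c)
    then show ?thesis using step by (auto intro: central_pow.step)
  qed
qed (auto intro: central_pow.intros)

text \<open>
  By the Leibniz rule it is enough that \<open>M\<close> itself is preserved.
\<close>
lemma central_pow_derivation:
  assumes d: "d \<in> derivations K A" and "central_pow M a x"
  shows "central_pow M a (d x)"
  using assms(2)
proof (induction rule: central_pow.induct)
  case (base z)
  then show ?case using derivation_center[OF d] by (auto intro: central_pow.base)
next
  case (step x a y)
  have xz: "x \<in> Z" and yz: "y \<in> Z" using step.hyps M_central central_pow_center by auto
  have "d (x \<otimes> y) = d x \<otimes> y \<oplus> x \<otimes> d y"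
    using xz yz A.center_carrier by (intro derivation_mult[OF d]) auto
  then show ?case
    using step derivation_M[rule_format, OF d xz] by (auto intro!: central_pow.add central_pow.step)
next
  case (add a x y)
  have "x \<in> carrier A" "y \<in> carrier A" using add.hyps central_pow_center A.center_carrier by auto
  then show ?case using add by (auto simp: derivation_add[OF d] intro: central_pow.add)
qed

lemma filtration_gens: "InnDer A \<union> {cmult z d | z d. central_pow M a z \<and> d \<in> derivations K A} \<subseteq> carrier D"
  using der.submodule_subset[OF InnDer_submodule] central_pow_center cmult_derivation by auto

lemma filtration_submodule: "submodule (filtration M a) K D"
  unfolding filtration_def by (rule der.module_span_submodule[OF filtration_gens])

lemma InnDer_filtration: "InnDer A \<subseteq> filtration M a"
  unfolding filtration_def by (intro subsetI der.module_span_base UnI1)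

lemma cmult_filtration: "\<lbrakk>central_pow M a z; d \<in> derivations K A\<rbrakk> \<Longrightarrow> cmult z d \<in> filtration M a"
  unfolding filtration_def by (rule der.module_span_base, rule UnI2) auto

lemma InnDer_bracket: "\<lbrakk>d \<in> InnDer A; e \<in> derivations K A\<rbrakk> \<Longrightarrow> d \<otimes>\<^bsub>D\<^esub> e \<in> InnDer A"
  using bracket_ideal.ideal_bracket_left[OF bracket_ideal_InnDer] by simp

text \<open>
  In the formula for \<open>[z d, w e]\<close> each of the coefficients \<open>z (d w)\<close>, \<open>w (e z)\<close> and \<open>z w\<close> lies in
  \<open>M\<^sup>a\<^sup>+\<^sup>b\<close>.
\<close>
lemma filtration_bracket:
  assumes "x \<in> filtration M a" "y \<in> filtration M b"
  shows "x \<otimes>\<^bsub>D\<^esub> y \<in> filtration M (a + b)"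
proof (rule der.module_span_bracket[OF filtration_gens filtration_gens filtration_submodule _
      assms[unfolded filtration_def]])
  fix x y
  assume x: "x \<in> InnDer A \<union> {cmult z d | z d. central_pow M a z \<and> d \<in> derivations K A}"
    and y: "y \<in> InnDer A \<union> {cmult z d | z d. central_pow M b z \<and> d \<in> derivations K A}"
  have xy: "x \<in> derivations K A" "y \<in> derivations K A"
    using subsetD[OF filtration_gens x] subsetD[OF filtration_gens y] by simp_all
  consider "x \<in> InnDer A" | "y \<in> InnDer A"
    | z d w e where "x = cmult z d" "central_pow M a z" "d \<in> derivations K A"
        "y = cmult w e" "central_pow M b w" "e \<in> derivations K A"
    using x y by auto
  then show "x \<otimes>\<^bsub>D\<^esub> y \<in> filtration M (a + b)"
  proof cases
    case 1
    then show ?thesis using InnDer_bracket xy InnDer_filtration by blast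
  next
    case 2
    then show ?thesis using bracket_InnDer xy InnDer_filtration by blast
  next
    case 3
    have "central_pow M (a + b) (z \<otimes> d w)"
      by (rule central_pow_mult[OF 3(2) central_pow_derivation[OF 3(3,5)]])
    moreover have "central_pow M (a + b) (w \<otimes> e z)"
      using central_pow_mult[OF 3(5) central_pow_derivation[OF 3(6,2)]] by (simp add: add.commute)
    moreover have "central_pow M (a + b) (z \<otimes> w)"
      by (rule central_pow_mult[OF 3(2,5)])
    ultimately have "cmult (z \<otimes> d w) e \<in> filtration M (a + b)" "cmult (w \<otimes> e z) d \<in> filtration M (a + b)"
        "cmult (z \<otimes> w) (d \<otimes>\<^bsub>D\<^esub> e) \<in> filtration M (a + b)"
      using 3 by (auto intro: cmult_filtration Der_bracket_closed)
    then show ?thesis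
      using 3 central_pow_center
      by (simp add: bracket_cmult a_minus_def der.submodule_add[OF filtration_submodule] der.submodule_neg[OF filtration_submodule])
  qed
qed

lemma filtration_le: "b \<le> a \<Longrightarrow> filtration M a \<subseteq> filtration M b"
  unfolding filtration_def[of M a]
  by (rule der.module_span_least[OF filtration_submodule])
    (use InnDer_filtration cmult_filtration central_pow_le in blast)

lemma filtration_0: "filtration M 0 = carrier D"
proof
  show "filtration M 0 \<subseteq> carrier D" by (rule der.submodule_subset[OF filtration_submodule])
  show "carrier D \<subseteq> filtration M 0"
  proof
    fix d assume d: "d \<in> carrier D"
    then have "cmult \<one> d \<in> filtration M 0"
      by (intro cmult_filtration central_pow.base A.center_closed) simp
    then show "d \<in> filtration M 0" using d cmult_simps(4)[of \<one> \<one> d "\<one>\<^bsub>K\<^esub>"] by (simp add: A.center_closed)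
  qed
qed

lemma filtration_steps: "(lie_step K D)\<^sup>*\<^sup>* (filtration M 1) (filtration M (Suc k))"
proof (induction k)
  case (Suc k)
  have "x \<otimes>\<^bsub>D\<^esub> y \<in> filtration M (Suc (Suc k))" if "x \<in> filtration M (Suc k)" "y \<in> filtration M (Suc k)" for x y
    using filtration_bracket[OF that] filtration_le[of "Suc (Suc k)" "Suc k + Suc k"] by auto
  then have "lie_step K D (filtration M (Suc k)) (filtration M (Suc (Suc k)))"
    by (simp add: lie_step_def filtration_submodule)
  then show ?case using Suc by (rule rtranclp.rtrancl_into_rtrancl[rotated])
qed simp

text \<open>
  By induction on \<open>a\<close>, an element of \<open>M\<^sup>a\<close> is killed by all products of \<open>n - a\<close> elements of \<open>I\<close>.
\<close>
lemma central_pow_nilpotent: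
  assumes MI: "M \<subseteq> I" and I: "I \<subseteq> carrier A" and nil: "A.nil_set I n" and x: "central_pow M n x"
  shows "x = \<zero>"
proof -
  have "A.lprod ys \<otimes> x = \<zero>" if "central_pow M a x" "set ys \<subseteq> I" "length ys + a = n" for a ys x
    using that
  proof (induction arbitrary: ys rule: central_pow.induct)
    case (base z)
    then show ?case using nil A.center_carrier[of z] by (simp add: A.nil_set_def)
  next
    case (step x a y)
    have cl: "x \<in> carrier A" "y \<in> carrier A" "A.lprod ys \<in> carrier A"
      using step M_central central_pow_center A.center_carrier I by (auto intro!: A.lprod_closed)
    have "A.lprod (ys @ [x]) \<otimes> y = \<zero>" using step MI by (intro step.IH) auto
    then show ?case using cl by (simp add: A.lprod_snoc A.m_assoc)
  next
    case (add a x y)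
    have cl: "x \<in> carrier A" "y \<in> carrier A" "A.lprod ys \<in> carrier A"
      using add central_pow_center A.center_carrier I by (auto intro!: A.lprod_closed)
    then show ?case using add by (simp add: A.r_distr)
  qed
  from this[OF x, of "[]"] show ?thesis using A.center_carrier[OF central_pow_center[OF x]] by simp
qed

lemma filtration_nilpotent:
  assumes "M \<subseteq> I" "I \<subseteq> carrier A" "A.nil_set I n"
  shows "filtration M n \<subseteq> InnDer A"
  unfolding filtration_def
proof (rule der.module_span_least[OF InnDer_submodule], intro Un_least subsetI)
  fix x assume "x \<in> {cmult z d | z d. central_pow M n z \<and> d \<in> derivations K A}"
  then obtain z d where x: "x = cmult z d" "central_pow M n z" "d \<in> derivations K A" by auto
  have "z = \<zero>" using central_pow_nilpotent[OF assms x(2)] .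
  then have "x = \<zero>\<^bsub>D\<^esub>"
    unfolding x(1) using x(3) by (intro derivation_eqI)
      (simp_all add: cmult_derivation A.center_closed Der_zero_closed cmult_apply Der_apply derivation_closed[OF x(3)])
  then show "x \<in> InnDer A" using der.submodule_zero[OF InnDer_submodule] by simp
qed simp

lemma filtration_solvable:
  assumes "M \<subseteq> I" "I \<subseteq> carrier A" "A.nil_set I n"
  shows "\<exists>Y. (lie_step K D)\<^sup>*\<^sup>* (filtration M 1) Y \<and> Y \<subseteq> InnDer A"
proof (intro exI conjI)
  show "(lie_step K D)\<^sup>*\<^sup>* (filtration M 1) (filtration M (Suc n))" by (rule filtration_steps)
  show "filtration M (Suc n) \<subseteq> InnDer A"
    using filtration_le[of n "Suc n"] filtration_nilpotent[OF assms] by (rule order_trans) simp_all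
qed

end

end

section \<open>Solvability for a direct product\<close>

context product_group_algebra
begin

text \<open>
  Pull a chain back along \<open>d \<mapsto> d \<otimes> 1\<close>.
\<close>
theorem solvable_factor:
  assumes "solvable_modulo K (Der K C) (InnDer C)"
  shows "solvable_modulo K (Der K A) (InnDer A)"
proof -
  obtain Y where Y: "(lie_step K (Der K C))\<^sup>*\<^sup>* (carrier (Der K C)) Y" "Y \<subseteq> InnDer C"
    using assms by (auto simp: solvable_modulo_def)
  define R where "R T = {d \<in> derivations K A. lift d \<in> T}" for T
  have R_sub: "submodule (R T) K (Der K A)" if T: "submodule T K (Der K C)" for T
    unfolding R_def
    by (rule G.alg.der.submoduleI')
      (auto simp: G.alg.Der_zero_closed G.alg.Der_add_closed G.alg.Der_smult_closed lift_zero lift_add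
        lift_smult P.alg.der.submodule_zero[OF T] P.alg.der.submodule_add[OF T] P.alg.der.submodule_smult[OF T])
  have "(lie_step K (Der K A))\<^sup>*\<^sup>* (carrier (Der K A)) (R Y)"
    using Y(1)
  proof (induction rule: rtranclp_induct)
    case base
    have "R (carrier (Der K C)) = carrier (Der K A)" by (auto simp: R_def lift_derivation)
    then show ?case by simp
  next
    case (step S T)
    have "lie_step K (Der K A) (R S) (R T)"
      using step.hyps(2) R_sub unfolding lie_step_def
      by (auto simp: R_def lift_bracket G.alg.Der_bracket_closed)
    then show ?case using step.IH by simp
  qed
  moreover have "R Y \<subseteq> InnDer A"
  proof
    fix d assume d: "d \<in> R Y"
    then obtain x where "x \<in> carrier C" "lift d = P.alg.inner x"
      using Y(2) by (auto simp: R_def P.alg.InnDer_eq)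
    then have "d = G.alg.inner (slice x \<one>\<^bsub>H\<^esub>)" "slice x \<one>\<^bsub>H\<^esub> \<in> carrier A"
      using d inner_of_lift_inner by (auto simp: R_def slice_closed)
    then show "d \<in> InnDer A" by (auto simp: G.alg.InnDer_eq)
  qed
  ultimately show ?thesis unfolding solvable_modulo_def by blast
qed

lemma helt_swap_emb:
  assumes "h \<in> carrier H"
  shows "helt h = product_group_algebra.emb H G P K (\<lambda>h g. m g h) (H.gelt h)"
proof -
  interpret sw: product_group_algebra H G P K "\<lambda>h g. m g h" by (rule swap)
  have "sw.emb (H.gelt h) \<otimes>\<^bsub>C\<^esub> P.gelt (m \<one>\<^bsub>G\<^esub> \<one>\<^bsub>H\<^esub>) = helt h"
    using sw.emb_gelt_helt[OF assms G.G.one_closed] by simp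
  then show ?thesis by (simp add: m_one P.gelt_one)
qed

text \<open>
  Subtracting the class part with respect to \<open>B\<close> and an inner derivation from \<open>D\<close> gives a derivation
  that vanishes on \<open>B\<close>; such a derivation equals its class part with respect to \<open>A\<close>.
\<close>
theorem derivation_decomposition:
  assumes D: "D \<in> derivations K C"
  shows "D \<in> module_span K (Der K C)
    (InnDer C \<union> multiples \<union> product_group_algebra.multiples H G P K (\<lambda>h g. m g h))"
proof -
  interpret sw: product_group_algebra H G P K "\<lambda>h g. m g h" by (rule swap)
  let ?gen = "InnDer C \<union> multiples \<union> sw.multiples"
  let ?S = "module_span K (Der K C) ?gen"
  have gen: "?gen \<subseteq> carrier (Der K C)"
    using P.alg.der.submodule_subset[OF P.alg.InnDer_submodule] multiples_closed sw.multiples_closed by auto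
  have S: "submodule ?S K (Der K C)" by (rule P.alg.der.module_span_submodule[OF gen])
  have sub: "module_span K (Der K C) X \<subseteq> ?S" if "X \<subseteq> ?gen" for X
    by (intro P.alg.der.module_span_least[OF S] subsetI P.alg.der.module_span_base subsetD[OF that])
  obtain x where x: "x \<in> carrier C"
    "\<And>b. b \<in> carrier B \<Longrightarrow> D (sw.emb b) = sw.class_part D (sw.emb b) \<oplus>\<^bsub>C\<^esub> P.alg.inner x (sw.emb b)"
    using sw.derivation_on_emb[OF D] by blast
  \<comment> \<open>\<open>E\<close> agrees with \<open>D\<close> on the second factor.\<close>
  define E where "E = sw.class_part D \<oplus>\<^bsub>Der K C\<^esub> P.alg.inner x"
  have E_S: "E \<in> ?S"
    unfolding E_def
  proof (rule P.alg.der.submodule_add[OF S])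
    show "sw.class_part D \<in> ?S" using sw.class_part_in_span(1)[OF D] sub[of sw.multiples] by blast
    show "P.alg.inner x \<in> ?S" 
      using x(1) by (intro P.alg.der.module_span_base UnI1) (simp add: P.alg.InnDer_eq)
  qed
  have E: "E \<in> derivations K C" using E_S P.alg.der.submodule_subset[OF S] by auto
  define F where "F = D \<ominus>\<^bsub>Der K C\<^esub> E"
  have F: "F \<in> derivations K C"
    using P.alg.der.M.minus_closed D E by (simp add: F_def)
  have "F (helt k) = \<zero>\<^bsub>C\<^esub>" if k: "k \<in> carrier H" for k
  proof -
    have "D (helt k) = E (helt k)"
      unfolding helt_swap_emb[OF k] E_def by (subst x(2)) (simp_all add: P.alg.Der_apply)
    then show ?thesis
      using P.alg.derivation_closed[OF E] by (simp add: F_def P.alg.Der_minus_apply D E P.alg.A.minus_eq P.alg.A.r_neg)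
  qed
  then have "F \<in> ?S"
    using derivation_vanishing_on_helt[OF F] class_part_in_span(1)[OF F] sub[of multiples] by auto
  moreover have "D = F \<oplus>\<^bsub>Der K C\<^esub> E"
  proof -
    have "D \<in> carrier (Der K C)" "E \<in> carrier (Der K C)" using D E by simp_all
    then show ?thesis
      by (simp add: F_def P.alg.der.M.minus_eq P.alg.der.M.a_assoc P.alg.der.M.l_neg del: P.alg.Der_carrier)
  qed
  ultimately show ?thesis using E_S P.alg.der.submodule_add[OF S] by metis
qed

lemma aug_lift_central:
  assumes augA: "\<And>d z. \<lbrakk>d \<in> derivations K A; z \<in> ring_center A\<rbrakk> \<Longrightarrow> G.aug (d z) = \<zero>\<^bsub>K\<^esub>"
    and d: "d \<in> derivations K A" and z: "z \<in> ring_center C"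
  shows "P.aug (lift d z) = \<zero>\<^bsub>K\<^esub>"
proof -
  note zc = P.alg.A.center_carrier[OF z]
  have "P.aug (lift d z) = (\<Oplus>\<^bsub>K\<^esub>h\<in>carrier H. G.aug (d (slice z h)))"
    unfolding aug_slice[OF lift_closed[OF d zc]]
    using zc d G.alg.derivation_closed[OF d] by (intro G.K.finsum_cong') (simp_all add: slice_lift slice_closed)
  also have "\<dots> = \<zero>\<^bsub>K\<^esub>"
    using augA[OF d slice_center[OF z]] by (intro G.K.add.finprod_one_eqI) simp
  finally show ?thesis .
qed

text \<open>
  Each of \<open>d \<otimes> 1\<close> and \<open>1 \<otimes> e\<close> preserves one of the two subalgebras and kills the other one, so the
  bracket vanishes on both, and these generate \<open>C\<close>.
\<close>
lemma bracket_lift_swap_lift: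
  assumes d: "d \<in> derivations K A" and e: "e \<in> derivations K B"
  shows "lift d \<otimes>\<^bsub>Der K C\<^esub> product_group_algebra.lift H G P K (\<lambda>h g. m g h) e = \<zero>\<^bsub>Der K C\<^esub>"
proof -
  interpret sw: product_group_algebra H G P K "\<lambda>h g. m g h" by (rule swap)
  note der = lift_derivation[OF d] sw.lift_derivation[OF e]
  note zero = P.alg.derivation_zero[OF der(1)] P.alg.derivation_zero[OF der(2)]
  have kill: "sw.lift e (emb a) = \<zero>\<^bsub>C\<^esub>" if "a \<in> carrier A" for a
    using that
  proof (induction a rule: G.A_induct)
    case (gelt c x)
    have "emb (G.gelt x) = sw.helt x"
      using sw.helt_swap_emb[OF gelt(2)] by simp
    then show ?case
      using gelt sw.lift_helt[OF e gelt(2)] by (simp add: emb_smult P.alg.derivation_smult[OF der(2)])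
  next
    case zero
    have "emb \<zero>\<^bsub>A\<^esub> = \<zero>\<^bsub>C\<^esub>" by (rule slice_eqI) (auto simp: slice_emb slice_zero)
    then show ?case by (simp add: P.alg.derivation_zero[OF der(2)])
  qed (simp add: emb_add P.alg.derivation_add[OF der(2)])
  have kill': "lift d (sw.emb b) = \<zero>\<^bsub>C\<^esub>" if "b \<in> carrier B" for b
    using that
  proof (induction b rule: H.A_induct)
    case (gelt c x)
    then show ?case
      using lift_helt[OF d gelt(2)] by (simp add: helt_swap_emb sw.emb_smult P.alg.derivation_smult[OF der(1)])
  next
    case zero
    have "sw.emb \<zero>\<^bsub>B\<^esub> = \<zero>\<^bsub>C\<^esub>" by (rule sw.slice_eqI) (auto simp: sw.slice_emb sw.slice_zero)
    then show ?case by (simp add: P.alg.derivation_zero[OF der(1)])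
  qed (simp add: sw.emb_add P.alg.derivation_add[OF der(1)])
  show ?thesis
  proof (rule derivation_determined)
    show "lift d \<otimes>\<^bsub>Der K C\<^esub> sw.lift e \<in> derivations K C" using der by (rule P.alg.Der_bracket_closed)
    show "(lift d \<otimes>\<^bsub>Der K C\<^esub> sw.lift e) (emb a) = \<zero>\<^bsub>Der K C\<^esub> (emb a)" if a: "a \<in> carrier A" for a
      using a d G.alg.derivation_closed[OF d a] kill
      by (simp add: P.alg.Der_apply lift_emb zero P.alg.A.minus_eq)
    show "(lift d \<otimes>\<^bsub>Der K C\<^esub> sw.lift e) (helt k) = \<zero>\<^bsub>Der K C\<^esub> (helt k)" if k: "k \<in> carrier H" for k
      using k e H.alg.derivation_closed[OF e] kill' d
      by (simp add: P.alg.Der_apply lift_helt zero P.alg.A.minus_eq)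
       (simp add: helt_swap_emb sw.lift_emb P.alg.A.minus_eq)
  qed (rule P.alg.Der_zero_closed)
qed

text \<open>
  A chain in \<open>Der(A)\<close> gives one in \<open>Der(C)\<close>, in the presence of a subalgebra \<open>N\<close> that is stable under
  \<open>Der(A)\<close>.
\<close>
lemma lie_steps_lift:
  assumes XY: "(lie_step K (Der K A))\<^sup>*\<^sup>* X Y" and X: "submodule X K (Der K A)"
    and N: "submodule N K (Der K C)"
    and NN: "\<And>x y. \<lbrakk>x \<in> N; y \<in> N\<rbrakk> \<Longrightarrow> x \<otimes>\<^bsub>Der K C\<^esub> y \<in> N"
    and lift_N: "\<And>d x. \<lbrakk>d \<in> derivations K A; x \<in> N\<rbrakk> \<Longrightarrow> lift d \<otimes>\<^bsub>Der K C\<^esub> x \<in> N"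
  shows "(lie_step K (Der K C))\<^sup>*\<^sup>* (module_span K (Der K C) (lift ` X \<union> N))
    (module_span K (Der K C) (lift ` Y \<union> N))"
  using XY
proof (induction rule: rtranclp_induct)
  case (step S T)
  let ?span = "\<lambda>X. module_span K (Der K C) (lift ` X \<union> N)"
  have ST: "submodule S K (Der K A)" "submodule T K (Der K A)"
    and br: "\<And>x y. \<lbrakk>x \<in> S; y \<in> S\<rbrakk> \<Longrightarrow> x \<otimes>\<^bsub>Der K A\<^esub> y \<in> T"
    using step.hyps(2) by (auto simp: lie_step_def)
  have gen: "lift ` X \<union> N \<subseteq> carrier (Der K C)" if "submodule X K (Der K A)" for X
    using G.alg.der.submodule_subset[OF that] P.alg.der.submodule_subset[OF N] lift_derivation by auto
  have sub: "submodule (?span X) K (Der K C)" if "submodule X K (Der K A)" for X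
    by (rule P.alg.der.module_span_submodule[OF gen[OF that]])
  have S_der: "S \<subseteq> derivations K A" and N_der: "N \<subseteq> derivations K C"
    using G.alg.der.submodule_subset[OF ST(1)] P.alg.der.submodule_subset[OF N] by auto
  have "x \<otimes>\<^bsub>Der K C\<^esub> y \<in> ?span T" if "x \<in> ?span S" "y \<in> ?span S" for x y
  proof (rule P.alg.der.module_span_bracket[OF gen[OF ST(1)] gen[OF ST(1)] sub[OF ST(2)] _ that])
    fix x y assume x: "x \<in> lift ` S \<union> N" and y: "y \<in> lift ` S \<union> N"
    have "x \<otimes>\<^bsub>Der K C\<^esub> y \<in> lift ` T \<union> N"
    proof (cases "x \<in> N")
      case True
      show ?thesis
      proof (cases "y \<in> N")
        case False
        then obtain e where e: "e \<in> S" "y = lift e" using y by auto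
        then have "\<ominus>\<^bsub>Der K C\<^esub> (y \<otimes>\<^bsub>Der K C\<^esub> x) \<in> N"
          using True S_der lift_N by (intro P.alg.der.submodule_neg[OF N]) auto
        moreover have "x \<in> derivations K C" "y \<in> derivations K C"
          using True e S_der N_der lift_derivation by auto
        ultimately show ?thesis using P.alg.der.bracket_skew[of x y] by simp
      qed (use True NN in auto)
    next
      case False
      then obtain d where d: "d \<in> S" "x = lift d" using x by auto
      show ?thesis
      proof (cases "y \<in> N")
        case False
        then obtain e where e: "e \<in> S" "y = lift e" using y by auto
        then have "x \<otimes>\<^bsub>Der K C\<^esub> y = lift (d \<otimes>\<^bsub>Der K A\<^esub> e)" 
          using d(2) lift_bracket[OF subsetD[OF S_der d(1)] subsetD[OF S_der e(1)]] by simp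
        then show ?thesis using br d e by auto
      qed (use d lift_N S_der in auto)
    qed
    then show "x \<otimes>\<^bsub>Der K C\<^esub> y \<in> ?span T" by (rule P.alg.der.module_span_base)
  qed
  then have "lie_step K (Der K C) (?span S) (?span T)" using sub ST by (simp add: lie_step_def)
  then show ?case using step.IH by simp
qed simp

text \<open>
  The chain for \<open>C\<close> has three parts. Starting from \<open>Der(C)\<close>, which is spanned by \<open>Der(A) \<otimes> 1\<close>,
  \<open>1 \<otimes> Der(B)\<close> and \<open>V = M Der(C) + InnDer(C)\<close>, a chain for \<open>A\<close> removes the first summand, a chain
  for \<open>B\<close> removes the second one, and the powers of \<open>M\<close> lead from \<open>V\<close> to the inner derivations.
\<close>
theorem solvable_product:
  assumes solvA: "solvable_modulo K (Der K A) (InnDer A)" and solvB: "solvable_modulo K (Der K B) (InnDer B)"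
    and augA: "\<And>d z. \<lbrakk>d \<in> derivations K A; z \<in> ring_center A\<rbrakk> \<Longrightarrow> G.aug (d z) = \<zero>\<^bsub>K\<^esub>"
    and augB: "\<And>d z. \<lbrakk>d \<in> derivations K B; z \<in> ring_center B\<rbrakk> \<Longrightarrow> H.aug (d z) = \<zero>\<^bsub>K\<^esub>"
    and nil: "P.alg.A.nil_set {u \<in> carrier C. P.aug u = \<zero>\<^bsub>K\<^esub>} n"
  shows "solvable_modulo K (Der K C) (InnDer C)"
proof -
  interpret sw: product_group_algebra H G P K "\<lambda>h g. m g h" by (rule swap)
  let ?DC = "Der K C"
  define M where "M = {z \<in> ring_center C. P.aug z = \<zero>\<^bsub>K\<^esub>}"
  have gen: "InnDer C \<union> multiples \<union> sw.multiples \<subseteq> carrier ?DC"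
    using P.alg.der.submodule_subset[OF P.alg.InnDer_submodule] multiples_closed sw.multiples_closed by auto
  have aug_lift: "P.aug (lift d z) = \<zero>\<^bsub>K\<^esub>"
    if "d \<in> derivations K A" "z \<in> ring_center C" for d z
    by (rule aug_lift_central[OF _ that]) (rule augA)
  have aug_lift': "P.aug (sw.lift e z) = \<zero>\<^bsub>K\<^esub>"
    if "e \<in> derivations K B" "z \<in> ring_center C" for e z
    by (rule sw.aug_lift_central[OF _ that]) (rule augB)
  have "D z \<in> M" if D: "D \<in> derivations K C" and z: "z \<in> ring_center C" for D z
  proof -
    define W where "W = {D \<in> derivations K C. P.aug (D z) = \<zero>\<^bsub>K\<^esub>}"
    note zc = P.alg.A.center_carrier[OF z]
    have W: "submodule W K ?DC"
      unfolding W_def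
      by (rule P.alg.der.submoduleI')
        (use zc in \<open>auto simp: P.alg.Der_zero_closed P.alg.Der_add_closed P.alg.Der_smult_closed P.alg.Der_apply
          P.aug_zero P.aug_add P.aug_smult P.alg.derivation_closed\<close>)
    have "InnDer C \<union> multiples \<union> sw.multiples \<subseteq> W"
    proof
      fix D assume "D \<in> InnDer C \<union> multiples \<union> sw.multiples"
      then consider x where "x \<in> carrier C" "D = P.alg.inner x"
        | w d where "w \<in> ring_center C" "d \<in> derivations K A" "D = P.alg.cmult w (lift d)"
        | w e where "w \<in> ring_center C" "e \<in> derivations K B" "D = P.alg.cmult w (sw.lift e)"
        by (auto simp: P.alg.InnDer_eq multiples_def sw.multiples_def)
      then show "D \<in> W"
      proof cases
        case 1
        then show ?thesis using z by (simp add: W_def P.alg.inner_derivation P.alg.inner_center P.aug_zero)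
      next
        case 2
        then show ?thesis using zc z
          by (simp add: W_def P.alg.cmult_derivation lift_derivation P.alg.cmult_apply P.aug_mult
            P.alg.A.center_carrier lift_closed aug_lift)
      next
        case 3
        then show ?thesis using zc z
          by (simp add: W_def P.alg.cmult_derivation sw.lift_derivation P.alg.cmult_apply P.aug_mult
            P.alg.A.center_carrier sw.lift_closed aug_lift')
      qed
    qed
    then have "D \<in> W" using P.alg.der.module_span_least[OF W] derivation_decomposition[OF D] by blast
    then show ?thesis using P.alg.derivation_center[OF D z] by (simp add: W_def M_def)
  qed
  then have derM: "\<forall>D\<in>derivations K C. \<forall>z\<in>ring_center C. D z \<in> M" by blast
  have MZ: "M \<subseteq> ring_center C" by (auto simp: M_def)
  define V where "V = P.alg.filtration M 1"
  have V: "submodule V K ?DC" unfolding V_def by (rule P.alg.filtration_submodule[OF MZ derM])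
  have V_der: "V \<subseteq> derivations K C" using P.alg.der.submodule_subset[OF V] by simp
  have Inn_V: "InnDer C \<subseteq> V" unfolding V_def by (rule P.alg.InnDer_filtration[OF MZ derM])
  have V_bracket: "D \<otimes>\<^bsub>?DC\<^esub> x \<in> V" if "D \<in> derivations K C" "x \<in> V" for D x
    using P.alg.filtration_bracket[OF MZ derM, of D 0 x 1] that P.alg.filtration_0[OF MZ derM] by (simp add: V_def)
  define N where "N = module_span K ?DC (sw.lift ` derivations K B \<union> V)"
  have genN: "sw.lift ` derivations K B \<union> V \<subseteq> carrier ?DC"
    using V_der sw.lift_derivation by auto
  have N: "submodule N K ?DC" unfolding N_def by (rule P.alg.der.module_span_submodule[OF genN])
  have VN: "V \<subseteq> N" unfolding N_def by (intro subsetI P.alg.der.module_span_base UnI2)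
  have NN: "x \<otimes>\<^bsub>?DC\<^esub> y \<in> N" if "x \<in> N" "y \<in> N" for x y
  proof (rule P.alg.der.module_span_bracket[OF genN genN N _ that[unfolded N_def]])
    fix x y assume x: "x \<in> sw.lift ` derivations K B \<union> V" and y: "y \<in> sw.lift ` derivations K B \<union> V"
    have xy: "x \<in> derivations K C" "y \<in> derivations K C" using x y genN by auto
    show "x \<otimes>\<^bsub>?DC\<^esub> y \<in> N"
    proof (cases "y \<in> V")
      case True
      then show ?thesis using V_bracket xy VN by blast
    next
      case y_lift: False
      show ?thesis
      proof (cases "x \<in> V")
        case True
        then have "\<ominus>\<^bsub>?DC\<^esub> (y \<otimes>\<^bsub>?DC\<^esub> x) \<in> N"
          using V_bracket xy VN by (intro P.alg.der.submodule_neg[OF N]) auto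
        then show ?thesis using P.alg.der.bracket_skew[of x y] xy by simp
      next
        case False
        then obtain d e where "d \<in> derivations K B" "e \<in> derivations K B" "x = sw.lift d" "y = sw.lift e"
          using x y y_lift by auto
        then have "x \<otimes>\<^bsub>?DC\<^esub> y \<in> sw.lift ` derivations K B"
          using H.alg.Der_bracket_closed by (auto simp: sw.lift_bracket[symmetric])
        then show ?thesis unfolding N_def by (intro P.alg.der.module_span_base UnI1)
      qed
    qed
  qed
  have lift_N: "lift d \<otimes>\<^bsub>?DC\<^esub> x \<in> N" if d: "d \<in> derivations K A" and x: "x \<in> N" for d x
  proof -
    have "lift d \<in> module_span K ?DC {lift d}" by (rule P.alg.der.module_span_base) simp
    then show ?thesis
    proof (rule P.alg.der.module_span_bracket[OF _ genN N _ _ x[unfolded N_def], rotated 2])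
      show "{lift d} \<subseteq> carrier ?DC" using lift_derivation[OF d] by simp
      fix x y assume "x \<in> {lift d}" "y \<in> sw.lift ` derivations K B \<union> V"
      then show "x \<otimes>\<^bsub>?DC\<^esub> y \<in> N"
        using bracket_lift_swap_lift[OF d] P.alg.der.submodule_zero[OF N] V_bracket lift_derivation[OF d] VN
        by auto
    qed
  qed
  obtain YA where YA: "(lie_step K (Der K A))\<^sup>*\<^sup>* (carrier (Der K A)) YA" "YA \<subseteq> InnDer A"
    using solvA by (auto simp: solvable_modulo_def)
  obtain YB where YB: "(lie_step K (Der K B))\<^sup>*\<^sup>* (carrier (Der K B)) YB" "YB \<subseteq> InnDer B"
    using solvB by (auto simp: solvable_modulo_def)
  have 1: "(lie_step K ?DC)\<^sup>*\<^sup>* (module_span K ?DC (lift ` derivations K A \<union> N)) N"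
  proof -
    have "lift ` YA \<subseteq> InnDer C"
      using YA(2) by (auto simp: G.alg.InnDer_eq P.alg.InnDer_eq lift_inner)
    then have "module_span K ?DC (lift ` YA \<union> N) = N"
      using Inn_V VN by (intro P.alg.der.module_span_absorb[OF N]) auto
    then show ?thesis
      using lie_steps_lift[OF YA(1) G.alg.der.carrier_is_submodule N NN lift_N] by simp
  qed
  have 2: "(lie_step K ?DC)\<^sup>*\<^sup>* N V"
  proof -
    have "sw.lift ` YB \<subseteq> InnDer C"
      using YB(2) by (auto simp: H.alg.InnDer_eq P.alg.InnDer_eq sw.lift_inner)
    then have "module_span K ?DC (sw.lift ` YB \<union> V) = V"
      using Inn_V by (intro P.alg.der.module_span_absorb[OF V]) auto
    moreover have "x \<otimes>\<^bsub>?DC\<^esub> y \<in> V" if "x \<in> V" "y \<in> V" for x y using that V_bracket V_der by blast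
    ultimately show ?thesis
      using sw.lie_steps_lift[OF YB(1) H.alg.der.carrier_is_submodule V] V_bracket sw.lift_derivation
      by (simp add: N_def)
  qed
  obtain Y where Y: "(lie_step K ?DC)\<^sup>*\<^sup>* V Y" "Y \<subseteq> InnDer C"
    using P.alg.filtration_solvable[OF MZ derM _ _ nil] unfolding V_def M_def
    by (force dest: P.alg.A.center_carrier)
  have all: "module_span K ?DC (lift ` derivations K A \<union> N) = carrier ?DC" (is "?T = _")
  proof
    have genT: "lift ` derivations K A \<union> N \<subseteq> carrier ?DC"
      using lift_derivation P.alg.der.submodule_subset[OF N] by auto
    have T: "submodule ?T K ?DC" by (rule P.alg.der.module_span_submodule[OF genT])
    then show "?T \<subseteq> carrier ?DC" by (rule P.alg.der.submodule_subset)
    have NT: "N \<subseteq> ?T" by (intro subsetI P.alg.der.module_span_base UnI2)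
    \<comment> \<open>Modulo \<open>M\<close>, a central coefficient is the scalar given by its augmentation.\<close>
    have split: "P.alg.cmult z D \<in> ?T" if z: "z \<in> ring_center C" and D: "D \<in> derivations K C" "D \<in> ?T" for z D
    proof -
      note zc = P.alg.A.center_carrier[OF z]
      let ?c = "P.aug z"
      have c: "?c \<in> carrier K" using zc by simp
      define w where "w = z \<ominus>\<^bsub>C\<^esub> ?c \<odot>\<^bsub>C\<^esub> \<one>\<^bsub>C\<^esub>"
      have w: "w \<in> ring_center C"
        unfolding w_def using z c by (intro P.alg.A.center_closed P.alg.center_smult)
      have "w \<in> M" using w zc c
        by (simp add: M_def w_def P.aug_minus P.aug_smult P.aug_one G.K.minus_eq G.K.r_neg)
      then have "P.alg.central_pow M (Suc 0) (w \<otimes>\<^bsub>C\<^esub> \<one>\<^bsub>C\<^esub>)"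
        by (intro P.alg.central_pow.step P.alg.central_pow.base P.alg.A.center_closed)
      then have "P.alg.cmult w D \<in> V"
        using P.alg.cmult_filtration[OF MZ derM, of 1 w D] D P.alg.A.center_carrier[OF w] by (simp add: V_def)
      then have "P.alg.cmult w D \<in> ?T" using VN NT by auto
      moreover have "?c \<odot>\<^bsub>?DC\<^esub> D \<in> ?T" using c D(2) by (rule P.alg.der.submodule_smult[OF T])
      moreover have "P.alg.cmult z D = P.alg.cmult w D \<oplus>\<^bsub>?DC\<^esub> ?c \<odot>\<^bsub>?DC\<^esub> D"
      proof (rule P.alg.derivation_eqI)
        fix u assume u: "u \<in> carrier C"
        have "z = w \<oplus>\<^bsub>C\<^esub> ?c \<odot>\<^bsub>C\<^esub> \<one>\<^bsub>C\<^esub>"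
          using zc c by (simp add: w_def P.alg.A.minus_eq P.alg.A.a_assoc P.alg.A.l_neg)
        then have "z \<otimes>\<^bsub>C\<^esub> D u = (w \<oplus>\<^bsub>C\<^esub> ?c \<odot>\<^bsub>C\<^esub> \<one>\<^bsub>C\<^esub>) \<otimes>\<^bsub>C\<^esub> D u" by (rule arg_cong)
        also have "\<dots> = w \<otimes>\<^bsub>C\<^esub> D u \<oplus>\<^bsub>C\<^esub> ?c \<odot>\<^bsub>C\<^esub> D u"
          using c P.alg.A.center_carrier[OF w] P.alg.derivation_closed[OF D(1) u]
          by (simp add: P.alg.A.l_distr P.alg.smult_mult_left)
        finally show "P.alg.cmult z D u = (P.alg.cmult w D \<oplus>\<^bsub>?DC\<^esub> ?c \<odot>\<^bsub>?DC\<^esub> D) u"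
          using u by (simp add: P.alg.cmult_apply P.alg.Der_apply)
      qed (use z w c D in \<open>simp_all add: P.alg.cmult_derivation P.alg.Der_add_closed P.alg.Der_smult_closed\<close>)
      ultimately show ?thesis using P.alg.der.submodule_add[OF T] by simp
    qed
    have "InnDer C \<union> multiples \<union> sw.multiples \<subseteq> ?T"
    proof (intro Un_least)
      show "InnDer C \<subseteq> ?T" using Inn_V VN NT by blast
      have lift_T: "lift d \<in> ?T" if "d \<in> derivations K A" for d
        using that by (intro P.alg.der.module_span_base UnI1 imageI)
      show "multiples \<subseteq> ?T" using split lift_derivation lift_T by (auto simp: multiples_def)
      have lift_T': "sw.lift e \<in> ?T" if "e \<in> derivations K B" for e
        using that unfolding N_def[symmetric]
        by (intro subsetD[OF NT]) (simp add: N_def P.alg.der.module_span_base)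
      show "sw.multiples \<subseteq> ?T" using split sw.lift_derivation lift_T' by (auto simp: sw.multiples_def)
    qed
    from P.alg.der.module_span_least[OF T this] show "carrier ?DC \<subseteq> ?T"
      using derivation_decomposition by auto
  qed
  have "(lie_step K ?DC)\<^sup>*\<^sup>* (carrier ?DC) Y"
    using 1 2 Y(1) unfolding all by (meson rtranclp_trans)
  then show ?thesis using Y(2) unfolding solvable_modulo_def by blast
qed

end

theorem corollary1p4:
  fixes p :: nat
    and K :: "('k, 'm) ring_scheme"
    and P1 :: "('a, 'n1) monoid_scheme"
    and P2 :: "('b, 'n2) monoid_scheme"
  assumes "prime p" and "p \<noteq> 2"
    and "field K" and "ring_characteristic K = p"
    and "finite_p_group p P1" and "finite_p_group p P2"
  shows "lie_solvable K (HH1 K (group_algebra K (P1 \<times>\<times> P2))) \<longleftrightarrow>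
         lie_solvable K (HH1 K (group_algebra K P1)) \<and>
         lie_solvable K (HH1 K (group_algebra K P2))"
proof -
  interpret K: field K by fact
  obtain n1 n2 where P1: "group P1" "finite (carrier P1)" "order P1 = p ^ n1"
    and P2: "group P2" "finite (carrier P2)" "order P2 = p ^ n2"
    using assms(5,6) by (auto simp: finite_p_group_def)
  have char: "[p] \<cdot>\<^bsub>K\<^esub> \<one>\<^bsub>K\<^esub> = \<zero>\<^bsub>K\<^esub>"
  proof -
    have "\<exists>n::nat. 0 < n \<and> [n] \<cdot>\<^bsub>K\<^esub> \<one>\<^bsub>K\<^esub> = \<zero>\<^bsub>K\<^esub>" and
      "p = (LEAST n::nat. 0 < n \<and> [n] \<cdot>\<^bsub>K\<^esub> \<one>\<^bsub>K\<^esub> = \<zero>\<^bsub>K\<^esub>)"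
      using assms(1,4) unfolding ring_characteristic_def by (auto split: if_splits)
    then show ?thesis using LeastI_ex by (metis (mono_tags, lifting))
  qed
  have "modular_group_algebra P1 K p n1" "modular_group_algebra P2 K p n2"
    "modular_group_algebra (P1 \<times>\<times> P2) K p (n1 + n2)"
    using P1 P2 assms(1) char K.cring_axioms DirProd_group[OF P1(1) P2(1)]
    by (simp_all add: modular_group_algebra_def modular_group_algebra_axioms_def finite_group_algebra_def
      finite_group_algebra_axioms_def order_def card_cartesian_product power_add)
  then interpret A: modular_group_algebra P1 K p n1 + B: modular_group_algebra P2 K p n2
    + C: modular_group_algebra "P1 \<times>\<times> P2" K p "n1 + n2" .
  interpret prod: product_group_algebra P1 P2 "P1 \<times>\<times> P2" K Pair
    by unfold_locales (auto simp: DirProd_def)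
  interpret sw: product_group_algebra P2 P1 "P1 \<times>\<times> P2" K "\<lambda>h g. (g, h)"
    by (rule prod.swap)
  obtain n where nil: "C.alg.A.nil_set {u \<in> carrier C.A. C.aug u = \<zero>\<^bsub>K\<^esub>} n"
    using C.augmentation_ideal_nilpotent by blast
  show ?thesis
    unfolding A.alg.lie_solvable_HH1_iff B.alg.lie_solvable_HH1_iff C.alg.lie_solvable_HH1_iff
  proof (intro iffI conjI; (elim conjE)?)
    assume "solvable_modulo K (Der K C.A) (InnDer C.A)"
    then show "solvable_modulo K (Der K A.A) (InnDer A.A)" "solvable_modulo K (Der K B.A) (InnDer B.A)"
      by (rule prod.solvable_factor, rule sw.solvable_factor)
  next
    assume solvable: "solvable_modulo K (Der K A.A) (InnDer A.A)" "solvable_modulo K (Der K B.A) (InnDer B.A)"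
    show "solvable_modulo K (Der K C.A) (InnDer C.A)"
      by (rule prod.solvable_product[OF solvable _ _ nil])
        (rule A.aug_derivation_central[OF assms(3,2) solvable(1)]
          B.aug_derivation_central[OF assms(3,2) solvable(2)]; assumption)+
  qed
qed

end
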